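(* Let $T>0$ and let $\mathbf Z:[-T,T]\to\mathbb R^{2N}$ be a solution of $\dot{\mathbf Z}\in\operatorname{co}F(\mathbf Z)$, $\mathbf Z(0)=\mathbf Z_0$, where $\mathbf Z_0\in\mathcal D(F)$. Let $k\ne\ell$ be indices in $\{1,\dots,N\}$, and let $\mathbf Z_1\in\mathcal A_\ell\cap\mathcal A_k$ be such that $\mathbf Z_1\notin\mathcal A_i$ for all $i\ne k,\ell$, $\mathbf Z_1\notin\mathcal E_{\rm zero}\cup\mathcal S_\ell\cup\mathcal S_k$, and $$\mathbf f^{(+,+)}(\mathbf Z_1)\cdot\mathbf n_k(\mathbf Z_1)<0,\qquad \mathbf f^{(+,+)}(\mathbf Z_1)\cdot\mathbf n_\ell(\mathbf Z_1)<0,$$ $$\mathbf f^{(+,-)}(\mathbf Z_1)\cdot\mathbf n_k(\mathbf Z_1)<0,\qquad \mathbf f^{(+,-)}(\mathbf Z_1)\cdot\mathbf n_\ell(\mathbf Z_1)>0,$$ $$\mathbf f^{(-,+)}(\mathbf Z_1)\cdot\mathbf n_k(\mathbf Z_1)>0,\qquad \mathbf f^{(-,+)}(\mathbf Z_1)\cdot\mathbf n_\ell(\mathbf Z_1)<0,$$ $$\mathbf f^{(-,-)}(\mathbf Z_1)\cdot\mathbf n_k(\mathbf Z_1)>0,\qquad \mathbf f^{(-,-)}(\mathbf Z_1)\cdot\mathbf n_\ell(\mathbf Z_1)>0,$$ with $\mathbf f^{(\pm,\pm)}$, $\mathbf n_k$, $\mathbf n_\ell$ as defined in the context. Assume that there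 exists $t_1\in[-T,T)$ such that $\mathbf Z(t_1)=\mathbf Z_1$. Then there exists $\delta>0$ such that $\mathbf Z$ is unique in $[t_1,t_1+\delta]$ (i.e. any two solutions of the inclusion with value $\mathbf Z_1$ at time $t_1$ coincide on the part of $[t_1,t_1+\delta]$ where both are defined) and $\mathbf Z(t)\in\mathcal A_k\cap\mathcal A_\ell$ for all $t\in[t_1,t_1+\delta]$.
   Context: Setting. $\Omega\subset\mathbb R^2$ is a bounded simply connected open set with $C^{2,\gamma}$ boundary for some $\gamma\in(0,1)$, with outer unit normal $\mathbf n_\Omega$; $N\ge1$ is an integer, and $b_1,\dots,b_N\in\mathbb R$ are the Burgers moduli. Let $\mu>0$, $\lambda\neq0$ and $$\mathbf L=\begin{pmatrix}\mu&0\\0&\mu\lambda^2\end{pmatrix},\quad \mathbf J=\begin{pmatrix}0&1\\-1&0\end{pmatrix},\quad \boldsymbol\Lambda=\begin{pmatrix}\lambda&0\\0&1\end{pmatrix},\quad \mathbf k_i(\mathbf x;\mathbf y)=\frac{b_i}{2\pi}\frac{\lambda\mathbf J^T(\mathbf x-\mathbf y)}{|\boldsymbol\Lambda(\mathbf x-\mathbf y)|^2}\ (\mathbf x\ne\mathbf y).$$ Set $\mathcal D(F)=\{\mathbf Z=(\mathbf z_1,\dots,\mathbf z_N)\in\Omega^N:\ \mathbf z_j\neq\mathbf z_k\text{ for all }j\ne k\}\subset\mathbb R^{2N}$. For $\mathbf Z\in\mathcal D(F)$ let $u_0(\cdot;\mathbf z_1,\dots,\mathbf z_N)$ be the solution (unique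 up to an additive constant) of the Neumann problem $\operatorname{div}(\mathbf L\nabla_{\mathbf x}u_0)=0$ in $\Omega$, $\mathbf L(\nabla_{\mathbf x}u_0+\sum_{i=1}^N\mathbf k_i(\mathbf x;\mathbf z_i))\cdot\mathbf n_\Omega(\mathbf x)=0$ on $\partial\Omega$. The Peach-Köhler force on the $\ell$-th dislocation is $$\mathbf j_\ell(\mathbf Z)=b_\ell\,\mathbf J\mathbf L\Big[\sum_{i\ne\ell}\mathbf k_i(\mathbf z_\ell;\mathbf z_i)+\nabla_{\mathbf x}u_0(\mathbf z_\ell;\mathbf z_1,\dots,\mathbf z_N)\Big].$$ The set of glide directions $\mathcal G\subset S^1$ is a finite set of unit vectors of $\mathbb R^2$ with $-\mathbf g\in\mathcal G$ whenever $\mathbf g\in\mathcal G$ and $\operatorname{span}\mathcal G=\mathbb R^2$. Set $\mathcal G_\ell(\mathbf Z)=\arg\max_{\mathbf g\in\mathcal G}\{\mathbf j_\ell(\mathbf Z)\cdot\mathbf g\}$, $F_\ell(\mathbf Z)=\{(\mathbf j_\ell(\mathbf Z)\cdot\mathbf g)\mathbf g:\mathbf g\in\mathcal G_\ell(\mathbf Z)\}$, $F(\mathbf Z)=F_1(\mathbf Z)\times\cdots\times F_N(\mathbf Z)\subset\mathbb R^{2N}$. $\operatorname{co}$ denotes the convex hull. A solution of $\dot{\mathbf Z}\in\operatorname{co}F(\mathbf Z)$ on an interval $I$ is an absolutely continuous function $\mathbf Z$ on $I$ with $\mathbf Z(t)\in\mathcal D(F)$ for $t\in I$ and $\dot{\mathbf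 Z}(t)\in\operatorname{co}F(\mathbf Z(t))$ for a.e. $t\in I$. Ambiguity sets. $\mathcal A_\ell=\{\mathbf Z\in\mathcal D(F):\operatorname{card}\mathcal G_\ell(\mathbf Z)=2\}$; for $\mathbf Z\in\mathcal A_\ell$ write $\mathcal G_\ell(\mathbf Z)=\{\mathbf g_\ell^+(\mathbf Z),\mathbf g_\ell^-(\mathbf Z)\}$. If $\mathcal G_i(\mathbf Z)$ is a singleton, its element is denoted $\mathbf g_i(\mathbf Z)$. The singular set $\mathcal S_\ell$ is the set of $\mathbf Z^*\in\mathcal A_\ell$ such that, with the constant vector $\mathbf g_0=\mathbf g_\ell^+(\mathbf Z^* )-\mathbf g_\ell^-(\mathbf Z^* )$, the function $\mathbf Z\mapsto\mathbf j_\ell(\mathbf Z)\cdot\mathbf g_0$ and its full gradient in $\mathbb R^{2N}$ both vanish at $\mathbf Z^*$. $\mathcal E_{\rm zero}=\{\mathbf Z\in\mathcal D(F):\mathbf j_i(\mathbf Z)=\mathbf 0\text{ for some }i\}$. Local fields near $\mathbf Z_1$. For $\mathbf Z_1\in\mathcal A_\ell\cap\mathcal A_k$ with $\mathbf Z_1\notin\mathcal A_i$ for $i\ne k,\ell$ and $\mathbf Z_1\notin\mathcal E_{\rm zero}\cup\mathcal S_\ell\cup\mathcal S_k$, and for $h>0$ small, for each $m\in\{k,\ell\}$ the set $\mathcal A_m\cap B_h(\mathbf Z_1)$ is a smooth hypersurface separating $B_h(\mathbf Z_1)\subset\mathcal D(F)$ into two open sets $V_m^\pm$ with $\mathcal G_m(\mathbf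 Z)=\{\mathbf g_m^\pm\}$ for $\mathbf Z\in V_m^\pm$, where $\mathbf g_m^\pm:=\mathbf g_m^\pm(\mathbf Z_1)$; $\mathbf n_m$ is the unit normal to $\mathcal A_m$ pointing from $V_m^-$ to $V_m^+$. For $i\ne k,\ell$, $\mathcal G_i(\mathbf Z)=\{\mathbf g_i(\mathbf Z_1)\}$ on $B_h(\mathbf Z_1)$ and $\mathbf f_i(\mathbf Z):=(\mathbf j_i(\mathbf Z)\cdot\mathbf g_i(\mathbf Z_1))\mathbf g_i(\mathbf Z_1)$. For $m\in\{k,\ell\}$, $\widehat{\mathbf f}_m^\pm(\mathbf Z):=(\mathbf j_m(\mathbf Z)\cdot\mathbf g_m^\pm)\mathbf g_m^\pm$ on $B_h(\mathbf Z_1)$. For signs $\sigma,\tau\in\{+,-\}$, $\mathbf f^{(\sigma,\tau)}(\mathbf Z)\in\mathbb R^{2N}$ is the vector whose $k$-th ($\mathbb R^2$-valued) component is $\widehat{\mathbf f}_k^\sigma(\mathbf Z)$, whose $\ell$-th component is $\widehat{\mathbf f}_\ell^\tau(\mathbf Z)$, and whose $i$-th component is $\mathbf f_i(\mathbf Z)$ for $i\neq k,\ell$. *)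

theory Defs
  imports "HOL-Analysis.Analysis"
begin

type_synonym plane = "real^2"

text \<open>A configuration of \<open>N\<close> dislocations is an element of \<open>plane^'n\<close> with \<open>N = CARD('n) \<ge> 1\<close>;
  its Euclidean structure is that of \<open>\<real>\<^bsup>2N\<^esup>\<close>.\<close>

definition C2_holder :: "real \<Rightarrow> (real \<Rightarrow> real) \<Rightarrow> bool" where
  "C2_holder \<gamma> h \<longleftrightarrow>
     (\<exists>h' h''. (\<forall>s. (h has_real_derivative h' s) (at s)) \<and>
               (\<forall>s. (h' has_real_derivative h'' s) (at s)) \<and>
               (\<exists>C. \<forall>s t. \<bar>h'' s - h'' t\<bar> \<le> C * \<bar>s - t\<bar> powr \<gamma>))"

text \<open>Near the boundary point \<open>x\<close> the set lies strictly above the graph of \<open>h\<close>, in the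
  orthonormal frame \<open>(e, e')\<close>.\<close>

definition local_graph ::
    "real \<Rightarrow> plane set \<Rightarrow> plane \<Rightarrow> plane \<Rightarrow> plane \<Rightarrow> (real \<Rightarrow> real) \<Rightarrow> bool" where
  "local_graph \<gamma> \<Omega> x e e' h \<longleftrightarrow>
     norm e = 1 \<and> norm e' = 1 \<and> e \<bullet> e' = 0 \<and> C2_holder \<gamma> h \<and>
     (\<exists>r>0. \<Omega> \<inter> ball x r = {y \<in> ball x r. h (y \<bullet> e) < y \<bullet> e'})"

definition C2_holder_boundary :: "real \<Rightarrow> plane set \<Rightarrow> bool" where
  "C2_holder_boundary \<gamma> \<Omega> \<longleftrightarrow> (\<forall>x\<in>frontier \<Omega>. \<exists>e e' h. local_graph \<gamma> \<Omega> x e e' h)"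

definition outer_unit_normal :: "real \<Rightarrow> plane set \<Rightarrow> plane \<Rightarrow> plane \<Rightarrow> bool" where
  "outer_unit_normal \<gamma> \<Omega> x \<nu> \<longleftrightarrow>
     (\<exists>e e' h. local_graph \<gamma> \<Omega> x e e' h \<and>
        \<nu> = (1 / sqrt (1 + (deriv h (x \<bullet> e))\<^sup>2)) *\<^sub>R (deriv h (x \<bullet> e) *\<^sub>R e - e'))"

definition grad :: "(plane \<Rightarrow> real) \<Rightarrow> plane \<Rightarrow> plane" where
  "grad u x = (THE D. GDERIV u x :> D)"

definition divergence :: "(plane \<Rightarrow> plane) \<Rightarrow> plane \<Rightarrow> real" where
  "divergence V x = trace (jacobian V (at x))"

text \<open>The material parameters are \<open>\<mu>\<close> and \<open>lam\<close> (the anisotropy, usually written as the Greek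
  letter).\<close>

definition L_mat :: "real \<Rightarrow> real \<Rightarrow> real^2^2" where
  "L_mat \<mu> lam = vector [vector [\<mu>, 0], vector [0, \<mu> * lam\<^sup>2]]"

definition J_mat :: "real^2^2" where
  "J_mat = vector [vector [0, 1], vector [-1, 0]]"

definition Lambda_mat :: "real \<Rightarrow> real^2^2" where
  "Lambda_mat lam = vector [vector [lam, 0], vector [0, 1]]"

definition burgers_kernel :: "real \<Rightarrow> real \<Rightarrow> plane \<Rightarrow> plane \<Rightarrow> plane" where
  "burgers_kernel lam \<beta> x y =
     (\<beta> / (2 * pi)) *\<^sub>R ((lam / (norm (Lambda_mat lam *v (x - y)))\<^sup>2) *\<^sub>R (transpose J_mat *v (x - y)))"

definition configurations :: "plane set \<Rightarrow> (plane^'n) set" where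
  "configurations \<Omega> = {Z. (\<forall>i. Z $ i \<in> \<Omega>) \<and> (\<forall>i j. i \<noteq> j \<longrightarrow> Z $ i \<noteq> Z $ j)}"

text \<open>Classical solutions, of class \<open>C\<^sup>2\<close> inside and \<open>C\<^sup>1\<close> up to the boundary: on the
  boundary, \<open>Du\<close> is the continuous extension of the gradient.\<close>

definition neumann_solution ::
    "plane set \<Rightarrow> (plane \<Rightarrow> plane) \<Rightarrow> real \<Rightarrow> real \<Rightarrow> ('n \<Rightarrow> real) \<Rightarrow> plane^'n \<Rightarrow> (plane \<Rightarrow> real) \<Rightarrow> bool"
  where
  "neumann_solution \<Omega> nrm \<mu> lam b Z u \<longleftrightarrow>
     continuous_on (closure \<Omega>) u \<and>
     (\<exists>Du. continuous_on (closure \<Omega>) Du \<and>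
        (\<forall>x\<in>\<Omega>. GDERIV u x :> Du x) \<and>
        (\<exists>D2u :: plane \<Rightarrow> real^2^2. continuous_on \<Omega> D2u \<and>
           (\<forall>x\<in>\<Omega>. (Du has_derivative (\<lambda>v. D2u x *v v)) (at x))) \<and>
        (\<forall>x\<in>\<Omega>. divergence (\<lambda>y. L_mat \<mu> lam *v Du y) x = 0) \<and>
        (\<forall>x\<in>frontier \<Omega>.
           (L_mat \<mu> lam *v (Du x + (\<Sum>i\<in>UNIV. burgers_kernel lam (b i) x (Z $ i)))) \<bullet> nrm x = 0))"

definition peach_koehler ::
    "real \<Rightarrow> real \<Rightarrow> ('n \<Rightarrow> real) \<Rightarrow> (plane^'n \<Rightarrow> plane \<Rightarrow> real) \<Rightarrow> 'n::finite \<Rightarrow> plane^'n \<Rightarrow> plane" where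
  "peach_koehler \<mu> lam b u0 l Z =
     b l *\<^sub>R ((J_mat ** L_mat \<mu> lam) *v
       ((\<Sum>i\<in>UNIV - {l}. burgers_kernel lam (b i) (Z $ l) (Z $ i)) + grad (u0 Z) (Z $ l)))"

definition glide_directions :: "plane set \<Rightarrow> bool" where
  "glide_directions G \<longleftrightarrow>
     finite G \<and> (\<forall>g\<in>G. norm g = 1) \<and> (\<forall>g\<in>G. - g \<in> G) \<and> span G = UNIV"

text \<open>In the following, \<open>j i Z\<close> is the force on the \<open>i\<close>-th dislocation.\<close>

definition glide_set ::
    "plane set \<Rightarrow> ('n \<Rightarrow> plane^'n \<Rightarrow> plane) \<Rightarrow> 'n \<Rightarrow> plane^'n \<Rightarrow> plane set" where
  "glide_set G j l Z = {g. is_arg_max (\<lambda>g. j l Z \<bullet> g) (\<lambda>g. g \<in> G) g}"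

definition velocity_set ::
    "plane set \<Rightarrow> ('n \<Rightarrow> plane^'n \<Rightarrow> plane) \<Rightarrow> plane^'n \<Rightarrow> (plane^'n) set" where
  "velocity_set G j Z = {W. \<forall>l. W $ l \<in> (\<lambda>g. (j l Z \<bullet> g) *\<^sub>R g) ` glide_set G j l Z}"

definition absolutely_continuous_fun_on :: "real set \<Rightarrow> (real \<Rightarrow> 'a::real_normed_vector) \<Rightarrow> bool" where
  "absolutely_continuous_fun_on I f \<longleftrightarrow>
     (\<forall>\<epsilon>>0. \<exists>\<delta>>0. \<forall>P. finite P \<and> (\<forall>(s, t)\<in>P. s \<le> t \<and> s \<in> I \<and> t \<in> I) \<and>
          disjoint_family_on (\<lambda>(s, t). {s<..<t}) P \<and> (\<Sum>(s, t)\<in>P. t - s) < \<delta>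
        \<longrightarrow> (\<Sum>(s, t)\<in>P. norm (f t - f s)) < \<epsilon>)"

definition inclusion_solution ::
    "plane set \<Rightarrow> plane set \<Rightarrow> ('n \<Rightarrow> plane^'n \<Rightarrow> plane) \<Rightarrow> real set \<Rightarrow> (real \<Rightarrow> plane^'n) \<Rightarrow> bool" where
  "inclusion_solution \<Omega> G j I Z \<longleftrightarrow>
     absolutely_continuous_fun_on I Z \<and>
     (\<forall>t\<in>I. Z t \<in> configurations \<Omega>) \<and>
     (AE t in lebesgue. t \<in> I \<longrightarrow>
        (\<exists>v \<in> convex hull velocity_set G j (Z t). (Z has_vector_derivative v) (at t within I)))"

definition ambiguity_set ::
    "plane set \<Rightarrow> plane set \<Rightarrow> ('n \<Rightarrow> plane^'n \<Rightarrow> plane) \<Rightarrow> 'n \<Rightarrow> (plane^'n) set" where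
  "ambiguity_set \<Omega> G j l = {Z \<in> configurations \<Omega>. card (glide_set G j l Z) = 2}"

definition singular_set ::
    "plane set \<Rightarrow> plane set \<Rightarrow> ('n::finite \<Rightarrow> plane^'n \<Rightarrow> plane) \<Rightarrow> 'n \<Rightarrow> (plane^'n) set" where
  "singular_set \<Omega> G j l =
     {Z \<in> ambiguity_set \<Omega> G j l.
        \<exists>gp gm. glide_set G j l Z = {gp, gm} \<and> gp \<noteq> gm \<and>
          j l Z \<bullet> (gp - gm) = 0 \<and> GDERIV (\<lambda>Y. j l Y \<bullet> (gp - gm)) Z :> 0}"

definition zero_force_set ::
    "plane set \<Rightarrow> ('n \<Rightarrow> plane^'n \<Rightarrow> plane) \<Rightarrow> (plane^'n) set" where
  "zero_force_set \<Omega> j = {Z \<in> configurations \<Omega>. \<exists>i. j i Z = 0}"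

definition tangent_vectors :: "'a::real_normed_vector set \<Rightarrow> 'a \<Rightarrow> 'a set" where
  "tangent_vectors S p =
     {v. \<exists>c \<epsilon>. \<epsilon> > 0 \<and> c C1_differentiable_on {-\<epsilon><..<\<epsilon>} \<and> c ` {-\<epsilon><..<\<epsilon>} \<subseteq> S \<and>
         c 0 = p \<and> (c has_vector_derivative v) (at (0::real))}"

definition side_region ::
    "plane set \<Rightarrow> ('n::finite \<Rightarrow> plane^'n \<Rightarrow> plane) \<Rightarrow> 'n \<Rightarrow> plane^'n \<Rightarrow> real \<Rightarrow> plane \<Rightarrow> (plane^'n) set" where
  "side_region G j m Z1 h g = {Z \<in> ball Z1 h. glide_set G j m Z = {g}}"

text \<open>\<open>\<nu>\<close> is the unit normal at \<open>Z1\<close> to the ambiguity set of index \<open>m\<close>, pointing from the side where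
  \<open>gm\<close> is the only optimal glide direction to the side where \<open>gp\<close> is.\<close>

definition ambiguity_normal ::
    "plane set \<Rightarrow> plane set \<Rightarrow> ('n::finite \<Rightarrow> plane^'n \<Rightarrow> plane) \<Rightarrow> 'n \<Rightarrow> plane^'n \<Rightarrow>
      plane \<Rightarrow> plane \<Rightarrow> plane^'n \<Rightarrow> bool" where
  "ambiguity_normal \<Omega> G j m Z1 gp gm \<nu> \<longleftrightarrow>
     norm \<nu> = 1 \<and>
     (\<forall>v \<in> tangent_vectors (ambiguity_set \<Omega> G j m) Z1. v \<bullet> \<nu> = 0) \<and>
     (\<exists>h>0. ball Z1 h \<subseteq> configurations \<Omega> \<and>
        (\<forall>s\<in>{0<..<h}. Z1 + s *\<^sub>R \<nu> \<in> side_region G j m Z1 h gp \<and>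
                      Z1 - s *\<^sub>R \<nu> \<in> side_region G j m Z1 h gm))"

text \<open>The field whose \<open>k\<close>-th and \<open>l\<close>-th dislocations glide along \<open>gk\<close> and \<open>gl\<close>. The others glide
  along the direction frozen at \<open>Z1\<close>, where their optimal direction is unique.\<close>

definition local_field ::
    "plane set \<Rightarrow> ('n::finite \<Rightarrow> plane^'n \<Rightarrow> plane) \<Rightarrow> 'n \<Rightarrow> 'n \<Rightarrow> plane^'n \<Rightarrow>
      plane \<Rightarrow> plane \<Rightarrow> plane^'n \<Rightarrow> plane^'n" where
  "local_field G j k l Z1 gk gl Z =
     (\<chi> i. let g = (if i = k then gk else if i = l then gl else the_elem (glide_set G j i Z1))
          in (j i Z \<bullet> g) *\<^sub>R g)"

end

theory Submission
  imports Defs "HOL-Complex_Analysis.Complex_Analysis" "HOL-Real_Asymp.Real_Asymp"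
begin

text \<open>Near \<open>Z1\<close> the two ambiguity surfaces are the zero sets of the functions
\<open>\<phi> Z = j k Z \<bullet> (gkp - gkm)\<close> and \<open>\<psi> Z = j l Z \<bullet> (glp - glm)\<close>. The sign conditions say that every
admissible velocity on the side \<open>\<phi> > 0\<close> decreases \<open>\<phi>\<close> and every admissible velocity on the side
\<open>\<phi> < 0\<close> increases it, and likewise for \<open>\<psi>\<close>. A trajectory starting at \<open>Z1\<close> therefore cannot leave
\<open>{\<phi> = 0} \<inter> {\<psi> = 0}\<close>, and this set consists of ambiguous configurations.

For uniqueness, on the surface \<open>\<phi> = 0\<close> the two velocities \<open>(j k Z \<bullet> g) *\<^sub>R g\<close> with \<open>g = gkp\<close> and
\<open>g = gkm\<close> have the same factor \<open>j k Z \<bullet> g\<close>, so they differ by a multiple of the fixed vector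
\<open>E = axis k (gkp - gkm)\<close>. Hence the unknown sliding coefficients only appear in front of two fixed
vectors \<open>E\<close> and \<open>E'\<close>. A linear projection \<open>P\<close> along them removes these coefficients, so that the
velocity of \<open>P (W - W')\<close> is Lipschitz in \<open>W - W'\<close>; and the sign conditions make \<open>E, E'\<close> transversal
to the two surfaces, so \<open>P\<close> does not lose information about a difference of two points lying on both
surfaces. This is \<open>codimension_two_sliding\<close>. It works directly with absolutely continuous
functions; the fact behind it is \<open>absolutely_continuous_nonincreasing\<close>.

All this needs the force to depend in a \<open>C\<^sup>1\<close> way on the configuration, which is the second half of
the work, because the force contains the gradient of the solution \<open>u0 Z\<close> of a Neumann problem that
varies with \<open>Z\<close>. After a linear change of variables \<open>u0 Z\<close> is harmonic, its complex gradient is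
holomorphic, and the Neumann condition says that the harmonic conjugate of \<open>u0 Z\<close> has the explicit
boundary values \<open>burgers_log\<close>, up to a constant. The maximum principle and Cauchy's inequality then
bound every linear combination of the gradients of such solutions by the same linear combination
of explicit boundary values (\<open>neumann_interior_estimate\<close>). An estimate of this kind for linear
combinations of at most four solutions is enough to pass differentiability with Lipschitz
derivative from the boundary values to the gradients (\<open>four_point_transfer\<close>). Together these
give \<open>peach_koehler_locally_C11\<close>.

Finally, the unit normals of the statement are only characterised through tangent curves;
\<open>normal_of_C11_hypersurface\<close> shows that they are positive multiples of the gradients of \<open>\<phi>\<close> and \<open>\<psi>\<close>.\<close>

no_notation fps_nth (infixl \<open>$\<close> 75)

section \<open>Absolutely continuous functions\<close>

text \<open>The assumption bounds increments over intervals that contain \<open>t\<close> in any position, because the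
tag of an interval of a division need not be an endpoint. The exceptional null set lies in an open
set of small measure. A gauge forces the intervals tagged there into this set, and by absolute
continuity they contribute little in total; every other interval contributes at most \<open>e\<close> times its
length.\<close>

lemma absolutely_continuous_nonincreasing:
  fixes f :: "real \<Rightarrow> real"
  assumes ac: "absolutely_continuous_fun_on {a..b} f" and ab: "a \<le> b"
    and ae: "AE t in lebesgue. t \<in> {a<..<b} \<longrightarrow>
      (\<forall>e>0. \<exists>r>0. \<forall>u v. a \<le> u \<and> u \<le> t \<and> t \<le> v \<and> v \<le> b \<and> t - r < u \<and> v < t + r \<longrightarrow> f v - f u \<le> e * (v - u))"
  shows "f b \<le> f a"
proof -
  have bound: "f b - f a \<le> e + e * (b - a)" if e: "e > 0" for e
  proof -
    obtain d where d: "d > 0" and dP: "\<And>P. finite P \<Longrightarrow> (\<forall>(s, t)\<in>P. s \<le> t \<and> s \<in> {a..b} \<and> t \<in> {a..b}) \<Longrightarrow>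
          disjoint_family_on (\<lambda>(s, t). {s<..<t}) P \<Longrightarrow> (\<Sum>(s, t)\<in>P. t - s) < d
        \<Longrightarrow> (\<Sum>(s, t)\<in>P. norm (f t - f s)) < e"
      using ac e unfolding absolutely_continuous_fun_on_def by meson
    obtain N where N: "N \<in> null_sets lebesgue" and
      good: "\<And>t. t \<in> {a..b} - N \<Longrightarrow> (\<forall>e>0. \<exists>r>0. \<forall>u v. a \<le> u \<and> u \<le> t \<and> t \<le> v \<and> v \<le> b \<and> t - r < u \<and> v < t + r \<longrightarrow> f v - f u \<le> e * (v - u))"
    proof -
      define Q where "Q t \<longleftrightarrow> (\<forall>e>0. \<exists>r>0. \<forall>u v. a \<le> u \<and> u \<le> t \<and> t \<le> v \<and> v \<le> b \<and> t - r < u \<and> v < t + r \<longrightarrow> f v - f u \<le> e * (v - u))" for t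
      from ae have "AE t in lebesgue. t \<in> {a<..<b} \<longrightarrow> Q t" by (simp add: Q_def)
      then obtain N where sub: "{t \<in> space lebesgue. \<not> (t \<in> {a<..<b} \<longrightarrow> Q t)} \<subseteq> N"
        and N0: "emeasure lebesgue N = 0" and Ns: "N \<in> sets lebesgue" by (rule AE_E)
      have N: "N \<in> null_sets lebesgue" using N0 Ns by (rule null_setsI)
      have NQ: "Q t" if "t \<in> {a<..<b} - N" for t
      proof (rule ccontr)
        assume "\<not> Q t"
        then have "t \<in> {t \<in> space lebesgue. \<not> (t \<in> {a<..<b} \<longrightarrow> Q t)}"
          using that by simp
        with sub that show False by auto
      qed
      have "{a, b} \<in> null_sets lebesgue"
        by (simp add: negligible_iff_null_sets[symmetric] negligible_insert)
      with N have "N \<union> {a, b} \<in> null_sets lebesgue" by (rule null_sets.Un)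
      moreover have "Q t" if "t \<in> {a..b} - (N \<union> {a, b})" for t
        using that by (intro NQ) auto
      ultimately show thesis using that unfolding Q_def by blast
    qed
    obtain U where U: "open U" "N \<subseteq> U" "emeasure lebesgue (U - N) < ennreal d"
      using sets_lebesgue_outer_open[OF null_setsD2[OF N] d] by metis
    have Um: "emeasure lebesgue U < ennreal d"
    proof -
      have "emeasure lebesgue U \<le> emeasure lebesgue (U - N) + emeasure lebesgue N"
        using U N by (subst plus_emeasure) (auto simp: null_sets_def Un_absorb2 intro!: emeasure_mono)
      also have "\<dots> = emeasure lebesgue (U - N)" using N by auto
      finally show ?thesis using U by simp
    qed
    \<comment> \<open>\<open>P t r\<close>: the radius \<open>r\<close> is admissible for a gauge at \<open>t\<close>.\<close>
    define P where "P t r \<longleftrightarrow> (if t \<in> N then ball t r \<subseteq> U else (t \<in> {a..b} \<longrightarrow>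
        (\<forall>u v. a \<le> u \<and> u \<le> t \<and> t \<le> v \<and> v \<le> b \<and> t - r < u \<and> v < t + r \<longrightarrow> f v - f u \<le> e * (v - u))))" for t r
    have "\<exists>r>0. P t r" for t
    proof (cases "t \<in> N")
      case True
      then show ?thesis using U open_contains_ball[of U] by (auto simp: P_def)
    next
      case False
      show ?thesis
      proof (cases "t \<in> {a..b}")
        case True
        with False have "t \<in> {a..b} - N" by simp
        from good[OF this] e False show ?thesis by (auto simp: P_def)
      qed (use False in \<open>auto simp: P_def intro: exI[of _ 1]\<close>)
    qed
    then obtain r where rP: "\<And>t. r t > 0 \<and> P t (r t)" by metis
    have r: "\<And>t. r t > 0" "\<And>t. t \<in> N \<Longrightarrow> ball t (r t) \<subseteq> U"
      using rP by (auto simp: P_def split: if_splits)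
    have r3: "f v - f u \<le> e * (v - u)"
      if "t \<notin> N" "a \<le> u" "u \<le> t" "t \<le> v" "v \<le> b" "t - r t < u" "v < t + r t" for t u v
      using rP[of t] that by (simp add: P_def)
    have "gauge (\<lambda>t. ball t (r t))" using r by (simp add: gauge_ball_dependent)
    then obtain p where p: "p tagged_division_of {a..b}" "(\<lambda>t. ball t (r t)) fine p"
      using fine_division_exists_real by blast
    have finp: "finite p" using p by blast
    have K: "k = {Inf k..Sup k} \<and> Inf k \<le> x \<and> x \<le> Sup k \<and> a \<le> Inf k \<and> Sup k \<le> b \<and> x - r x < Inf k \<and> Sup k < x + r x" if mem: "(x, k) \<in> p" for x k
    proof -
      obtain c d where k: "k = {c..d}" using tagged_division_ofD(4)[OF p(1) mem] by auto
      have x: "x \<in> k" "k \<subseteq> {a..b}" using tagged_division_ofD(2,3)[OF p(1) mem] by auto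
      have "k \<subseteq> ball x (r x)" using p(2) mem by (auto simp: fine_def)
      moreover have "c \<in> k" "d \<in> k" using x k by auto
      ultimately have "c \<in> ball x (r x)" "d \<in> ball x (r x)" by auto
      then show ?thesis using x k by (auto simp: dist_real_def)
    qed
    have Keq: "k = {Inf k..Sup k}" if "(x, k) \<in> p" for x k using K[OF that] by blast
    have Kb: "Inf k \<le> x" "x \<le> Sup k" "Inf k \<le> Sup k" "a \<le> Inf k" "Sup k \<le> b" "x - r x < Inf k" "Sup k < x + r x"
      if "(x, k) \<in> p" for x k
      using K[OF that] by linarith+
    have tele: "(\<Sum>(x,k)\<in>p. f (Sup k) - f (Inf k)) = f b - f a"
      using additive_tagged_division_1[OF ab p(1), of f] .
    have len: "(\<Sum>(x,k)\<in>p. Sup k - Inf k) = b - a"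
      using additive_tagged_division_1[OF ab p(1), of "\<lambda>x. x"] .
    \<comment> \<open>the part of the division that is tagged in the exceptional set, as intervals \<open>(s, t)\<close>\<close>
    define pb where "pb = {xk \<in> p. fst xk \<in> N}"
    define h where "h = (\<lambda>(x::real, k::real set). (Inf k, Sup k))"
    have pbp: "pb \<subseteq> p" and finb: "finite pb" using finp by (auto simp: pb_def)
    have disj: "{Inf k<..<Sup k} \<inter> {Inf k'<..<Sup k'} = {}" if "(x,k) \<in> p" "(x',k') \<in> p" "(x,k) \<noteq> (x',k')" for x k x' k'
    proof -
      have "interior k \<inter> interior k' = {}" using tagged_division_ofD(5)[OF p(1) that] .
      moreover have "interior k = {Inf k<..<Sup k}" using Keq[OF that(1)] by (metis interior_atLeastAtMost_real)
      moreover have "interior k' = {Inf k'<..<Sup k'}" using Keq[OF that(2)] by (metis interior_atLeastAtMost_real)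
      ultimately show ?thesis by simp
    qed
    \<comment> \<open>Distinct members of the division give the same pair only if they are degenerate.\<close>
    have reidx: "sum g (h ` pb) = sum (g \<circ> h) pb" if "\<And>s. g (s,s) = (0::real)" for g
    proof (rule sum.reindex_nontrivial[OF finb])
      fix x y assume xy: "x \<in> pb" "y \<in> pb" "x \<noteq> y" "h x = h y"
      obtain x1 k1 x2 k2 where [simp]: "x = (x1,k1)" "y = (x2,k2)" by (cases x, cases y) auto
      have "{Inf k1<..<Sup k1} = {}"
        using disj[of x1 k1 x2 k2] xy pbp by (auto simp: h_def)
      moreover have "(x1, k1) \<in> p" using xy pbp by auto
      then have "Inf k1 \<le> x1" "x1 \<le> Sup k1" using Kb by blast+
      then have "Inf k1 \<le> Sup k1" by linarith
      ultimately have "Inf k1 = Sup k1" by force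
      then show "g (h x) = 0" using that by (simp add: h_def)
    qed
    have "(\<Sum>(s, t)\<in>h ` pb. norm (f t - f s)) < e"
    proof (rule dP)
      show "finite (h ` pb)" using finb by simp
      show cl: "\<forall>(s, t)\<in>h ` pb. s \<le> t \<and> s \<in> {a..b} \<and> t \<in> {a..b}"
      proof
        fix z assume "z \<in> h ` pb"
        then obtain x k where "(x, k) \<in> pb" and z: "z = (Inf k, Sup k)" by (auto simp: h_def)
        then have "(x, k) \<in> p" using pbp by auto
        with Kb[of x k] z show "case z of (s, t) \<Rightarrow> s \<le> t \<and> s \<in> {a..b} \<and> t \<in> {a..b}" by simp
      qed
      show dj: "disjoint_family_on (\<lambda>(s, t). {s<..<t}) (h ` pb)"
        unfolding disjoint_family_on_def
      proof (intro ballI impI)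
        fix i j assume "i \<in> h ` pb" "j \<in> h ` pb" and ij: "i \<noteq> j"
        then obtain x k x' k' where "(x, k) \<in> pb" "(x', k') \<in> pb"
          and z: "i = (Inf k, Sup k)" "j = (Inf k', Sup k')" by (auto simp: h_def)
        moreover have "(x, k) \<noteq> (x', k')" using z ij by auto
        ultimately show "(case i of (s, t) \<Rightarrow> {s<..<t}) \<inter> (case j of (s, t) \<Rightarrow> {s<..<t}) = {}"
          using disj[of x k x' k'] pbp by auto
      qed
      have nn: "(\<Sum>(s, t)\<in>h ` pb. t - s) \<ge> 0"
        using cl by (intro sum_nonneg) auto
      have "ennreal (\<Sum>(s, t)\<in>h ` pb. t - s) = ennreal (\<Sum>i\<in>h ` pb. snd i - fst i)"
        by (simp add: split_beta)
      also have "\<dots> = (\<Sum>i\<in>h ` pb. ennreal (snd i - fst i))"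
        using cl by (subst sum_ennreal) auto
      also have "\<dots> = (\<Sum>i\<in>h ` pb. emeasure lebesgue ((\<lambda>(s, t). {s<..<t}) i))"
        using cl by (intro sum.cong) (auto simp: split_beta)
      also have "\<dots> = emeasure lebesgue (\<Union>i\<in>h ` pb. (\<lambda>(s, t). {s<..<t}) i)"
        by (rule sum_emeasure[OF _ dj]) (auto simp: finb)
      also have "\<dots> \<le> emeasure lebesgue U"
      proof (rule emeasure_mono)
        show "(\<Union>i\<in>h ` pb. (\<lambda>(s, t). {s<..<t}) i) \<subseteq> U"
        proof
          fix y assume "y \<in> (\<Union>i\<in>h ` pb. (\<lambda>(s, t). {s<..<t}) i)"
          then obtain x k where xk: "(x, k) \<in> pb" and y: "y \<in> (case h (x,k) of (s, t) \<Rightarrow> {s<..<t})"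
            by auto
          have "(x, k) \<in> p" using xk pbp by auto
          then have "x - r x < Inf k" "Sup k < x + r x" using Kb by blast+
          then have "y \<in> ball x (r x)" using y by (auto simp: h_def dist_real_def)
          then show "y \<in> U" using r(2)[of x] xk by (auto simp: pb_def)
        qed
      qed (use U in auto)
      also have "\<dots> < ennreal d" by (rule Um)
      finally show "(\<Sum>(s, t)\<in>h ` pb. t - s) < d"
        using nn by (simp add: ennreal_less_iff)
    qed
    also have "(\<Sum>(s, t)\<in>h ` pb. norm (f t - f s)) = (\<Sum>(x,k)\<in>pb. norm (f (Sup k) - f (Inf k)))"
      by (subst reidx) (auto simp: h_def split_beta o_def)
    finally have "(\<Sum>(x,k)\<in>pb. norm (f (Sup k) - f (Inf k))) < e" .
    then have bad: "(\<Sum>(x,k)\<in>pb. f (Sup k) - f (Inf k)) \<le> e"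
    proof -
      have "(\<Sum>(x,k)\<in>pb. f (Sup k) - f (Inf k)) \<le> (\<Sum>(x,k)\<in>pb. norm (f (Sup k) - f (Inf k)))"
        by (intro sum_mono) auto
      also assume "\<dots> < e"
      finally show ?thesis by simp
    qed
    have "(\<Sum>(x,k)\<in>p - pb. f (Sup k) - f (Inf k)) \<le> (\<Sum>(x,k)\<in>p - pb. e * (Sup k - Inf k))"
    proof (intro sum_mono)
      fix i assume i: "i \<in> p - pb"
      obtain x k where [simp]: "i = (x, k)" by (cases i)
      have "(x, k) \<in> p" "x \<notin> N" using i by (auto simp: pb_def)
      then show "(case i of (x, k) \<Rightarrow> f (Sup k) - f (Inf k)) \<le> (case i of (x, k) \<Rightarrow> e * (Sup k - Inf k))"
        using Kb[of x k] r3[of x "Inf k" "Sup k"] by simp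
    qed
    also have "\<dots> \<le> (\<Sum>(x,k)\<in>p. e * (Sup k - Inf k))"
    proof (rule sum_mono2[OF finp])
      fix i assume "i \<in> p - (p - pb)"
      then show "0 \<le> (case i of (x, k) \<Rightarrow> e * (Sup k - Inf k))" using Kb(3)[of "fst i" "snd i"] e by (simp add: split_beta)
    qed auto
    also have "\<dots> = e * (b - a)" using len by (simp add: sum_distrib_left[symmetric] split_beta)
    finally have "(\<Sum>(x,k)\<in>p - pb. f (Sup k) - f (Inf k)) \<le> e * (b - a)" .
    with bad show ?thesis unfolding tele[symmetric] using sum.subset_diff[OF pbp finp, of "\<lambda>(x,k). f (Sup k) - f (Inf k)"]
      by simp
  qed
  show ?thesis
  proof (rule ccontr)
    assume "\<not> f b \<le> f a"
    then have pos: "f b - f a > 0" by simp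
    define e where "e = (f b - f a) / (2 * (1 + (b - a)))"
    have "e > 0" using pos ab by (simp add: e_def)
    from bound[OF this] have "f b - f a \<le> e * (1 + (b - a))" by (simp add: algebra_simps)
    also have "\<dots> = (f b - f a) / 2" using ab by (simp add: e_def divide_simps)
    finally show False using pos by simp
  qed
qed

text \<open>Splitting the increment at \<open>t\<close> gives two increments that start at \<open>t\<close>.\<close>

lemma has_vector_derivative_straddle:
  assumes "(W has_vector_derivative v) (at t within I)" "e > 0"
  shows "\<exists>r>0. \<forall>u\<in>I. \<forall>w\<in>I. u \<le> t \<and> t \<le> w \<and> t - r < u \<and> w < t + r \<longrightarrow>
           norm (W w - W u - (w - u) *\<^sub>R v) \<le> e * (w - u)"
proof -
  obtain r where r: "r > 0" and
    rP: "\<And>y. y \<in> I \<Longrightarrow> norm (y - t) < r \<Longrightarrow> norm (W y - W t - (y - t) *\<^sub>R v) \<le> e * norm (y - t)"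
    using assms unfolding has_vector_derivative_def has_derivative_within_alt by blast
  have "norm (W w - W u - (w - u) *\<^sub>R v) \<le> e * (w - u)"
    if "u \<in> I" "w \<in> I" "u \<le> t" "t \<le> w" "t - r < u" "w < t + r" for u w
  proof -
    have "W w - W u - (w - u) *\<^sub>R v = (W w - W t - (w - t) *\<^sub>R v) - (W u - W t - (u - t) *\<^sub>R v)"
      by (simp add: algebra_simps)
    then have "norm (W w - W u - (w - u) *\<^sub>R v)
        \<le> norm (W w - W t - (w - t) *\<^sub>R v) + norm (W u - W t - (u - t) *\<^sub>R v)"
      by (metis norm_triangle_ineq4)
    also have "\<dots> \<le> e * (w - t) + e * (t - u)"
      using rP[of w] rP[of u] that by auto
    finally show ?thesis by (simp add: algebra_simps)
  qed
  with r show ?thesis by blast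
qed

lemma absolutely_continuous_fun_on_subset:
  "absolutely_continuous_fun_on I f \<Longrightarrow> J \<subseteq> I \<Longrightarrow> absolutely_continuous_fun_on J f"
  unfolding absolutely_continuous_fun_on_def
  by (elim all_forward imp_forward ex_forward conj_forward)
     (blast | force)+

text \<open>Having two dominating functions covers both Lipschitz images and differences of trajectories.\<close>

lemma absolutely_continuous_fun_on_dominated:
  assumes f: "absolutely_continuous_fun_on I f" and g: "absolutely_continuous_fun_on I g"
    and dom: "\<And>s t. s \<in> I \<Longrightarrow> t \<in> I \<Longrightarrow> norm (h t - h s) \<le> L * (norm (f t - f s) + norm (g t - g s))"
    and L: "L \<ge> 0"
  shows "absolutely_continuous_fun_on I h"
  unfolding absolutely_continuous_fun_on_def
proof (intro allI impI)
  fix e :: real assume e: "e > 0"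
  define e' where "e' = e / (2 * (L + 1))"
  have e': "e' > 0" using e L by (simp add: e'_def)
  obtain d1 where d1: "d1 > 0" "\<And>P. finite P \<and> (\<forall>(s, t)\<in>P. s \<le> t \<and> s \<in> I \<and> t \<in> I) \<and>
          disjoint_family_on (\<lambda>(s, t). {s<..<t}) P \<and> (\<Sum>(s, t)\<in>P. t - s) < d1
        \<Longrightarrow> (\<Sum>(s, t)\<in>P. norm (f t - f s)) < e'"
    using f e' unfolding absolutely_continuous_fun_on_def by meson
  obtain d2 where d2: "d2 > 0" "\<And>P. finite P \<and> (\<forall>(s, t)\<in>P. s \<le> t \<and> s \<in> I \<and> t \<in> I) \<and>
          disjoint_family_on (\<lambda>(s, t). {s<..<t}) P \<and> (\<Sum>(s, t)\<in>P. t - s) < d2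
        \<Longrightarrow> (\<Sum>(s, t)\<in>P. norm (g t - g s)) < e'"
    using g e' unfolding absolutely_continuous_fun_on_def by meson
  have "(\<Sum>(s, t)\<in>P. norm (h t - h s)) < e"
    if P: "finite P \<and> (\<forall>(s, t)\<in>P. s \<le> t \<and> s \<in> I \<and> t \<in> I) \<and>
          disjoint_family_on (\<lambda>(s, t). {s<..<t}) P \<and> (\<Sum>(s, t)\<in>P. t - s) < min d1 d2" for P
  proof -
    have "(\<Sum>(s, t)\<in>P. norm (h t - h s)) \<le> (\<Sum>(s, t)\<in>P. L * (norm (f t - f s) + norm (g t - g s)))"
      using P dom by (intro sum_mono) auto
    also have "\<dots> = L * ((\<Sum>(s, t)\<in>P. norm (f t - f s)) + (\<Sum>(s, t)\<in>P. norm (g t - g s)))"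
      by (simp add: sum_distrib_left sum.distrib split_beta distrib_left)
    also have "\<dots> \<le> L * (e' + e')"
      using d1(2)[of P] d2(2)[of P] P L by (intro mult_left_mono add_mono) auto
    also have "\<dots> = L * e / (L + 1)" using L by (simp add: e'_def divide_simps)
    also have "\<dots> < e" using e L by (simp add: field_simps)
    finally show ?thesis .
  qed
  then show "\<exists>\<delta>>0. \<forall>P. finite P \<and> (\<forall>(s, t)\<in>P. s \<le> t \<and> s \<in> I \<and> t \<in> I) \<and>
          disjoint_family_on (\<lambda>(s, t). {s<..<t}) P \<and> (\<Sum>(s, t)\<in>P. t - s) < \<delta>
        \<longrightarrow> (\<Sum>(s, t)\<in>P. norm (h t - h s)) < e"
    using d1(1) d2(1) by (intro exI[of _ "min d1 d2"]) auto
qed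

lemma absolutely_continuous_fun_on_lipschitz:
  assumes f: "absolutely_continuous_fun_on I f"
    and dom: "\<And>s t. s \<in> I \<Longrightarrow> t \<in> I \<Longrightarrow> norm (h t - h s) \<le> L * norm (f t - f s)"
    and L: "L \<ge> 0"
  shows "absolutely_continuous_fun_on I h"
proof (rule absolutely_continuous_fun_on_dominated[OF f f _ L])
  fix s t assume st: "s \<in> I" "t \<in> I"
  have "L * norm (f t - f s) \<le> L * (norm (f t - f s) + norm (f t - f s))"
    using L by (intro mult_left_mono) auto
  with dom[OF st] show "norm (h t - h s) \<le> L * (norm (f t - f s) + norm (f t - f s))" by linarith
qed

lemma absolutely_continuous_fun_on_imp_continuous:
  assumes "absolutely_continuous_fun_on I f"
  shows "continuous_on I f"
  unfolding continuous_on_iff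
proof (intro ballI allI impI)
  fix x e assume x: "x \<in> I" and e: "(e::real) > 0"
  obtain d where d: "d > 0" and dP: "\<And>P. finite P \<and> (\<forall>(s, t)\<in>P. s \<le> t \<and> s \<in> I \<and> t \<in> I) \<and>
          disjoint_family_on (\<lambda>(s, t). {s<..<t}) P \<and> (\<Sum>(s, t)\<in>P. t - s) < d
        \<Longrightarrow> (\<Sum>(s, t)\<in>P. norm (f t - f s)) < e"
    using assms e unfolding absolutely_continuous_fun_on_def by meson
  have "dist (f y) (f x) < e" if y: "y \<in> I" "dist y x < d" for y
    using dP[of "{(x, y)}"] dP[of "{(y, x)}"] x y
    by (cases "x \<le> y") (simp_all add: disjoint_family_on_def dist_norm norm_minus_commute abs_if)
  with d show "\<exists>d>0. \<forall>x'\<in>I. dist x' x < d \<longrightarrow> dist (f x') (f x) < e" by blast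
qed

text \<open>The component of \<open>f t\<close> in the direction of the total displacement, minus \<open>B * t\<close>, is nonincreasing.\<close>

lemma absolutely_continuous_speed_bound:
  fixes f :: "real \<Rightarrow> 'a::real_inner"
  assumes ac: "absolutely_continuous_fun_on {a..b} f" and ab: "a \<le> b"
    and ae: "AE t in lebesgue. t \<in> {a<..<b} \<longrightarrow>
      (\<exists>v. (f has_vector_derivative v) (at t within {a..b}) \<and> norm v \<le> B)"
  shows "norm (f b - f a) \<le> B * (b - a)"
proof -
  define w where "w = sgn (f b - f a)"
  have nw: "norm w \<le> 1" by (simp add: w_def norm_sgn)
  define F where "F t = f t \<bullet> w - B * t" for t
  have "F b \<le> F a"
  proof (rule absolutely_continuous_nonincreasing[OF _ ab])
    have "absolutely_continuous_fun_on {a..b} (\<lambda>t::real. t)"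
      unfolding absolutely_continuous_fun_on_def
    proof (intro allI impI exI conjI)
      fix e :: real and P :: "(real \<times> real) set" assume "e > 0" and P: "finite P \<and> (\<forall>(s, t)\<in>P. s \<le> t \<and> s \<in> {a..b} \<and> t \<in> {a..b}) \<and>
          disjoint_family_on (\<lambda>(s, t). {s<..<t}) P \<and> (\<Sum>(s, t)\<in>P. t - s) < e"
      have "(\<Sum>(s, t)\<in>P. norm (t - s)) = (\<Sum>(s, t)\<in>P. t - s)"
        using P by (intro sum.cong) auto
      with P show "(\<Sum>(s, t)\<in>P. norm (t - s)) < e" by simp
    qed
    then show "absolutely_continuous_fun_on {a..b} F"
    proof (rule absolutely_continuous_fun_on_dominated[OF ac])
      fix s t
      have "norm (F t - F s) = \<bar>(f t - f s) \<bullet> w - B * (t - s)\<bar>"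
        by (simp add: F_def algebra_simps)
      also have "\<dots> \<le> \<bar>(f t - f s) \<bullet> w\<bar> + \<bar>B * (t - s)\<bar>" by linarith
      also have "\<bar>(f t - f s) \<bullet> w\<bar> \<le> norm (f t - f s) * 1"
        by (meson Cauchy_Schwarz_ineq2 mult_left_mono norm_ge_zero nw order_trans)
      also have "norm (f t - f s) * 1 + \<bar>B * (t - s)\<bar> \<le> (1 + \<bar>B\<bar>) * (norm (f t - f s) + norm (t - s))"
      proof -
        have "0 \<le> \<bar>B\<bar> * norm (f t - f s)" "0 \<le> norm (t - s)" by simp_all
        then show ?thesis unfolding abs_mult real_norm_def by (simp add: distrib_left distrib_right)
      qed
      finally show "norm (F t - F s) \<le> (1 + \<bar>B\<bar>) * (norm (f t - f s) + norm (t - s))" by simp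
    qed simp
    show "AE t in lebesgue. t \<in> {a<..<b} \<longrightarrow> (\<forall>e>0. \<exists>r>0. \<forall>u v. a \<le> u \<and> u \<le> t \<and> t \<le> v \<and> v \<le> b \<and> t - r < u \<and> v < t + r \<longrightarrow> F v - F u \<le> e * (v - u))"
      using ae
    proof (rule AE_mp, intro AE_I2 impI allI)
      fix t and e :: real assume t: "t \<in> {a<..<b} \<longrightarrow> (\<exists>v. (f has_vector_derivative v) (at t within {a..b}) \<and> norm v \<le> B)"
        "t \<in> {a<..<b}" and e: "e > 0"
      then obtain v where v: "(f has_vector_derivative v) (at t within {a..b})" "norm v \<le> B" by blast
      obtain r where r: "r > 0" and rP: "\<And>u w. u\<in>{a..b} \<Longrightarrow> w\<in>{a..b} \<Longrightarrow> u \<le> t \<and> t \<le> w \<and> t - r < u \<and> w < t + r \<Longrightarrow>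
           norm (f w - f u - (w - u) *\<^sub>R v) \<le> e * (w - u)"
        using has_vector_derivative_straddle[OF v(1) e] by blast
      have "F s - F u \<le> e * (s - u)" if "a \<le> u" "u \<le> t" "t \<le> s" "s \<le> b" "t - r < u" "s < t + r" for u s
      proof -
        have "F s - F u = (f s - f u - (s - u) *\<^sub>R v) \<bullet> w + (s - u) * (v \<bullet> w - B)"
          by (simp add: F_def algebra_simps)
        also have "(f s - f u - (s - u) *\<^sub>R v) \<bullet> w \<le> norm (f s - f u - (s - u) *\<^sub>R v) * 1"
          by (meson norm_cauchy_schwarz mult_left_mono norm_ge_zero nw order_trans)
        also have "norm (f s - f u - (s - u) *\<^sub>R v) \<le> e * (s - u)" using that rP by auto
        also have "v \<bullet> w \<le> norm v * 1"
          by (meson norm_cauchy_schwarz mult_left_mono norm_ge_zero nw order_trans)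
        finally have "F s - F u \<le> e * (s - u) * 1 + (s - u) * (norm v * 1 - B)" 
          using that by (auto simp: mult_left_mono)
        moreover have "(s - u) * (norm v * 1 - B) \<le> 0" using that v(2) by (simp add: mult_nonneg_nonpos)
        ultimately show ?thesis by simp
      qed
      with r show "\<exists>r>0. \<forall>u v. a \<le> u \<and> u \<le> t \<and> t \<le> v \<and> v \<le> b \<and> t - r < u \<and> v < t + r \<longrightarrow> F v - F u \<le> e * (v - u)"
        by blast
    qed
  qed
  moreover have "f b \<bullet> w - f a \<bullet> w = norm (f b - f a)"
  proof -
    have "f b \<bullet> w - f a \<bullet> w = (f b - f a) \<bullet> w" by (simp add: inner_diff_left)
    also have "\<dots> = norm (f b - f a)"
      unfolding w_def by (simp only: sgn_div_norm inner_scaleR_right dot_square_norm)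
        (cases "f b = f a", simp_all add: power2_eq_square)
    finally show ?thesis .
  qed
  ultimately show ?thesis by (simp add: F_def algebra_simps)
qed

text \<open>If \<open>f t > 0\<close>, then \<open>f\<close> is positive, hence nonincreasing, after the last time at which it is at most \<open>0\<close>.\<close>

lemma absolutely_continuous_barrier:
  fixes f :: "real \<Rightarrow> real"
  assumes ac: "absolutely_continuous_fun_on {a..b} f" and fa: "f a \<le> 0"
    and ae: "AE t in lebesgue. t \<in> {a<..<b} \<longrightarrow> f t > 0 \<longrightarrow>
      (\<exists>r>0. \<forall>u v. a \<le> u \<and> u \<le> t \<and> t \<le> v \<and> v \<le> b \<and> t - r < u \<and> v < t + r \<longrightarrow> f v \<le> f u)"
    and t: "t \<in> {a..b}"
  shows "f t \<le> 0"
proof (rule ccontr)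
  assume "\<not> f t \<le> 0"
  then have ft: "f t > 0" by simp
  define A where "A = {s \<in> {a..t}. f s \<le> 0}"
  have cont: "continuous_on {a..t} f"
    using absolutely_continuous_fun_on_imp_continuous[OF ac] t by (rule_tac continuous_on_subset) auto
  have A: "a \<in> A" "bdd_above A" "A \<subseteq> {a..t}" using fa t by (auto simp: A_def)
  have "closed A"
    unfolding A_def by (rule continuous_on_closed_Collect_le[OF cont]) auto
  then have sA: "Sup A \<in> A" using A closed_contains_Sup by blast
  define s where "s = Sup A"
  have s: "a \<le> s" "s \<le> t" "f s \<le> 0" using sA by (auto simp: A_def s_def)
  have pos: "f x > 0" if "x \<in> {s<..<t}" for x
  proof (rule ccontr)
    assume "\<not> f x > 0"
    then have "x \<in> A" using that s by (auto simp: A_def)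
    then have "x \<le> s" unfolding s_def using A(2) by (rule cSup_upper)
    with that show False by simp
  qed
  have "f t \<le> f s"
  proof (rule absolutely_continuous_nonincreasing[where f = f and a = s and b = t])
    show "absolutely_continuous_fun_on {s..t} f"
      using ac by (rule absolutely_continuous_fun_on_subset) (use s t in auto)
    show "AE x in lebesgue. x \<in> {s<..<t} \<longrightarrow> (\<forall>e>0. \<exists>r>0. \<forall>u v. s \<le> u \<and> u \<le> x \<and> x \<le> v \<and> v \<le> t \<and> x - r < u \<and> v < x + r \<longrightarrow> f v - f u \<le> e * (v - u))"
      using ae
    proof (rule AE_mp, intro AE_I2 impI allI)
      fix x and e :: real assume x: "x \<in> {a<..<b} \<longrightarrow> f x > 0 \<longrightarrow>
      (\<exists>r>0. \<forall>u v. a \<le> u \<and> u \<le> x \<and> x \<le> v \<and> v \<le> b \<and> x - r < u \<and> v < x + r \<longrightarrow> f v \<le> f u)" "x \<in> {s<..<t}" "e > 0"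
      then obtain r where r: "r > 0" "\<And>u v. a \<le> u \<and> u \<le> x \<and> x \<le> v \<and> v \<le> b \<and> x - r < u \<and> v < x + r \<Longrightarrow> f v \<le> f u"
        using pos[of x] s t by auto
      show "\<exists>r>0. \<forall>u v. s \<le> u \<and> u \<le> x \<and> x \<le> v \<and> v \<le> t \<and> x - r < u \<and> v < x + r \<longrightarrow> f v - f u \<le> e * (v - u)"
      proof (intro exI[of _ r] conjI r(1) allI impI)
        fix u v assume uv: "s \<le> u \<and> u \<le> x \<and> x \<le> v \<and> v \<le> t \<and> x - r < u \<and> v < x + r"
        have "f v \<le> f u" using uv s t by (intro r(2)) auto
        moreover have "0 \<le> e * (v - u)" using uv x(3) by simp
        ultimately show "f v - f u \<le> e * (v - u)" by linarith
      qed
    qed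
  qed (use s in auto)
  with s ft show False by simp
qed

section \<open>Families with uniformly bounded and uniformly Lipschitz derivatives\<close>

text \<open>One constant \<open>B\<close> serves all indices \<open>q\<close>, so that suprema over \<open>q\<close> can be taken although \<open>Q\<close> is a
mere set. In the application \<open>q\<close> ranges over points at which data of a boundary value problem are
evaluated.\<close>

definition uniformly_C11 ::
    "'q set \<Rightarrow> 'a::real_normed_vector set \<Rightarrow> ('q \<Rightarrow> 'a \<Rightarrow> 'b::real_normed_vector) \<Rightarrow> bool" where
  "uniformly_C11 Q S g \<longleftrightarrow> (\<exists>g' B. \<forall>q\<in>Q. \<forall>x\<in>S. (g q has_derivative g' q x) (at x) \<and>
      norm (g q x) \<le> B \<and> (\<forall>v. norm (g' q x v) \<le> B * norm v) \<and>
      (\<forall>y\<in>S. \<forall>v. norm (g' q x v - g' q y v) \<le> B * norm (x - y) * norm v))"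

lemma uniformly_C11I:
  fixes g :: "'q \<Rightarrow> 'b::real_normed_vector \<Rightarrow> 'c::real_normed_vector"
  assumes "\<And>q x. q \<in> Q \<Longrightarrow> x \<in> S \<Longrightarrow> (g q has_derivative g' q x) (at x)"
    and "\<And>q x. q \<in> Q \<Longrightarrow> x \<in> S \<Longrightarrow> norm (g q x) \<le> B1"
    and "\<And>q x v. q \<in> Q \<Longrightarrow> x \<in> S \<Longrightarrow> norm (g' q x v) \<le> B2 * norm v"
    and "\<And>q x y v. q \<in> Q \<Longrightarrow> x \<in> S \<Longrightarrow> y \<in> S \<Longrightarrow> norm (g' q x v - g' q y v) \<le> B3 * norm (x - y) * norm v"
  shows "uniformly_C11 Q S g"
  unfolding uniformly_C11_def
proof (intro exI[of _ g'] exI[of _ "max B1 (max B2 B3)"] ballI conjI allI)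
  fix q x assume q: "q \<in> Q" and x: "x \<in> S"
  show "(g q has_derivative g' q x) (at x)" using assms(1) q x .
  show "norm (g q x) \<le> max B1 (max B2 B3)" using assms(2)[OF q x] by simp
  show "norm (g' q x v) \<le> max B1 (max B2 B3) * norm v" for v
    using assms(3)[OF q x, of v] by (rule order_trans) (intro mult_right_mono, auto)
  fix y and v :: 'b assume y: "y \<in> S"
  have "B3 * norm (x - y) * norm v \<le> max B1 (max B2 B3) * norm (x - y) * norm v"
    by (intro mult_right_mono) auto
  then show "norm (g' q x v - g' q y v) \<le> max B1 (max B2 B3) * norm (x - y) * norm v"
    using assms(4)[OF q x y, of v] by linarith
qed

text \<open>Besides witnesses for \<open>uniformly_C11\<close>, this contains two consequences of the mean value inequality
on convex sets, namely the Lipschitz bound and the quadratic Taylor estimate.\<close>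

definition C11_data ::
    "'q set \<Rightarrow> 'a::real_normed_vector set \<Rightarrow> ('q \<Rightarrow> 'a \<Rightarrow> 'b::real_normed_vector) \<Rightarrow> ('q \<Rightarrow> 'a \<Rightarrow> 'a \<Rightarrow> 'b) \<Rightarrow> real \<Rightarrow> bool" where
  "C11_data Q S g g' B \<longleftrightarrow> B > 0 \<and>
    (\<forall>q\<in>Q. \<forall>x\<in>S. (g q has_derivative g' q x) (at x) \<and> norm (g q x) \<le> B \<and>
      (\<forall>v. norm (g' q x v) \<le> B * norm v) \<and>
      (\<forall>y\<in>S. (\<forall>v. norm (g' q x v - g' q y v) \<le> B * norm (x - y) * norm v) \<and>
        norm (g q x - g q y) \<le> B * norm (x - y) \<and>
        norm (g q y - g q x - g' q x (y - x)) \<le> B * norm (y - x) * norm (y - x)))"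

lemma C11_dataD:
  assumes "C11_data Q S g g' B"
  shows "B > 0"
    "\<And>q x. q \<in> Q \<Longrightarrow> x \<in> S \<Longrightarrow> (g q has_derivative g' q x) (at x)"
    "\<And>q x. q \<in> Q \<Longrightarrow> x \<in> S \<Longrightarrow> norm (g q x) \<le> B"
    "\<And>q x v. q \<in> Q \<Longrightarrow> x \<in> S \<Longrightarrow> norm (g' q x v) \<le> B * norm v"
    "\<And>q x y v. q \<in> Q \<Longrightarrow> x \<in> S \<Longrightarrow> y \<in> S \<Longrightarrow> norm (g' q x v - g' q y v) \<le> B * norm (x - y) * norm v"
    "\<And>q x y. q \<in> Q \<Longrightarrow> x \<in> S \<Longrightarrow> y \<in> S \<Longrightarrow> norm (g q x - g q y) \<le> B * norm (x - y)"
    "\<And>q x y. q \<in> Q \<Longrightarrow> x \<in> S \<Longrightarrow> y \<in> S \<Longrightarrow> norm (g q y - g q x - g' q x (y - x)) \<le> B * norm (y - x) * norm (y - x)"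
  using assms unfolding C11_data_def by blast+

lemma uniformly_C11E:
  fixes g :: "'q \<Rightarrow> 'b::real_normed_vector \<Rightarrow> 'c::real_normed_vector"
  assumes "uniformly_C11 Q S g" "convex S"
  shows "\<exists>g' B. C11_data Q S g g' B"
proof -
  obtain g' B0 where B0: "\<And>q x. q \<in> Q \<Longrightarrow> x \<in> S \<Longrightarrow> (g q has_derivative g' q x) (at x)"
    "\<And>q x. q \<in> Q \<Longrightarrow> x \<in> S \<Longrightarrow> norm (g q x) \<le> B0"
    "\<And>q x v. q \<in> Q \<Longrightarrow> x \<in> S \<Longrightarrow> norm (g' q x v) \<le> B0 * norm v"
    "\<And>q x y v. q \<in> Q \<Longrightarrow> x \<in> S \<Longrightarrow> y \<in> S \<Longrightarrow> norm (g' q x v - g' q y v) \<le> B0 * norm (x - y) * norm v"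
    using assms(1) unfolding uniformly_C11_def by blast
  define B where "B = max B0 1"
  have B: "B > 0" "B0 \<le> B" by (auto simp: B_def)
  have 3: "norm (g' q x v) \<le> B * norm v" if "q \<in> Q" "x \<in> S" for q x v
    using B0(3)[OF that, of v] B(2) by (meson mult_right_mono norm_ge_zero order_trans)
  have 4: "norm (g' q x v - g' q y v) \<le> B * norm (x - y) * norm v" if "q \<in> Q" "x \<in> S" "y \<in> S" for q x y v
    using B0(4)[OF that, of v] B(2) by (meson mult_right_mono norm_ge_zero order_trans)
  have 6: "norm (g q x - g q y) \<le> B * norm (x - y)" if "q \<in> Q" "x \<in> S" "y \<in> S" for q x y
    proof (rule differentiable_bound[OF assms(2) _ _ that(2,3)])
      show "(g q has_derivative g' q x) (at x within S)" if "x \<in> S" for x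
        using B0(1)[OF \<open>q \<in> Q\<close> that] by (rule has_derivative_at_withinI)
      show "onorm (g' q x) \<le> B" if "x \<in> S" for x
        using 3[OF \<open>q \<in> Q\<close> that] B by (intro onorm_bound) auto
    qed
  have 7: "norm (g q y - g q x - g' q x (y - x)) \<le> B * norm (y - x) * norm (y - x)" if q: "q \<in> Q" and xy: "x \<in> S" "y \<in> S" for q x y
    proof -
      have sub: "closed_segment x y \<subseteq> S" using assms(2) xy by (simp add: closed_segment_subset)
      have "norm (g q y - g q x - g' q x (y - x)) \<le> norm (y - x) * (B * norm (y - x))"
      proof (rule differentiable_bound_linearization[where S = "closed_segment x y"])
        show "x + t *\<^sub>R (y - x) \<in> closed_segment x y" if "t \<in> {0..1}" for t
          using that unfolding closed_segment_def by (auto simp: algebra_simps intro!: exI[of _ t])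
        show "(g q has_derivative g' q z) (at z within closed_segment x y)" if "z \<in> closed_segment x y" for z
          using B0(1)[OF q, of z] that sub by (auto intro: has_derivative_at_withinI)
        show "onorm (g' q z - g' q x) \<le> B * norm (y - x)" if z: "z \<in> closed_segment x y" for z
          unfolding fun_diff_def
        proof (rule onorm_bound)
          fix v :: 'b
          have "norm (z - x) \<le> norm (y - x)" using z segment_bound(1) by blast
          then have "B * norm (z - x) * norm v \<le> B * norm (y - x) * norm v"
            using B by (intro mult_right_mono mult_left_mono) auto
          then show "norm (g' q z v - g' q x v) \<le> B * norm (y - x) * norm v"
            using 4[OF q, of z x v] z sub xy by force
        qed (use B in auto)
      qed auto
      then show ?thesis by (simp add: mult_ac)
    qed
  have 2: "norm (g q x) \<le> B" if "q \<in> Q" "x \<in> S" for q x using B0(2)[OF that] B(2) by linarith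
  show ?thesis unfolding C11_data_def using B(1) B0(1) 2 3 4 6 7 by (intro exI[of _ g'] exI[of _ B]) blast
qed

lemma uniformly_C11_const:
  assumes "\<And>q. q \<in> Q \<Longrightarrow> norm (c q) \<le> B"
  shows "uniformly_C11 Q S (\<lambda>q x. c q)"
  by (rule uniformly_C11I[where g' = "\<lambda>q x v. 0" and ?B1.0 = B and ?B2.0 = 0 and ?B3.0 = 0])
     (use assms in auto)

lemma uniformly_C11_linear:
  assumes "bounded_linear L" "bounded S"
  shows "uniformly_C11 Q S (\<lambda>q x. L x)"
proof -
  obtain K where K: "K \<ge> 0" "\<And>x. norm (L x) \<le> norm x * K"
    using bounded_linear.nonneg_bounded[OF assms(1)] by blast
  obtain R where R: "\<And>x. x \<in> S \<Longrightarrow> norm x \<le> R" using assms(2) by (auto simp: bounded_iff)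
  show ?thesis
  proof (rule uniformly_C11I[where g' = "\<lambda>q x. L" and ?B1.0 = "R * K" and ?B2.0 = K and ?B3.0 = 0])
    show "norm (L x) \<le> R * K" if "x \<in> S" for x
      using K(2)[of x] R[OF that] K(1) by (meson mult_right_mono order_trans)
  qed (use assms K in \<open>auto intro: bounded_linear_imp_has_derivative simp: mult_ac\<close>)
qed

lemma uniformly_C11_compose_linear:
  fixes f :: "'q \<Rightarrow> 'a::real_normed_vector \<Rightarrow> 'b::real_normed_vector"
  assumes f: "uniformly_C11 Q S f" and S: "convex S" and T: "bounded_linear T"
  shows "uniformly_C11 Q S (\<lambda>q x. T (f q x))"
proof -
  obtain K where K: "K \<ge> 0" "\<And>x. norm (T x) \<le> norm x * K"
    using bounded_linear.nonneg_bounded[OF T] by blast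
  obtain f' B where f_data: "C11_data Q S f f' B"
    using uniformly_C11E[OF f S] by blast
  note B = C11_dataD[OF f_data]
  have mono: "norm (T z) \<le> K * c" if "norm z \<le> c" for z c
    using K(2)[of z] mult_right_mono[OF that K(1)] by (simp add: mult_ac)
  show ?thesis
  proof (rule uniformly_C11I[where g' = "\<lambda>q x v. T (f' q x v)" and ?B1.0 = "K * B" and ?B2.0 = "K * B" and ?B3.0 = "K * B"])
    show "norm (T (f' q x v)) \<le> K * B * norm v" if "q \<in> Q" "x \<in> S" for q x v
      using mono[OF B(4)[OF that]] by (simp add: mult_ac)
    show "norm (T (f' q x v) - T (f' q y v)) \<le> K * B * norm (x - y) * norm v" if "q \<in> Q" "x \<in> S" "y \<in> S" for q x y v
      using mono[OF B(5)[OF that]] by (simp add: mult_ac linear_diff[OF bounded_linear.linear[OF T]])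
  qed (use B mono in \<open>auto intro: bounded_linear.has_derivative[OF T]\<close>)
qed

lemma uniformly_C11_add:
  fixes f :: "'q \<Rightarrow> 'a::real_normed_vector \<Rightarrow> 'b::real_normed_vector"
  assumes f: "uniformly_C11 Q S f" and g: "uniformly_C11 Q S g" and S: "convex S"
  shows "uniformly_C11 Q S (\<lambda>q x. f q x + g q x)"
proof -
  obtain f' B where f_data: "C11_data Q S f f' B"
    using uniformly_C11E[OF f S] by blast
  note B = C11_dataD[OF f_data]
  obtain g' C where g_data: "C11_data Q S g g' C"
    using uniformly_C11E[OF g S] by blast
  note C = C11_dataD[OF g_data]
  show ?thesis
  proof (rule uniformly_C11I[where g' = "\<lambda>q x v. f' q x v + g' q x v" and ?B1.0 = "B + C" and ?B2.0 = "B + C" and ?B3.0 = "B + C"])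
    fix q x y and v :: 'a assume q: "q \<in> Q" "x \<in> S"
    show "norm (f q x + g q x) \<le> B + C" using norm_triangle_mono[OF B(3)[OF q] C(3)[OF q]] .
    show "norm (f' q x v + g' q x v) \<le> (B + C) * norm v"
      using norm_triangle_mono[OF B(4)[OF q] C(4)[OF q]] by (simp add: algebra_simps)
    assume y: "y \<in> S"
    have eq: "f' q x v + g' q x v - (f' q y v + g' q y v) = (f' q x v - f' q y v) + (g' q x v - g' q y v)" by simp
    show "norm (f' q x v + g' q x v - (f' q y v + g' q y v)) \<le> (B + C) * norm (x - y) * norm v"
      unfolding eq using norm_triangle_mono[OF B(5)[OF q y, of v] C(5)[OF q y, of v]] by (simp add: distrib_right)
  qed (use B(2) C(2) in \<open>auto intro: has_derivative_add\<close>)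
qed

lemma uniformly_C11_sum:
  assumes "finite I" "\<And>i. i \<in> I \<Longrightarrow> uniformly_C11 Q S (f i)" "convex S"
  shows "uniformly_C11 Q S (\<lambda>q x. \<Sum>i\<in>I. f i q x)"
  using assms(1,2)
proof (induction I rule: finite_induct)
  case empty
  then show ?case by (simp add: uniformly_C11_const[where B = 0])
next
  case (insert i I)
  then show ?case by (simp add: uniformly_C11_add[OF _ _ assms(3)])
qed

text \<open>The Lipschitz estimate of the product rule, \<open>a * b - c * d = (a - c) * b + c * (b - d)\<close>.\<close>

lemma product_difference_bound:
  fixes a b c d :: "'a::real_normed_algebra"
  assumes "norm (a - c) \<le> A1" "norm b \<le> B1" "norm c \<le> A2" "norm (b - d) \<le> B2"
  shows "norm (a * b - c * d) \<le> A1 * B1 + A2 * B2"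
proof -
  have "a * b - c * d = (a - c) * b + c * (b - d)" by (simp add: algebra_simps)
  then have "norm (a * b - c * d) \<le> norm ((a - c) * b) + norm (c * (b - d))" by (metis norm_triangle_ineq)
  also have "\<dots> \<le> norm (a - c) * norm b + norm c * norm (b - d)" by (intro add_mono norm_mult_ineq)
  also have "\<dots> \<le> A1 * B1 + A2 * B2"
    using assms by (intro add_mono mult_mono') auto
  finally show ?thesis .
qed

lemma uniformly_C11_mult:
  fixes f g :: "'q \<Rightarrow> 'a::real_normed_vector \<Rightarrow> 'b::real_normed_algebra"
  assumes f: "uniformly_C11 Q S f" and g: "uniformly_C11 Q S g" and S: "convex S"
  shows "uniformly_C11 Q S (\<lambda>q x. f q x * g q x)"
proof -
  obtain f' B where f_data: "C11_data Q S f f' B"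
    using uniformly_C11E[OF f S] by blast
  note B = C11_dataD[OF f_data]
  obtain g' C where g_data: "C11_data Q S g g' C"
    using uniformly_C11E[OF g S] by blast
  note C = C11_dataD[OF g_data]
  show ?thesis
  proof (rule uniformly_C11I[where g' = "\<lambda>q x v. f q x * g' q x v + f' q x v * g q x"
        and ?B1.0 = "B * C" and ?B2.0 = "2 * B * C" and ?B3.0 = "4 * B * C"])
    fix q x y and v :: 'a assume q: "q \<in> Q" "x \<in> S"
    have mm: "norm (a * b) \<le> A * A'" if "norm a \<le> A" "norm b \<le> A'" for a b :: 'b and A A'
      using norm_mult_ineq[of a b] mult_mono'[OF that] by force
    show "norm (f q x * g q x) \<le> B * C" using mm[OF B(3)[OF q] C(3)[OF q]] .
    show "norm (f q x * g' q x v + f' q x v * g q x) \<le> 2 * B * C * norm v"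
      using norm_triangle_mono[OF mm[OF B(3)[OF q] C(4)[OF q, of v]] mm[OF B(4)[OF q, of v] C(3)[OF q]]] by (simp add: mult_ac)
    assume y: "y \<in> S"
    have "norm ((f q x * g' q x v - f q y * g' q y v) + (f' q x v * g q x - f' q y v * g q y))
        \<le> ((B * norm (x - y)) * (C * norm v) + B * (C * norm (x - y) * norm v))
         + ((B * norm (x - y) * norm v) * C + (B * norm v) * (C * norm (x - y)))"
      using q y B C by (intro norm_triangle_mono product_difference_bound) auto
    then show "norm (f q x * g' q x v + f' q x v * g q x - (f q y * g' q y v + f' q y v * g q y))
        \<le> 4 * B * C * norm (x - y) * norm v"
      by (simp add: algebra_simps)
  qed (use B(2) C(2) in \<open>auto intro!: has_derivative_mult\<close>)
qed

lemma inverse_difference_bound: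
  fixes a b :: "'a::real_normed_field"
  assumes "d \<le> norm a" "d \<le> norm b" "d > 0"
  shows "norm (inverse a - inverse b) \<le> norm (a - b) / d^2"
proof -
  have nz: "a \<noteq> 0" "b \<noteq> 0" using assms by auto
  have "norm (inverse a - inverse b) = norm (a - b) / (norm a * norm b)"
    using nz by (simp add: division_ring_inverse_diff norm_mult norm_inverse divide_inverse mult_ac)
       (metis norm_minus_commute)
  also have "\<dots> \<le> norm (a - b) / (d * d)"
    using assms by (intro divide_left_mono mult_mono) (auto intro!: mult_pos_pos)
  finally show ?thesis by (simp add: power2_eq_square)
qed

lemma uniformly_C11_inverse:
  fixes f :: "'q \<Rightarrow> 'a::real_normed_vector \<Rightarrow> 'b::real_normed_field"
  assumes f: "uniformly_C11 Q S f" and S: "convex S"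
    and d: "d > 0" "\<And>q x. q \<in> Q \<Longrightarrow> x \<in> S \<Longrightarrow> d \<le> norm (f q x)"
  shows "uniformly_C11 Q S (\<lambda>q x. inverse (f q x))"
proof -
  obtain f' B where f_data: "C11_data Q S f f' B"
    using uniformly_C11E[OF f S] by blast
  note B = C11_dataD[OF f_data]
  define D where "D = 1 / d"
  have D: "D > 0" using d by (simp add: D_def)
  have iD: "norm (inverse (f q x)) \<le> D" if "q \<in> Q" "x \<in> S" for q x
    using d(2)[OF that] d(1) unfolding norm_inverse D_def by (simp add: inverse_eq_divide frac_le)
  have iL: "norm (inverse (f q x) - inverse (f q y)) \<le> D^2 * B * norm (x - y)" if "q \<in> Q" "x \<in> S" "y \<in> S" for q x y
  proof -
    have "norm (inverse (f q x) - inverse (f q y)) \<le> norm (f q x - f q y) / d^2"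
      using d that by (intro inverse_difference_bound) auto
    also have "\<dots> \<le> (B * norm (x - y)) / d^2" using B(6)[OF that] by (intro divide_right_mono) auto
    finally show ?thesis by (simp add: D_def power_divide)
  qed
  show ?thesis
  proof (rule uniformly_C11I[where g' = "\<lambda>q x v. - (inverse (f q x) * f' q x v * inverse (f q x))"
        and ?B1.0 = "D" and ?B2.0 = "D * B * D" and ?B3.0 = "D^2 * B * B * D + D * B * D + D * B * (D^2 * B)"])
    fix q x y and v :: 'a assume q: "q \<in> Q" "x \<in> S"
    show "((\<lambda>x. inverse (f q x)) has_derivative (\<lambda>v. - (inverse (f q x) * f' q x v * inverse (f q x)))) (at x)"
      using d(2)[OF q] d(1) by (intro Deriv.has_derivative_inverse B(2) q) auto
    show "norm (inverse (f q x)) \<le> D" using iD q by blast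
    show "norm (- (inverse (f q x) * f' q x v * inverse (f q x))) \<le> D * B * D * norm v"
    proof -
      have "norm (inverse (f q x)) * norm (f' q x v) * norm (inverse (f q x)) \<le> D * (B * norm v) * D"
        using iD[OF q] B(4)[OF q, of v] D B(1) by (intro mult_mono) auto
      then show ?thesis by (simp add: norm_mult mult_ac)
    qed
    assume y: "y \<in> S"
    have "norm ((inverse (f q x) * f' q x v) * inverse (f q x) - (inverse (f q y) * f' q y v) * inverse (f q y))
       \<le> ((D^2 * B * norm (x - y)) * (B * norm v) + D * (B * norm (x - y) * norm v)) * D
          + (D * (B * norm v)) * (D^2 * B * norm (x - y))"
    proof (rule product_difference_bound)
      show "norm (inverse (f q x) * f' q x v - inverse (f q y) * f' q y v)
          \<le> (D^2 * B * norm (x - y)) * (B * norm v) + D * (B * norm (x - y) * norm v)"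
        using q y B iD iL by (intro product_difference_bound) auto
      have "norm (inverse (f q y)) * norm (f' q y v) \<le> D * (B * norm v)"
        using iD[OF q(1) y] B(4)[OF q(1) y, of v] D B(1) by (intro mult_mono) auto
      then show "norm (inverse (f q y) * f' q y v) \<le> D * (B * norm v)" by (simp add: norm_mult)
    qed (use iD iL q y in auto)
    then show "norm (- (inverse (f q x) * f' q x v * inverse (f q x)) - - (inverse (f q y) * f' q y v * inverse (f q y)))
        \<le> (D^2 * B * B * D + D * B * D + D * B * (D^2 * B)) * norm (x - y) * norm v"
      by (subst norm_minus_commute) (simp add: algebra_simps)
  qed
qed

text \<open>\<open>ln (cmod f)\<close> is the real part of a local logarithm of \<open>f\<close>, whose derivative is \<open>f' / f\<close>.\<close>

lemma has_derivative_ln_cmod: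
  assumes f: "(f has_derivative f') (at x)" and nz: "f x \<noteq> 0"
  shows "((\<lambda>x. ln (cmod (f x))) has_derivative (\<lambda>v. Re (f' v * inverse (f x)))) (at x)"
proof -
  have pos: "cmod (f x) > 0" using nz by simp
  have "((\<lambda>x. cmod (f x)) has_derivative (\<lambda>h. f' h \<bullet> sgn (f x))) (at x)"
    using has_derivative_compose[OF f has_derivative_norm[OF nz]] .
  then have "((\<lambda>x. ln (cmod (f x))) has_derivative (\<lambda>h. (f' h \<bullet> sgn (f x)) * inverse (cmod (f x)))) (at x)"
    using has_derivative_ln[where g = "\<lambda>x. cmod (f x)" and x = x, OF pos] by blast
  moreover have "(w \<bullet> sgn z) * inverse (norm z) = Re (w * inverse z)" for w z :: complex
  proof -
    have "Re (w * inverse z) = Re (w / z)" by (simp add: divide_inverse)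
    also have "\<dots> = Re (w * cnj z) / (cmod z)\<^sup>2"
      by (subst complex_div_cnj) (simp add: Re_divide_of_real del: of_real_power add: of_real_power[symmetric])
    finally show ?thesis
      by (simp add: sgn_div_norm inner_complex_def power2_eq_square divide_inverse algebra_simps)
  qed
  ultimately show ?thesis by simp
qed

lemma uniformly_C11_ln_norm:
  fixes f :: "'q \<Rightarrow> 'a::real_normed_vector \<Rightarrow> complex"
  assumes f: "uniformly_C11 Q S f" and S: "convex S"
    and d: "d > 0" "\<And>q x. q \<in> Q \<Longrightarrow> x \<in> S \<Longrightarrow> d \<le> norm (f q x)"
  shows "uniformly_C11 Q S (\<lambda>q x. ln (norm (f q x)))"
proof -
  obtain f' B where f_data: "C11_data Q S f f' B"
    using uniformly_C11E[OF f S] by blast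
  note B = C11_dataD[OF f_data]
  have inv: "uniformly_C11 Q S (\<lambda>q x. inverse (f q x))" by (rule uniformly_C11_inverse[OF f S d])
  obtain g' C where inv_data: "C11_data Q S (\<lambda>q x. inverse (f q x)) g' C"
    using uniformly_C11E[OF inv S] by blast
  note C = C11_dataD[OF inv_data]
  show ?thesis
  proof (rule uniformly_C11I[where g' = "\<lambda>q x v. Re (f' q x v * inverse (f q x))"
        and ?B1.0 = "\<bar>ln d\<bar> + \<bar>ln B\<bar>" and ?B2.0 = "B * C" and ?B3.0 = "B * C + B * C"])
    fix q x y and v :: 'a assume q: "q \<in> Q" "x \<in> S"
    have pos: "norm (f q x) > 0" using d(2)[OF q] d(1) by linarith
    then show "((\<lambda>x. ln (norm (f q x))) has_derivative (\<lambda>v. Re (f' q x v * inverse (f q x)))) (at x)"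
      by (intro has_derivative_ln_cmod B(2) q) auto
    have "ln d \<le> ln (norm (f q x))" "ln (norm (f q x)) \<le> ln B"
      using d B(3)[OF q] pos q B(1) by (auto simp: ln_le_cancel_iff)
    then show "norm (ln (norm (f q x))) \<le> \<bar>ln d\<bar> + \<bar>ln B\<bar>" by auto
    have R: "norm (Re z) \<le> norm z" for z by (simp add: abs_Re_le_cmod)
    have "norm (f' q x v) * norm (inverse (f q x)) \<le> (B * norm v) * C"
      using B(4)[OF q, of v] C(3)[OF q] B(1) by (intro mult_mono) auto
    then show "norm (Re (f' q x v * inverse (f q x))) \<le> B * C * norm v"
      using R[of "f' q x v * inverse (f q x)"] by (simp add: norm_mult mult_ac)
    assume y: "y \<in> S"
    have "norm (f' q x v * inverse (f q x) - f' q y v * inverse (f q y)) \<le> (B * norm (x - y) * norm v) * C + (B * norm v) * (C * norm (x - y))"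
      using q y B C by (intro product_difference_bound) auto
    then show "norm (Re (f' q x v * inverse (f q x)) - Re (f' q y v * inverse (f q y))) \<le> (B * C + B * C) * norm (x - y) * norm v"
      using R[of "f' q x v * inverse (f q x) - f' q y v * inverse (f q y)"] by (simp add: algebra_simps)
  qed
qed

lemma le_of_le_add_small:
  fixes a b :: real
  assumes "\<tau> > 0" "\<And>t. 0 < t \<Longrightarrow> t < \<tau> \<Longrightarrow> a \<le> b + K * t"
  shows "a \<le> b"
proof -
  have "((\<lambda>t. b + K * t) \<longlongrightarrow> b + K * 0) (at_right 0)"
    by (intro tendsto_intros)
  moreover have "eventually (\<lambda>t. a \<le> b + K * t) (at_right 0)"
    unfolding eventually_at_right_field using assms by (intro exI[of _ \<tau>]) auto
  ultimately have "a \<le> b + K * 0"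
    by (rule tendsto_lowerbound) simp
  then show ?thesis by simp
qed

section \<open>Transfer of differentiability along bounded linear combinations\<close>

text \<open>One can think of \<open>h\<close> as \<open>T \<circ> g\<close> for a linear operator \<open>T\<close> that is defined on linear combinations of
values of \<open>g\<close> only and bounded for the supremum over \<open>q\<close>. The derivative of \<open>g\<close> need not lie in
the domain of \<open>T\<close>, so \<open>T\<close> cannot be applied to it. But the difference quotients of \<open>g\<close> converge
uniformly in \<open>q\<close>, so those of \<open>h\<close> satisfy a Cauchy condition, and their limits form a Lipschitz
derivative of \<open>h\<close>. The Cauchy condition, additivity and the Lipschitz estimate compare the values
of \<open>h\<close> at no more than four points.\<close>

lemma four_point_transfer:
  fixes g :: "'q \<Rightarrow> 'a::real_normed_vector \<Rightarrow> 'b::real_normed_vector" and h :: "'a \<Rightarrow> 'c::banach"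
  assumes g: "uniformly_C11 Q S g" and S: "convex S" "open S" and C: "C \<ge> 0"
    and comb: "\<And>a1 a2 a3 a4 x1 x2 x3 x4 M. x1 \<in> S \<Longrightarrow> x2 \<in> S \<Longrightarrow> x3 \<in> S \<Longrightarrow> x4 \<in> S \<Longrightarrow> M > 0 \<Longrightarrow>
      (\<And>q. q \<in> Q \<Longrightarrow> norm (a1 *\<^sub>R g q x1 + a2 *\<^sub>R g q x2 + a3 *\<^sub>R g q x3 + a4 *\<^sub>R g q x4) \<le> M) \<Longrightarrow>
      norm (a1 *\<^sub>R h x1 + a2 *\<^sub>R h x2 + a3 *\<^sub>R h x3 + a4 *\<^sub>R h x4) \<le> C * M"
  shows "uniformly_C11 {()} S (\<lambda>_. h)"
proof -
  obtain g' B where g_data: "C11_data Q S g g' B"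
    using uniformly_C11E[OF g S(1)] by blast
  note B = C11_dataD[OF g_data]
  have lin: "linear (g' q x)" if "q \<in> Q" "x \<in> S" for q x
    using B(2)[OF that] by (rule has_derivative_linear)
  have comb0: "norm (a1 *\<^sub>R h x1 + a2 *\<^sub>R h x2 + a3 *\<^sub>R h x3 + a4 *\<^sub>R h x4) \<le> C * M"
    if x: "x1 \<in> S" "x2 \<in> S" "x3 \<in> S" "x4 \<in> S" and M: "M \<ge> 0"
      and le: "\<And>q. q \<in> Q \<Longrightarrow> norm (a1 *\<^sub>R g q x1 + a2 *\<^sub>R g q x2 + a3 *\<^sub>R g q x3 + a4 *\<^sub>R g q x4) \<le> M"
    for a1 a2 a3 a4 x1 x2 x3 x4 M
  proof (rule le_of_le_add_small[of 1 _ _ C])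
    fix t :: real assume t: "0 < t" "t < 1"
    have "norm (a1 *\<^sub>R h x1 + a2 *\<^sub>R h x2 + a3 *\<^sub>R h x3 + a4 *\<^sub>R h x4) \<le> C * (M + t)"
    proof (rule comb[OF x])
      show "norm (a1 *\<^sub>R g q x1 + a2 *\<^sub>R g q x2 + a3 *\<^sub>R g q x3 + a4 *\<^sub>R g q x4) \<le> M + t" if "q \<in> Q" for q
        using le[OF that] t by linarith
    qed (use M t in auto)
    then show "norm (a1 *\<^sub>R h x1 + a2 *\<^sub>R h x2 + a3 *\<^sub>R h x3 + a4 *\<^sub>R h x4) \<le> C * M + C * t"
      by (simp add: distrib_left)
  qed simp
  \<comment> \<open>the Taylor remainder of \<open>g q\<close> at \<open>x\<close>\<close>
  define r where "r q x w = g q (x + w) - g q x - g' q x w" for q x w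
  have r: "norm (r q x w) \<le> B * (norm w * norm w)" if "q \<in> Q" "x \<in> S" "x + w \<in> S" for q x w
    using B(7)[OF that] by (simp add: r_def mult_ac)
  have r_scaled: "norm ((1/t) *\<^sub>R r q x (t *\<^sub>R v)) \<le> B * \<bar>t\<bar> * (norm v * norm v)"
    if "q \<in> Q" "x \<in> S" "x + t *\<^sub>R v \<in> S" "t \<noteq> 0" for q x t v
    using mult_left_mono[OF r[OF that(1-3)], of "1 / \<bar>t\<bar>"] that(4)
    by (simp add: mult_ac divide_simps split: if_splits)
  define D where "D x v t = (1/t) *\<^sub>R (h (x + t *\<^sub>R v) - h x)" for x v t
  have gq: "(1/t) *\<^sub>R (g q (x + t *\<^sub>R v) - g q x) = g' q x v + (1/t) *\<^sub>R r q x (t *\<^sub>R v)"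
    if "q \<in> Q" "x \<in> S" "t \<noteq> 0" for q x v t
    using that linear_scale[OF lin[OF that(1,2)], of t v] by (simp add: r_def algebra_simps)
  have cauchy: "norm (D x v t - D x v s) \<le> C * B * (norm v * norm v) * (\<bar>t\<bar> + \<bar>s\<bar>)"
    if x: "x \<in> S" "x + t *\<^sub>R v \<in> S" "x + s *\<^sub>R v \<in> S" and ts: "t \<noteq> 0" "s \<noteq> 0" for x v t s
  proof -
    have "norm ((1/t) *\<^sub>R h (x + t *\<^sub>R v) + (- (1/s)) *\<^sub>R h (x + s *\<^sub>R v) + (1/s - 1/t) *\<^sub>R h x + 0 *\<^sub>R h x)
       \<le> C * (B * \<bar>t\<bar> * (norm v * norm v) + B * \<bar>s\<bar> * (norm v * norm v))"
    proof (rule comb0)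
      fix q assume q: "q \<in> Q"
      have "(1/t) *\<^sub>R g q (x + t *\<^sub>R v) + (- (1/s)) *\<^sub>R g q (x + s *\<^sub>R v) + (1/s - 1/t) *\<^sub>R g q x + 0 *\<^sub>R g q x
         = (1/t) *\<^sub>R (g q (x + t *\<^sub>R v) - g q x) - (1/s) *\<^sub>R (g q (x + s *\<^sub>R v) - g q x)"
        by (simp add: algebra_simps)
      also have "\<dots> = (1/t) *\<^sub>R r q x (t *\<^sub>R v) - (1/s) *\<^sub>R r q x (s *\<^sub>R v)"
        using gq[OF q x(1) ts(1)] gq[OF q x(1) ts(2)] by simp
      finally show "norm ((1/t) *\<^sub>R g q (x + t *\<^sub>R v) + (- (1/s)) *\<^sub>R g q (x + s *\<^sub>R v) + (1/s - 1/t) *\<^sub>R g q x + 0 *\<^sub>R g q x)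
         \<le> B * \<bar>t\<bar> * (norm v * norm v) + B * \<bar>s\<bar> * (norm v * norm v)"
        using norm_triangle_le_diff[OF add_mono[OF r_scaled[OF q x(1,2) ts(1)] r_scaled[OF q x(1,3) ts(2)]]] by simp
    qed (use x B(1) in auto)
    then show ?thesis by (simp add: D_def algebra_simps)
  qed
  \<comment> \<open>Limits in \<open>t\<close> are only taken for \<open>t\<close> so small that \<open>x + t *\<^sub>R v\<close> stays in \<open>S\<close>.\<close>
  have near: "\<exists>\<tau>>0. \<forall>t. \<bar>t\<bar> < \<tau> \<longrightarrow> x + t *\<^sub>R v \<in> S" if "x \<in> S" for x v
  proof -
    obtain e where e: "e > 0" "ball x e \<subseteq> S" using S(2) \<open>x \<in> S\<close> by (meson open_contains_ball)
    show ?thesis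
    proof (intro exI[of _ "e / (norm v + 1)"] conjI allI impI)
      show "0 < e / (norm v + 1)" using e(1) by (simp add: add_nonneg_pos)
      fix t assume "\<bar>t\<bar> < e / (norm v + 1)"
      then have "\<bar>t\<bar> * (norm v + 1) < e" by (simp add: pos_less_divide_eq add_nonneg_pos)
      moreover have "\<bar>t\<bar> * norm v \<le> \<bar>t\<bar> * (norm v + 1)" by (intro mult_left_mono) auto
      ultimately have "norm (t *\<^sub>R v) < e" by simp
      then show "x + t *\<^sub>R v \<in> S" using e(2) by (auto simp: dist_norm subset_iff)
    qed
  qed
  have "\<exists>L. \<forall>t. t \<noteq> 0 \<and> x + t *\<^sub>R v \<in> S \<longrightarrow> norm (D x v t - L) \<le> C * B * (norm v * norm v) * \<bar>t\<bar>"
    if x: "x \<in> S" for x v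
  proof -
    define A where "A = C * B * (norm v * norm v)"
    have A: "A \<ge> 0" using C B(1) by (simp add: A_def)
    obtain \<tau> where \<tau>: "\<tau> > 0" "\<And>t. \<bar>t\<bar> < \<tau> \<Longrightarrow> x + t *\<^sub>R v \<in> S" using near[OF x] by blast
    \<comment> \<open>a sequence of admissible steps tending to \<open>0\<close>; the offset \<open>2\<close> keeps them below \<open>\<tau>\<close>\<close>
    define T where "T n = \<tau> / (real n + 2)" for n
    have T0: "T n > 0" "\<bar>T n\<bar> < \<tau>" for n 
    proof -
      show "T n > 0" using \<tau>(1) by (auto simp: T_def intro!: divide_pos_pos add_nonneg_pos)
      have "\<tau> / (real n + 2) < \<tau> / 1" using \<tau>(1) by (intro divide_strict_left_mono) auto
      with \<open>T n > 0\<close> show "\<bar>T n\<bar> < \<tau>" by (simp add: T_def)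
    qed
    have Tlim: "T \<longlonglongrightarrow> 0" unfolding T_def by real_asymp
    have "Cauchy (\<lambda>n. D x v (T n))"
    proof (rule metric_CauchyI)
      fix e :: real assume e: "e > 0"
      have "eventually (\<lambda>n. \<bar>T n\<bar> < e / (2 * A + 1)) sequentially"
        using tendstoD[OF Tlim, of "e / (2 * A + 1)"] e A by (simp add: dist_real_def)
      then obtain N where N: "\<And>n. n \<ge> N \<Longrightarrow> \<bar>T n\<bar> < e / (2 * A + 1)" by (auto simp: eventually_sequentially)
      have "dist (D x v (T m)) (D x v (T n)) < e" if "m \<ge> N" "n \<ge> N" for m n
      proof -
        have "dist (D x v (T m)) (D x v (T n)) \<le> A * (\<bar>T m\<bar> + \<bar>T n\<bar>)"
          unfolding dist_norm A_def using x T0[of m] T0[of n] by (intro cauchy \<tau>(2)) auto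
        also have "\<dots> \<le> A * (e / (2 * A + 1) + e / (2 * A + 1))"
          using N[OF that(1)] N[OF that(2)] A by (intro mult_left_mono) auto
        also have "\<dots> = (2 * A * e) / (2 * A + 1)" by (simp add: algebra_simps)
        also have "\<dots> < e" using A e by (simp add: pos_divide_less_eq distrib_left)
        finally show ?thesis .
      qed
      then show "\<exists>M. \<forall>m\<ge>M. \<forall>n\<ge>M. dist (D x v (T m)) (D x v (T n)) < e" by blast
    qed
    then obtain L where L: "(\<lambda>n. D x v (T n)) \<longlonglongrightarrow> L" using Cauchy_convergent convergent_def by blast
    have "norm (D x v t - L) \<le> A * \<bar>t\<bar>" if t: "t \<noteq> 0" "x + t *\<^sub>R v \<in> S" for t
    proof (rule tendsto_le[OF sequentially_bot])
      show "(\<lambda>n. A * (\<bar>t\<bar> + \<bar>T n\<bar>)) \<longlonglongrightarrow> A * \<bar>t\<bar>"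
        using tendsto_mult_left[OF tendsto_add[OF tendsto_const tendsto_rabs_zero[OF Tlim]], of A "\<bar>t\<bar>"] by simp
      show "(\<lambda>n. norm (D x v t - D x v (T n))) \<longlonglongrightarrow> norm (D x v t - L)"
        by (intro tendsto_intros L)
      show "eventually (\<lambda>n. norm (D x v t - D x v (T n)) \<le> A * (\<bar>t\<bar> + \<bar>T n\<bar>)) sequentially"
        
        unfolding A_def
      proof (intro always_eventually allI cauchy x t)
        fix n
        show "x + T n *\<^sub>R v \<in> S" by (rule \<tau>(2)[OF T0(2)])
        show "T n \<noteq> 0" using T0(1)[of n] by simp
      qed
    qed
    then show ?thesis unfolding A_def by blast
  qed
  then obtain h' where h': "\<And>x v t. x \<in> S \<Longrightarrow> t \<noteq> 0 \<Longrightarrow> x + t *\<^sub>R v \<in> S \<Longrightarrow>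
      norm (D x v t - h' x v) \<le> C * B * (norm v * norm v) * \<bar>t\<bar>"
    by metis
  have h'D: "norm (h' x v) \<le> norm (D x v t) + C * B * (norm v * norm v) * \<bar>t\<bar>"
    if "x \<in> S" "t \<noteq> 0" "x + t *\<^sub>R v \<in> S" for x v t
    using h'[OF that] norm_triangle_ineq2[of "h' x v" "D x v t"] by (simp add: norm_minus_commute)
  have bound: "norm (h' x v) \<le> C * B * norm v" if x: "x \<in> S" for x v
  proof -
    obtain \<tau> where \<tau>: "\<tau> > 0" "\<And>t. \<bar>t\<bar> < \<tau> \<Longrightarrow> x + t *\<^sub>R v \<in> S" using near[OF x] by blast
    show ?thesis
    proof (rule le_of_le_add_small[OF \<tau>(1)])
      fix t assume t: "0 < t" "t < \<tau>"
      then have xt: "x + t *\<^sub>R v \<in> S" using \<tau>(2)[of t] by auto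
      have "norm ((1/t) *\<^sub>R h (x + t *\<^sub>R v) + (- (1/t)) *\<^sub>R h x + 0 *\<^sub>R h x + 0 *\<^sub>R h x) \<le> C * (B * norm v)"
      proof (rule comb0)
        fix q assume q: "q \<in> Q"
        have "norm (g q (x + t *\<^sub>R v) - g q x) \<le> B * (t * norm v)" using B(6)[OF q xt x] t by simp
        then have "norm ((1/t) *\<^sub>R (g q (x + t *\<^sub>R v) - g q x)) \<le> B * norm v"
          unfolding norm_scaleR using t by (simp add: pos_divide_le_eq mult_ac)
        then show "norm ((1/t) *\<^sub>R g q (x + t *\<^sub>R v) + (- (1/t)) *\<^sub>R g q x + 0 *\<^sub>R g q x + 0 *\<^sub>R g q x) \<le> B * norm v"
          by (simp add: algebra_simps)
      qed (use x xt B(1) in auto)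
      then have "norm (D x v t) \<le> C * (B * norm v)" by (simp add: D_def algebra_simps)
      then show "norm (h' x v) \<le> C * B * norm v + C * B * (norm v * norm v) * t"
        using h'D[OF x _ xt] t by simp
    qed
  qed
  \<comment> \<open>The linear parts cancel in the combination of \<open>g\<close>, and only the remainders \<open>r\<close> are left.\<close>
  have add: "h' x (v + w) = h' x v + h' x w" if x: "x \<in> S" for x v w
  proof -
    obtain \<tau>1 where \<tau>1: "\<tau>1 > 0" "\<And>t. \<bar>t\<bar> < \<tau>1 \<Longrightarrow> x + t *\<^sub>R v \<in> S" using near[OF x] by blast
    obtain \<tau>2 where \<tau>2: "\<tau>2 > 0" "\<And>t. \<bar>t\<bar> < \<tau>2 \<Longrightarrow> x + t *\<^sub>R w \<in> S" using near[OF x] by blast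
    obtain \<tau>3 where \<tau>3: "\<tau>3 > 0" "\<And>t. \<bar>t\<bar> < \<tau>3 \<Longrightarrow> x + t *\<^sub>R (v + w) \<in> S" using near[OF x] by blast
    define N where "N = norm (v + w) * norm (v + w) + norm v * norm v + norm w * norm w"
    have "norm (h' x (v + w) - h' x v - h' x w) \<le> 0"
    proof (rule le_of_le_add_small[of "min \<tau>1 (min \<tau>2 \<tau>3)" _ _ "2 * (C * B * N)"])
      fix t assume t: "0 < t" "t < min \<tau>1 (min \<tau>2 \<tau>3)"
      then have tn: "t \<noteq> 0" by simp
      have m: "x + t *\<^sub>R v \<in> S" "x + t *\<^sub>R w \<in> S" "x + t *\<^sub>R (v + w) \<in> S"
        using \<tau>1(2)[of t] \<tau>2(2)[of t] \<tau>3(2)[of t] t by auto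
      have "norm ((1/t) *\<^sub>R h (x + t *\<^sub>R (v + w)) + (-(1/t)) *\<^sub>R h (x + t *\<^sub>R v) + (-(1/t)) *\<^sub>R h (x + t *\<^sub>R w) + (1/t) *\<^sub>R h x)
          \<le> C * (B * t * N)"
      proof (rule comb0)
        fix q assume q: "q \<in> Q"
        have "(1/t) *\<^sub>R g q (x + t *\<^sub>R (v + w)) + (-(1/t)) *\<^sub>R g q (x + t *\<^sub>R v) + (-(1/t)) *\<^sub>R g q (x + t *\<^sub>R w) + (1/t) *\<^sub>R g q x
          = (1/t) *\<^sub>R (g q (x + t *\<^sub>R (v + w)) - g q x) - (1/t) *\<^sub>R (g q (x + t *\<^sub>R v) - g q x) - (1/t) *\<^sub>R (g q (x + t *\<^sub>R w) - g q x)"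
          by (simp add: algebra_simps)
        also have "\<dots> = (1/t) *\<^sub>R r q x (t *\<^sub>R (v + w)) - (1/t) *\<^sub>R r q x (t *\<^sub>R v) - (1/t) *\<^sub>R r q x (t *\<^sub>R w)"
          unfolding gq[OF q x tn] linear_add[OF lin[OF q x]] by simp
        finally have eq: "(1/t) *\<^sub>R g q (x + t *\<^sub>R (v + w)) + (-(1/t)) *\<^sub>R g q (x + t *\<^sub>R v) + (-(1/t)) *\<^sub>R g q (x + t *\<^sub>R w) + (1/t) *\<^sub>R g q x
          = (1/t) *\<^sub>R r q x (t *\<^sub>R (v + w)) - (1/t) *\<^sub>R r q x (t *\<^sub>R v) - (1/t) *\<^sub>R r q x (t *\<^sub>R w)" .
        have "norm ((1/t) *\<^sub>R r q x (t *\<^sub>R (v + w)) - (1/t) *\<^sub>R r q x (t *\<^sub>R v) - (1/t) *\<^sub>R r q x (t *\<^sub>R w))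
           \<le> B * \<bar>t\<bar> * (norm (v + w) * norm (v + w)) + B * \<bar>t\<bar> * (norm v * norm v) + B * \<bar>t\<bar> * (norm w * norm w)"
          using r_scaled[OF q x m(3) tn] r_scaled[OF q x m(1) tn] r_scaled[OF q x m(2) tn]
          by (smt (verit, best) norm_triangle_ineq4)
        also have "\<dots> = B * t * N" using t by (simp add: N_def distrib_left)
        finally show "norm ((1/t) *\<^sub>R g q (x + t *\<^sub>R (v + w)) + (-(1/t)) *\<^sub>R g q (x + t *\<^sub>R v) + (-(1/t)) *\<^sub>R g q (x + t *\<^sub>R w) + (1/t) *\<^sub>R g q x) \<le> B * t * N"
          unfolding eq .
      qed (use x m B(1) t in \<open>auto simp: N_def\<close>)
      then have d: "norm (D x (v + w) t - D x v t - D x w t) \<le> C * B * N * t"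
        by (simp add: D_def algebra_simps)
      have "h' x (v + w) - h' x v - h' x w = (D x (v + w) t - D x v t - D x w t)
          - (D x (v + w) t - h' x (v + w)) + (D x v t - h' x v) + (D x w t - h' x w)" by simp
      also have "norm \<dots> \<le> norm (D x (v + w) t - D x v t - D x w t) + norm (D x (v + w) t - h' x (v + w))
         + norm (D x v t - h' x v) + norm (D x w t - h' x w)"
        by (smt (verit, best) norm_triangle_ineq norm_triangle_ineq4)
      also have "\<dots> \<le> C * B * N * t + C * B * (norm (v + w) * norm (v + w)) * \<bar>t\<bar>
         + C * B * (norm v * norm v) * \<bar>t\<bar> + C * B * (norm w * norm w) * \<bar>t\<bar>"
        using d h'[OF x tn m(3)] h'[OF x tn m(1)] h'[OF x tn m(2)] by linarith
      also have "\<dots> = 0 + 2 * (C * B * N) * t" using t by (simp add: N_def algebra_simps)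
      finally show "norm (h' x (v + w) - h' x v - h' x w) \<le> 0 + 2 * (C * B * N) * t" .
    qed (use \<tau>1 \<tau>2 \<tau>3 in auto)
    then show ?thesis by (simp add: algebra_simps)
  qed
  have h'0: "h' x 0 = 0" if "x \<in> S" for x using add[OF that, of 0 0] by simp
  \<comment> \<open>Homogeneity is a property of difference quotients: \<open>D x (a *\<^sub>R v) t = a *\<^sub>R D x v (t * a)\<close>.\<close>
  have scale: "h' x (a *\<^sub>R v) = a *\<^sub>R h' x v" if x: "x \<in> S" for x a v
  proof (cases "a = 0")
    case False
    obtain \<tau>1 where \<tau>1: "\<tau>1 > 0" "\<And>t. \<bar>t\<bar> < \<tau>1 \<Longrightarrow> x + t *\<^sub>R (a *\<^sub>R v) \<in> S" using near[OF x] by blast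
    define N where "N = norm (a *\<^sub>R v) * norm (a *\<^sub>R v) + \<bar>a\<bar> * (norm v * norm v) * \<bar>a\<bar>"
    have "norm (h' x (a *\<^sub>R v) - a *\<^sub>R h' x v) \<le> 0"
    proof (rule le_of_le_add_small[OF \<tau>1(1), of _ _ "C * B * N"])
      fix t assume t: "0 < t" "t < \<tau>1"
      then have m: "x + t *\<^sub>R (a *\<^sub>R v) \<in> S" "x + (t * a) *\<^sub>R v \<in> S" using \<tau>1(2)[of t] by auto
      have eq: "D x (a *\<^sub>R v) t = a *\<^sub>R D x v (t * a)" using False t by (simp add: D_def)
      have 1: "norm (D x (a *\<^sub>R v) t - h' x (a *\<^sub>R v)) \<le> C * B * (norm (a *\<^sub>R v) * norm (a *\<^sub>R v)) * \<bar>t\<bar>"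
        using t by (intro h'[OF x _ m(1)]) auto
      have "norm (D x v (t * a) - h' x v) \<le> C * B * (norm v * norm v) * \<bar>t * a\<bar>"
        using t False by (intro h'[OF x _ m(2)]) auto
      then have "\<bar>a\<bar> * norm (D x v (t * a) - h' x v) \<le> \<bar>a\<bar> * (C * B * (norm v * norm v) * \<bar>t * a\<bar>)"
        by (intro mult_left_mono) auto
      then have 2: "norm (a *\<^sub>R D x v (t * a) - a *\<^sub>R h' x v) \<le> \<bar>a\<bar> * (C * B * (norm v * norm v) * \<bar>t * a\<bar>)"
        by (simp add: scaleR_diff_right[symmetric])
      have "norm (h' x (a *\<^sub>R v) - a *\<^sub>R h' x v) \<le> norm (D x (a *\<^sub>R v) t - h' x (a *\<^sub>R v)) + norm (D x (a *\<^sub>R v) t - a *\<^sub>R h' x v)"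
        using norm_triangle_ineq4[of "D x (a *\<^sub>R v) t - a *\<^sub>R h' x v" "D x (a *\<^sub>R v) t - h' x (a *\<^sub>R v)"] by simp
      also have "\<dots> \<le> C * B * (norm (a *\<^sub>R v) * norm (a *\<^sub>R v)) * \<bar>t\<bar> + \<bar>a\<bar> * (C * B * (norm v * norm v) * \<bar>t * a\<bar>)"
        using 1 2 unfolding eq by linarith
      also have "\<dots> = 0 + C * B * N * t" using t by (simp add: N_def abs_mult algebra_simps)
      finally show "norm (h' x (a *\<^sub>R v) - a *\<^sub>R h' x v) \<le> 0 + C * B * N * t" .
    qed
    then show ?thesis by simp
  qed (use h'0[OF x] in simp)
  have blin: "bounded_linear (h' x)" if "x \<in> S" for x
    by (rule bounded_linear_intro[of _ "C * B"]) (use add scale bound that in \<open>auto simp: mult_ac\<close>)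
  show ?thesis
  proof (rule uniformly_C11I[where g' = "\<lambda>_. h'" and ?B1.0 = "C * B" and ?B2.0 = "C * B" and ?B3.0 = "C * B"])
    fix x and v :: 'a assume x: "x \<in> S"
    show "(h has_derivative h' x) (at x)"
      unfolding has_derivative_at_alt
    proof (intro conjI allI impI blin x)
      fix e :: real assume e: "e > 0"
      obtain \<rho> where \<rho>: "\<rho> > 0" "ball x \<rho> \<subseteq> S" using S(2) x by (meson open_contains_ball)
      show "\<exists>d>0. \<forall>y. norm (y - x) < d \<longrightarrow> norm (h y - h x - h' x (y - x)) \<le> e * norm (y - x)"
      proof (intro exI[of _ "min \<rho> (e / (C * B + 1))"] conjI allI impI)
        show "0 < min \<rho> (e / (C * B + 1))" using \<rho> e C B(1) by (simp add: add_nonneg_pos)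
        fix y assume y: "norm (y - x) < min \<rho> (e / (C * B + 1))"
        \<comment> \<open>The bound for difference quotients with \<open>t = 1\<close> is a Taylor estimate for \<open>h\<close>.\<close>
        then have "x + 1 *\<^sub>R (y - x) \<in> S" using \<rho> by (auto simp: dist_norm norm_minus_commute)
        then have "norm (D x (y - x) 1 - h' x (y - x)) \<le> C * B * (norm (y - x) * norm (y - x)) * \<bar>1\<bar>"
          by (intro h'[OF x]) auto
        then have "norm (h y - h x - h' x (y - x)) \<le> (C * B * norm (y - x)) * norm (y - x)"
          by (simp add: D_def mult_ac)
        also have "C * B * norm (y - x) \<le> (C * B + 1) * norm (y - x)" by (intro mult_right_mono) auto
        also have "\<dots> \<le> e" using y C B(1) by (simp add: pos_less_divide_eq add_nonneg_pos mult_ac)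
        finally show "norm (h y - h x - h' x (y - x)) \<le> e * norm (y - x)" by (simp add: mult_right_mono)
      qed
    qed
    show "norm (h x) \<le> C * B"
      using comb0[OF x x x x, of B 1 0 0 0] B(1,3) x by auto
    show "norm (h' x v) \<le> C * B * norm v" by (rule bound[OF x])
    fix y assume y: "y \<in> S"
    obtain \<tau>1 where \<tau>1: "\<tau>1 > 0" "\<And>t. \<bar>t\<bar> < \<tau>1 \<Longrightarrow> x + t *\<^sub>R v \<in> S" using near[OF x] by blast
    obtain \<tau>2 where \<tau>2: "\<tau>2 > 0" "\<And>t. \<bar>t\<bar> < \<tau>2 \<Longrightarrow> y + t *\<^sub>R v \<in> S" using near[OF y] by blast
    show "norm (h' x v - h' y v) \<le> C * B * norm (x - y) * norm v"
    proof (rule le_of_le_add_small[of "min \<tau>1 \<tau>2" _ _ "4 * (C * B * (norm v * norm v))"])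
      fix t assume t: "0 < t" "t < min \<tau>1 \<tau>2"
      then have tn: "t \<noteq> 0" by simp
      have m: "x + t *\<^sub>R v \<in> S" "y + t *\<^sub>R v \<in> S" using \<tau>1(2)[of t] \<tau>2(2)[of t] t by auto
      have "norm ((1/t) *\<^sub>R h (x + t *\<^sub>R v) + (-(1/t)) *\<^sub>R h x + (-(1/t)) *\<^sub>R h (y + t *\<^sub>R v) + (1/t) *\<^sub>R h y)
          \<le> C * (B * norm (x - y) * norm v + 2 * (B * t * (norm v * norm v)))"
      proof (rule comb0)
        fix q assume q: "q \<in> Q"
        have "(1/t) *\<^sub>R g q (x + t *\<^sub>R v) + (-(1/t)) *\<^sub>R g q x + (-(1/t)) *\<^sub>R g q (y + t *\<^sub>R v) + (1/t) *\<^sub>R g q y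
          = (1/t) *\<^sub>R (g q (x + t *\<^sub>R v) - g q x) - (1/t) *\<^sub>R (g q (y + t *\<^sub>R v) - g q y)"
          by (simp add: algebra_simps)
        also have "\<dots> = (g' q x v - g' q y v) + (1/t) *\<^sub>R r q x (t *\<^sub>R v) - (1/t) *\<^sub>R r q y (t *\<^sub>R v)"
          unfolding gq[OF q x tn] gq[OF q y tn] by simp
        also have "norm \<dots> \<le> norm (g' q x v - g' q y v) + norm ((1/t) *\<^sub>R r q x (t *\<^sub>R v)) + norm ((1/t) *\<^sub>R r q y (t *\<^sub>R v))"
          by (smt (verit, best) norm_triangle_ineq norm_triangle_ineq4)
        also have "\<dots> \<le> B * norm (x - y) * norm v + B * \<bar>t\<bar> * (norm v * norm v) + B * \<bar>t\<bar> * (norm v * norm v)"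
          using B(5)[OF q x y, of v] r_scaled[OF q x m(1) tn] r_scaled[OF q y m(2) tn] by linarith
        also have "\<dots> = B * norm (x - y) * norm v + 2 * (B * t * (norm v * norm v))" using t by simp
        finally show "norm ((1/t) *\<^sub>R g q (x + t *\<^sub>R v) + (-(1/t)) *\<^sub>R g q x + (-(1/t)) *\<^sub>R g q (y + t *\<^sub>R v) + (1/t) *\<^sub>R g q y)
          \<le> B * norm (x - y) * norm v + 2 * (B * t * (norm v * norm v))" .
      qed (use x y m B(1) t in auto)
      then have d: "norm (D x v t - D y v t) \<le> C * (B * norm (x - y) * norm v + 2 * (B * t * (norm v * norm v)))"
        by (simp add: D_def algebra_simps)
      have "h' x v - h' y v = (D x v t - D y v t) - (D x v t - h' x v) + (D y v t - h' y v)" by simp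
      also have "norm \<dots> \<le> norm (D x v t - D y v t) + norm (D x v t - h' x v) + norm (D y v t - h' y v)"
        by (smt (verit, best) norm_triangle_ineq norm_triangle_ineq4)
      also have "\<dots> \<le> C * (B * norm (x - y) * norm v + 2 * (B * t * (norm v * norm v))) + C * B * (norm v * norm v) * \<bar>t\<bar> + C * B * (norm v * norm v) * \<bar>t\<bar>"
        using d h'[OF x tn m(1)] h'[OF y tn m(2)] by linarith
      also have "\<dots> = C * B * norm (x - y) * norm v + 4 * (C * B * (norm v * norm v)) * t"
        using t by (simp add: algebra_simps)
      finally show "norm (h' x v - h' y v) \<le> C * B * norm (x - y) * norm v + 4 * (C * B * (norm v * norm v)) * t" .
    qed (use \<tau>1 \<tau>2 in auto)
  qed
qed

section \<open>Plane domains bounded by graphs\<close>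

lemma isCont_realD:
  fixes h :: "real \<Rightarrow> real"
  assumes "isCont h s0" "\<eta> > 0"
  shows "\<exists>a>0. \<forall>s. \<bar>s - s0\<bar> < a \<longrightarrow> \<bar>h s - h s0\<bar> < \<eta>"
  using assms unfolding continuous_at_eps_delta by (auto simp: dist_real_def)

text \<open>The determinant of the matrix with columns \<open>u\<close> and \<open>v\<close>. The harmonic conjugate of a solution
has a differential of the form \<open>cross2 P\<close> with \<open>P\<close> the flux.\<close>

definition cross2 :: "plane \<Rightarrow> plane \<Rightarrow> real" where
  "cross2 u v = u $ 1 * v $ 2 - u $ 2 * v $ 1"

lemma cross2_bound: "\<bar>cross2 u v\<bar> \<le> 2 * norm u * norm v"
proof -
  have "\<bar>u $ 1 * v $ 2\<bar> \<le> norm u * norm v" "\<bar>u $ 2 * v $ 1\<bar> \<le> norm u * norm v"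
    unfolding abs_mult by (intro mult_mono component_le_norm_cart norm_ge_zero abs_ge_zero)+
  then show ?thesis unfolding cross2_def by linarith
qed

lemma cross2_diff_left: "cross2 (u - w) v = cross2 u v - cross2 w v"
  by (simp add: cross2_def algebra_simps)

lemma cross2_orthogonal:
  assumes "u \<bullet> \<nu> = 0" "v \<bullet> \<nu> = 0" "\<nu> \<noteq> 0"
  shows "cross2 u v = 0"
proof -
  have e: "u $ 1 * \<nu> $ 1 + u $ 2 * \<nu> $ 2 = 0" "v $ 1 * \<nu> $ 1 + v $ 2 * \<nu> $ 2 = 0"
    using assms by (simp_all add: inner_vec_def sum_2)
  have "\<nu> $ 1 * cross2 u v = v $ 2 * (u $ 1 * \<nu> $ 1 + u $ 2 * \<nu> $ 2) - u $ 2 * (v $ 1 * \<nu> $ 1 + v $ 2 * \<nu> $ 2)"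
    "\<nu> $ 2 * cross2 u v = u $ 1 * (v $ 1 * \<nu> $ 1 + v $ 2 * \<nu> $ 2) - v $ 1 * (u $ 1 * \<nu> $ 1 + u $ 2 * \<nu> $ 2)"
    by (simp_all add: cross2_def algebra_simps)
  then have "\<nu> $ 1 * cross2 u v = 0" "\<nu> $ 2 * cross2 u v = 0" using e by simp_all
  moreover have "\<nu> $ 1 \<noteq> 0 \<or> \<nu> $ 2 \<noteq> 0" using assms(3) by (auto simp: vec_eq_iff forall_2)
  ultimately show ?thesis by auto
qed

text \<open>A real two-by-two matrix with orthonormal rows also has orthonormal columns.\<close>

lemma orthonormal_frame_expansion:
  fixes e e' y :: plane
  assumes "norm e = 1" "norm e' = 1" "e \<bullet> e' = 0"
  shows "(y \<bullet> e) *\<^sub>R e + (y \<bullet> e') *\<^sub>R e' = y"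
proof -
  define a b c d where "a = e $ 1" and "b = e $ 2" and "c = e' $ 1" and "d = e' $ 2"
  have "e \<bullet> e = 1" "e' \<bullet> e' = 1" using assms by (simp_all add: dot_square_norm)
  then have 1: "a * a + b * b = 1" "c * c + d * d = 1" "a * c + b * d = 0"
    using assms(3) by (simp_all add: inner_vec_def sum_2 a_def b_def c_def d_def)
  \<comment> \<open>\<open>D\<close> is the determinant of the frame, so it is \<open>1\<close> or \<open>- 1\<close>.\<close>
  define D where "D = a * d - b * c"
  have "a = a * (c * c + d * d) - c * (a * c + b * d)" "b = b * (c * c + d * d) - d * (a * c + b * d)"
    using 1 by simp_all
  then have ab: "a = d * D" "b = - c * D" by (simp_all add: D_def algebra_simps)
  have "D * D = (a * a + b * b) * (c * c + d * d) - (a * c + b * d) * (a * c + b * d)"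
    by (simp add: D_def algebra_simps)
  then have DD: "D * D = 1" using 1 by simp
  have "a * a = d * d * (D * D)" "b * b = c * c * (D * D)" "a * b = - c * d * (D * D)"
    by (simp_all add: ab)
  then have s: "a * a = d * d" "b * b = c * c" "a * b = - c * d" using DD by simp_all
  have q: "a * a + c * c = 1" "b * b + d * d = 1" "a * b + c * d = 0" using s 1 by linarith+
  have "((y \<bullet> e) *\<^sub>R e + (y \<bullet> e') *\<^sub>R e') $ 1 = y $ 1 * (a * a + c * c) + y $ 2 * (a * b + c * d)"
    "((y \<bullet> e) *\<^sub>R e + (y \<bullet> e') *\<^sub>R e') $ 2 = y $ 1 * (a * b + c * d) + y $ 2 * (b * b + d * d)"
    by (simp_all add: inner_vec_def sum_2 a_def b_def c_def d_def algebra_simps)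
  then show ?thesis using q by (simp add: vec_eq_iff forall_2)
qed

text \<open>A point strictly below the graph has a neighbourhood below the graph, because \<open>h\<close> is continuous; a
point on the graph is a limit of points above it.\<close>

lemma local_graph_frontier:
  assumes "open \<Omega>" "local_graph \<gamma> \<Omega> x e e' h"
  obtains r where "r > 0"
    "\<And>y. y \<in> ball x r \<Longrightarrow> y \<in> \<Omega> \<longleftrightarrow> h (y \<bullet> e) < y \<bullet> e'"
    "\<And>y. y \<in> ball x r \<Longrightarrow> y \<in> frontier \<Omega> \<longleftrightarrow> h (y \<bullet> e) = y \<bullet> e'"
proof -
  have e: "norm e = 1" "norm e' = 1" "e \<bullet> e' = 0" and hC: "C2_holder \<gamma> h"
    using assms(2) by (auto simp: local_graph_def)
  obtain r where r: "r > 0" "\<Omega> \<inter> ball x r = {y \<in> ball x r. h (y \<bullet> e) < y \<bullet> e'}"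
    using assms(2) by (auto simp: local_graph_def)
  have in\<Omega>: "y \<in> \<Omega> \<longleftrightarrow> h (y \<bullet> e) < y \<bullet> e'" if "y \<in> ball x r" for y using r(2) that by blast
  have hcont: "continuous_on UNIV h"
    using hC unfolding C2_holder_def by (meson DERIV_isCont continuous_at_imp_continuous_on)
  have ee: "e' \<bullet> e' = 1" "e' \<bullet> e = 0" using e by (simp_all add: dot_square_norm inner_commute)
  show thesis
  proof (rule that[OF r(1) in\<Omega>])
    fix y assume y: "y \<in> ball x r"
    have fr: "y \<in> frontier \<Omega> \<longleftrightarrow> y \<in> closure \<Omega> \<and> y \<notin> \<Omega>"
      using assms(1) by (simp add: frontier_def interior_open)
    show "y \<in> frontier \<Omega> \<longleftrightarrow> h (y \<bullet> e) = y \<bullet> e'"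
    proof
      assume "y \<in> frontier \<Omega>"
      then have yc: "y \<in> closure \<Omega>" and "y \<notin> \<Omega>" using fr by auto
      then have ge: "h (y \<bullet> e) \<ge> y \<bullet> e'" using in\<Omega>[OF y] by simp
      have "\<not> h (y \<bullet> e) > y \<bullet> e'"
      proof
        assume gt: "h (y \<bullet> e) > y \<bullet> e'"
        define U where "U = ball x r \<inter> {z. z \<bullet> e' < h (z \<bullet> e)}"
        have "open {z. z \<bullet> e' < h (z \<bullet> e)}"
          by (intro open_Collect_less continuous_intros continuous_on_compose2[OF hcont]) auto
        then have "open U" "y \<in> U" using y gt by (auto simp: U_def)
        then have "U \<inter> \<Omega> \<noteq> {}" using yc by (meson open_Int_closure_eq_empty disjoint_iff)
        then show False using in\<Omega> by (force simp: U_def)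
      qed
      with ge show "h (y \<bullet> e) = y \<bullet> e'" by simp
    next
      assume eq: "h (y \<bullet> e) = y \<bullet> e'"
      have "y \<in> closure \<Omega>"
        unfolding closure_approachable
      proof (intro allI impI)
        fix d :: real assume d: "d > 0"
        define t where "t = min d (r - dist x y) / 2"
        have t: "t > 0" "t < d" "t < r - dist x y" using d y by (auto simp: t_def)
        have b: "y + t *\<^sub>R e' \<in> ball x r"
          using t e(2) dist_triangle[of x "y + t *\<^sub>R e'" y] by (simp add: dist_norm)
        have "y + t *\<^sub>R e' \<in> \<Omega>"
          unfolding in\<Omega>[OF b] using t eq by (simp add: inner_add_left ee)
        moreover have "dist (y + t *\<^sub>R e') y < d" using t e(2) by (simp add: dist_norm)
        ultimately show "\<exists>z\<in>\<Omega>. dist z y < d" by blast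
      qed
      moreover have "y \<notin> \<Omega>" using in\<Omega>[OF y] eq by simp
      ultimately show "y \<in> frontier \<Omega>" using fr by simp
    qed
  qed
qed

text \<open>The normal at \<open>y\<close> is defined through a chart around \<open>y\<close>, whereas the tangent vector
\<open>e + h' *\<^sub>R e'\<close> comes from a chart around another point \<open>x\<close>. The curve \<open>c\<close> that parametrises the
graph over \<open>e\<close> runs in the frontier, so it solves the equation of the chart around \<open>y\<close>;
differentiating that equation along \<open>c\<close> gives the orthogonality.\<close>

lemma outer_unit_normal_orthogonal_tangent:
  assumes "open \<Omega>" and x: "local_graph \<gamma> \<Omega> x e e' h"
    and r: "\<And>z. z \<in> ball x r \<Longrightarrow> z \<in> frontier \<Omega> \<longleftrightarrow> h (z \<bullet> e) = z \<bullet> e'"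
    and y: "y \<in> ball x r" "y \<in> frontier \<Omega>" and \<nu>: "outer_unit_normal \<gamma> \<Omega> y \<nu>"
    and h': "(h has_real_derivative h') (at (y \<bullet> e))"
  shows "(e + h' *\<^sub>R e') \<bullet> \<nu> = 0" "\<nu> \<noteq> 0"
proof -
  have e: "norm e = 1" "norm e' = 1" "e \<bullet> e' = 0" using x by (auto simp: local_graph_def)
  have ee: "e \<bullet> e = 1" "e' \<bullet> e' = 1" "e' \<bullet> e = 0" using e by (simp_all add: dot_square_norm inner_commute)
  obtain f f' g where f: "local_graph \<gamma> \<Omega> y f f' g" and
    \<nu>_eq: "\<nu> = (1 / sqrt (1 + (deriv g (y \<bullet> f))\<^sup>2)) *\<^sub>R (deriv g (y \<bullet> f) *\<^sub>R f - f')"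
    using \<nu> unfolding outer_unit_normal_def by blast
  have fn: "norm f = 1" "norm f' = 1" "f \<bullet> f' = 0" using f by (auto simp: local_graph_def)
  have ff: "f \<bullet> f = 1" "f' \<bullet> f' = 1" "f' \<bullet> f = 0" using fn by (simp_all add: dot_square_norm inner_commute)
  obtain r2 where r2: "r2 > 0" "\<And>z. z \<in> ball y r2 \<Longrightarrow> z \<in> frontier \<Omega> \<longleftrightarrow> g (z \<bullet> f) = z \<bullet> f'"
    using local_graph_frontier[OF assms(1) f] by metis
  obtain G where G: "(g has_real_derivative G) (at (y \<bullet> f))"
    using f unfolding local_graph_def C2_holder_def by blast
  have dG: "deriv g (y \<bullet> f) = G" using G by (rule DERIV_imp_deriv)
  define c where "c s = s *\<^sub>R e + h s *\<^sub>R e'" for s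
  have hy: "h (y \<bullet> e) = y \<bullet> e'" using r y by blast
  have c0: "c (y \<bullet> e) = y" using orthonormal_frame_expansion[OF e] by (simp add: c_def hy)
  have c': "(c has_vector_derivative (e + h' *\<^sub>R e')) (at (y \<bullet> e))"
    unfolding c_def using h' by (auto intro!: derivative_eq_intros simp: has_real_derivative_iff_has_vector_derivative[symmetric])
  have cont: "isCont c (y \<bullet> e)" using c' has_vector_derivative_continuous by blast
  have "eventually (\<lambda>s. c s \<in> ball x r \<inter> ball y r2) (at (y \<bullet> e))"
    using cont y r2(1) unfolding isCont_def c0 by (intro topological_tendstoD) auto
  then have ev: "eventually (\<lambda>s. g (c s \<bullet> f) - c s \<bullet> f' = 0) (at (y \<bullet> e))"
  proof eventually_elim
    case (elim s)
    have "c s \<bullet> e = s" "c s \<bullet> e' = h s" by (simp_all add: c_def inner_add_left ee e)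
    then have "c s \<in> frontier \<Omega>" using r elim by auto
    then show ?case using r2(2)[of "c s"] elim by simp
  qed
  have cf: "((\<lambda>s. c s \<bullet> w) has_real_derivative ((e + h' *\<^sub>R e') \<bullet> w)) (at (y \<bullet> e))" for w
    using bounded_linear.has_vector_derivative[OF bounded_linear_inner_left c', of w]
    by (simp add: has_real_derivative_iff_has_vector_derivative)
  have "((\<lambda>s. g (c s \<bullet> f)) has_real_derivative (G * ((e + h' *\<^sub>R e') \<bullet> f))) (at (y \<bullet> e))"
    by (rule DERIV_chain2[OF _ cf]) (simp add: c0 G)
  from DERIV_diff[OF this cf[of f']]
  have d1: "((\<lambda>s. g (c s \<bullet> f) - c s \<bullet> f') has_real_derivative (G * ((e + h' *\<^sub>R e') \<bullet> f) - (e + h' *\<^sub>R e') \<bullet> f')) (at (y \<bullet> e))" .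
  have v0: "g (c (y \<bullet> e) \<bullet> f) - c (y \<bullet> e) \<bullet> f' = 0" using r2(2)[of y] r2(1) y(2) by (simp add: c0)
  have "((\<lambda>s. g (c s \<bullet> f) - c s \<bullet> f') has_real_derivative 0) (at (y \<bullet> e))"
  proof -
    have "((\<lambda>s. 0::real) has_real_derivative 0) (at (y \<bullet> e))" by simp
    moreover have "eventually (\<lambda>s. g (c s \<bullet> f) - c s \<bullet> f' = 0) (nhds (y \<bullet> e))"
      using ev v0 by (simp add: eventually_nhds_conv_at)
    ultimately show ?thesis by (subst DERIV_cong_ev[OF refl _ refl])
  qed
  with d1 have z: "G * ((e + h' *\<^sub>R e') \<bullet> f) - (e + h' *\<^sub>R e') \<bullet> f' = 0" by (rule DERIV_unique)
  then have "(e + h' *\<^sub>R e') \<bullet> (G *\<^sub>R f - f') = 0" by (simp add: inner_diff_right)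
  then show "(e + h' *\<^sub>R e') \<bullet> \<nu> = 0" unfolding \<nu>_eq dG inner_scaleR_right by (simp only: mult_zero_right)
  have "(G *\<^sub>R f - f') \<bullet> f' = -1" by (simp add: inner_diff_left fn ff)
  then have "G *\<^sub>R f - f' \<noteq> 0" by auto
  moreover have "1 + G\<^sup>2 > 0" by (simp add: add_pos_nonneg)
  ultimately show "\<nu> \<noteq> 0" unfolding \<nu>_eq dG by simp
qed

text \<open>The tangential derivative of \<open>F\<close> along the frontier vanishes, since there \<open>P\<close> is tangential, but \<open>F\<close> is
only differentiable inside. So the graph is shifted inwards by \<open>\<epsilon>\<close>. Along the shifted curve the
derivative of \<open>F\<close> is uniformly small, because \<open>P\<close> is uniformly continuous near the point, and in
the limit \<open>\<epsilon> \<rightarrow> 0\<close> the increments of \<open>F\<close> vanish. The set \<open>K\<close> is there for the singularities of \<open>F\<close>.\<close>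

lemma locally_constant_on_frontier:
  fixes F :: "plane \<Rightarrow> real"
  assumes \<Omega>: "open \<Omega>" and nrm: "\<forall>x\<in>frontier \<Omega>. outer_unit_normal \<gamma> \<Omega> x (nrm x)"
    and K: "closed K" "K \<subseteq> \<Omega>"
    and F: "continuous_on (closure \<Omega> - K) F"
    and F': "\<And>y. y \<in> \<Omega> - K \<Longrightarrow> (F has_derivative cross2 (P y)) (at y)"
    and P: "continuous_on (closure \<Omega> - K) P"
    and P0: "\<And>x. x \<in> frontier \<Omega> \<Longrightarrow> P x \<bullet> nrm x = 0"
    and x: "x \<in> frontier \<Omega>"
  shows "eventually (\<lambda>y. F x = F y) (at x within frontier \<Omega>)"
proof -
  have fc: "frontier \<Omega> \<subseteq> closure \<Omega> - K" using K(2) \<Omega> by (auto simp: frontier_def interior_open)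
  obtain e e' h where lg: "local_graph \<gamma> \<Omega> x e e' h"
    using nrm x unfolding outer_unit_normal_def by blast
  have e: "norm e = 1" "norm e' = 1" "e \<bullet> e' = 0" and hC: "C2_holder \<gamma> h"
    using lg by (auto simp: local_graph_def)
  have ee: "e \<bullet> e = 1" "e' \<bullet> e' = 1" "e' \<bullet> e = 0" using e by (simp_all add: dot_square_norm inner_commute)
  obtain r0 where r0: "r0 > 0"
    "\<And>y. y \<in> ball x r0 \<Longrightarrow> y \<in> \<Omega> \<longleftrightarrow> h (y \<bullet> e) < y \<bullet> e'"
    "\<And>y. y \<in> ball x r0 \<Longrightarrow> y \<in> frontier \<Omega> \<longleftrightarrow> h (y \<bullet> e) = y \<bullet> e'"
    using local_graph_frontier[OF \<Omega> lg] by metis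
  obtain r1 where r1: "r1 > 0" "ball x r1 \<subseteq> - K"
    using K fc x by (metis Compl_iff DiffE open_Compl open_contains_ball subsetD)
  define r where "r = min r0 r1"
  have r: "r > 0" "ball x r \<subseteq> ball x r0" "ball x r \<inter> K = {}" using r0 r1 by (auto simp: r_def)
  obtain h' h'' where h': "\<And>s. (h has_real_derivative h' s) (at s)" "\<And>s. (h' has_real_derivative h'' s) (at s)"
    using hC unfolding C2_holder_def by blast
  have conth: "isCont h s" "isCont h' s" for s using h' DERIV_isCont by blast+
  define s0 where "s0 = x \<bullet> e"
  have hx: "h s0 = x \<bullet> e'" using r0(3)[of x] r0(1) x by (simp add: s0_def)
  have xs: "x = s0 *\<^sub>R e + h s0 *\<^sub>R e'" using orthonormal_frame_expansion[OF e] by (simp add: s0_def hx[unfolded s0_def])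
  obtain a0 where a0: "a0 > 0" "\<And>s. \<bar>s - s0\<bar> < a0 \<Longrightarrow> \<bar>h s - h s0\<bar> < r / 4"
    using isCont_realD[OF conth(1)[of s0], of "r / 4"] r(1) by auto
  define a where "a = min (a0 / 2) (r / 4)"
  have a: "a > 0" "a \<le> r / 4" "a < a0" using a0 r by (auto simp: a_def)
  \<comment> \<open>the graph shifted by \<open>\<epsilon>\<close>: in the frontier for \<open>\<epsilon> = 0\<close>, inside for small \<open>\<epsilon> > 0\<close>\<close>
  define c where "c \<epsilon> s = s *\<^sub>R e + (h s + \<epsilon>) *\<^sub>R e'" for \<epsilon> s
  have ce: "c \<epsilon> s \<bullet> e = s" "c \<epsilon> s \<bullet> e' = h s + \<epsilon>" for \<epsilon> s by (simp_all add: c_def inner_add_left ee e)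
  have cball: "dist x (c \<epsilon> s) \<le> 3 * r / 4" if "\<bar>s - s0\<bar> \<le> a" "0 \<le> \<epsilon>" "\<epsilon> \<le> r / 4" for \<epsilon> s
  proof -
    have "x - c \<epsilon> s = (s0 - s) *\<^sub>R e + ((h s0 - h s) - \<epsilon>) *\<^sub>R e'" by (subst xs) (simp add: c_def algebra_simps)
    then have "dist x (c \<epsilon> s) \<le> norm ((s0 - s) *\<^sub>R e) + norm (((h s0 - h s) - \<epsilon>) *\<^sub>R e')"
      unfolding dist_norm by (metis norm_triangle_ineq)
    also have "\<dots> = \<bar>s0 - s\<bar> + \<bar>(h s0 - h s) - \<epsilon>\<bar>" by (simp add: e)
    also have "\<dots> \<le> r / 4 + (r / 4 + r / 4)" using that a a0(2)[of s] by linarith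
    finally show ?thesis by simp
  qed
  have c\<Omega>: "c \<epsilon> s \<in> \<Omega> - K" if "\<bar>s - s0\<bar> \<le> a" "0 < \<epsilon>" "\<epsilon> \<le> r / 4" for \<epsilon> s
  proof -
    have "c \<epsilon> s \<in> ball x r" using cball[of s \<epsilon>] that r(1) by simp
    then show ?thesis using r r0(2)[of "c \<epsilon> s"] that by (auto simp: ce)
  qed
  have cF: "c 0 s \<in> frontier \<Omega>" if "\<bar>s - s0\<bar> \<le> a" for s
  proof -
    have "c 0 s \<in> ball x r" using cball[of s 0] that r(1) by simp
    then show ?thesis using r r0(3)[of "c 0 s"] that by (auto simp: ce)
  qed
  define I where "I = {s0 - a..s0 + a}"
  have I: "s \<in> I \<longleftrightarrow> \<bar>s - s0\<bar> \<le> a" for s by (auto simp: I_def)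
  obtain H where H: "\<And>s. s \<in> I \<Longrightarrow> \<bar>h' s\<bar> \<le> H"
  proof -
    have "compact (h' ` I)" using conth(2) by (intro compact_continuous_image continuous_at_imp_continuous_on) (auto simp: I_def)
    then have "bounded (h' ` I)" by (rule compact_imp_bounded)
    then obtain H1 where "\<forall>u\<in>h' ` I. norm u \<le> H1" unfolding bounded_iff by blast
    then show thesis by (intro that[of H1]) auto
  qed
  have H0: "H \<ge> 0" using H[of s0] a by (force simp: I)
  have tang: "cross2 (P (c 0 s)) (e + h' s *\<^sub>R e') = 0" if s: "s \<in> I" for s
  proof -
    have "c 0 s \<in> ball x r" using cball[of s 0] s r(1) by (auto simp: I)
    then have b: "c 0 s \<in> ball x r0" using r(2) by blast
    have f: "c 0 s \<in> frontier \<Omega>" using cF s by (simp add: I)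
    have "(e + h' s *\<^sub>R e') \<bullet> nrm (c 0 s) = 0" "nrm (c 0 s) \<noteq> 0"
      using outer_unit_normal_orthogonal_tangent[OF \<Omega> lg r0(3) b f, of "nrm (c 0 s)" "h' s"] nrm f h'(1) by (auto simp: ce)
    then show ?thesis using P0[OF f] cross2_orthogonal by blast
  qed
  define C where "C = closure \<Omega> \<inter> cball x (3 * r / 4)"
  have Ccomp: "compact C" unfolding C_def by (rule closed_Int_compact) auto
  have "cball x (3 * r / 4) \<subseteq> ball x r" using r(1) by auto
  then have Csub: "C \<subseteq> closure \<Omega> - K" using r(3) by (auto simp: C_def)
  have uP: "uniformly_continuous_on C P"
    by (rule compact_uniformly_continuous[OF continuous_on_subset[OF P Csub] Ccomp])
  have cC: "c \<epsilon> s \<in> C" if "s \<in> I" "0 \<le> \<epsilon>" "\<epsilon> \<le> r / 4" for \<epsilon> s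
    using that cball[of s \<epsilon>] c\<Omega>[of s \<epsilon>] cF[of s] closure_subset[of \<Omega>] fc by (cases "\<epsilon> = 0") (auto simp: C_def I)
  have const: "F (c 0 s1) = F (c 0 s2)" if s12: "s1 \<in> I" "s2 \<in> I" for s1 s2
  proof -
    have bound: "\<bar>F (c 0 s1) - F (c 0 s2)\<bar> \<le> 0 + (2 * (1 + H) * \<bar>s1 - s2\<bar>) * \<eta>" if \<eta>: "\<eta> > 0" for \<eta>
    proof -
      obtain d where d: "d > 0" "\<And>u v. u \<in> C \<Longrightarrow> v \<in> C \<Longrightarrow> dist v u < d \<Longrightarrow> dist (P v) (P u) < \<eta>"
        using uP \<eta> unfolding uniformly_continuous_on_def by metis
      have step: "\<bar>F (c \<epsilon> s1) - F (c \<epsilon> s2)\<bar> \<le> 2 * (1 + H) * \<eta> * \<bar>s1 - s2\<bar>" if \<epsilon>: "0 < \<epsilon>" "\<epsilon> < min d (r / 4)" for \<epsilon>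
      proof -
        have "norm (F (c \<epsilon> s1) - F (c \<epsilon> s2)) \<le> (2 * (1 + H) * \<eta>) * norm (s1 - s2)"
        proof (rule field_differentiable_bound[where S = I and f' = "\<lambda>s. cross2 (P (c \<epsilon> s)) (e + h' s *\<^sub>R e')"])
          fix s assume s: "s \<in> I"
          have "(c \<epsilon> has_vector_derivative (e + h' s *\<^sub>R e')) (at s)"
            unfolding c_def using h'(1) by (auto intro!: derivative_eq_intros simp: has_real_derivative_iff_has_vector_derivative[symmetric])
          then have cd: "(c \<epsilon> has_derivative (\<lambda>t. t *\<^sub>R (e + h' s *\<^sub>R e'))) (at s)"
            by (simp add: has_vector_derivative_def)
          have "c \<epsilon> s \<in> \<Omega> - K" using c\<Omega>[of s \<epsilon>] s \<epsilon> by (simp add: I)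
          from has_derivative_compose[OF cd F'[OF this]]
          have "((\<lambda>s. F (c \<epsilon> s)) has_derivative (\<lambda>t. cross2 (P (c \<epsilon> s)) (t *\<^sub>R (e + h' s *\<^sub>R e')))) (at s)" .
          moreover have "cross2 u (t *\<^sub>R v) = cross2 u v * t" for u v t by (simp add: cross2_def algebra_simps)
          ultimately show "((\<lambda>s. F (c \<epsilon> s)) has_field_derivative cross2 (P (c \<epsilon> s)) (e + h' s *\<^sub>R e')) (at s within I)"
            by (simp add: has_field_derivative_def has_derivative_at_withinI)
          have "dist (c \<epsilon> s) (c 0 s) = \<epsilon>" using \<epsilon> by (simp add: c_def dist_norm e algebra_simps)
          then have "dist (P (c \<epsilon> s)) (P (c 0 s)) < \<eta>" using \<epsilon> s by (intro d(2) cC) auto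
          then have "norm (P (c \<epsilon> s) - P (c 0 s)) \<le> \<eta>" by (simp add: dist_norm)
          moreover have "norm (e + h' s *\<^sub>R e') \<le> 1 + H"
            using norm_triangle_ineq[of e "h' s *\<^sub>R e'"] e H[OF s] by simp
          ultimately have "2 * norm (P (c \<epsilon> s) - P (c 0 s)) * norm (e + h' s *\<^sub>R e') \<le> 2 * \<eta> * (1 + H)"
            using H0 \<eta> by (intro mult_mono) auto
          then show "norm (cross2 (P (c \<epsilon> s)) (e + h' s *\<^sub>R e')) \<le> 2 * (1 + H) * \<eta>"
            using cross2_bound[of "P (c \<epsilon> s) - P (c 0 s)" "e + h' s *\<^sub>R e'"] tang[OF s]
            by (simp add: cross2_diff_left mult_ac)
        qed (use s12 in \<open>auto simp: I_def\<close>)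
        then show ?thesis by simp
      qed
      have lim: "((\<lambda>\<epsilon>. F (c \<epsilon> s)) \<longlongrightarrow> F (c 0 s)) (at_right 0)" if s: "s \<in> I" for s
      proof -
        have 1: "((\<lambda>\<epsilon>. c \<epsilon> s) \<longlongrightarrow> c 0 s) (at_right 0)"
          unfolding c_def by (intro tendsto_intros)
        have "c \<epsilon> s \<in> closure \<Omega> - K" if "0 < \<epsilon>" "\<epsilon> < r / 4" for \<epsilon>
          by (rule subsetD[OF Csub cC[OF s]]) (use that in auto)
        then have 2: "eventually (\<lambda>\<epsilon>. c \<epsilon> s \<in> closure \<Omega> - K) (at_right 0)"
          unfolding eventually_at_right_field using r(1) by (intro exI[of _ "r/4"]) auto
        have 3: "c 0 s \<in> closure \<Omega> - K" using cF[of s] s fc by (auto simp: I)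
        show ?thesis by (rule continuous_on_tendsto_compose[OF F 1 3 2])
      qed
      have "((\<lambda>\<epsilon>. \<bar>F (c \<epsilon> s1) - F (c \<epsilon> s2)\<bar>) \<longlongrightarrow> \<bar>F (c 0 s1) - F (c 0 s2)\<bar>) (at_right 0)"
        by (intro tendsto_intros lim s12)
      moreover have "eventually (\<lambda>\<epsilon>. \<bar>F (c \<epsilon> s1) - F (c \<epsilon> s2)\<bar> \<le> 2 * (1 + H) * \<eta> * \<bar>s1 - s2\<bar>) (at_right 0)"
        unfolding eventually_at_right_field using step d(1) r(1) by (intro exI[of _ "min d (r/4)"]) auto
      ultimately have "\<bar>F (c 0 s1) - F (c 0 s2)\<bar> \<le> 2 * (1 + H) * \<eta> * \<bar>s1 - s2\<bar>"
        by (rule tendsto_upperbound) simp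
      then show ?thesis by (simp add: mult_ac)
    qed
    have "\<bar>F (c 0 s1) - F (c 0 s2)\<bar> \<le> 0"
      by (rule le_of_le_add_small[of 1, OF _ bound]) auto
    then show ?thesis by simp
  qed
  have "F x = F y" if y: "y \<in> frontier \<Omega>" "dist y x < a" for y
  proof -
    have "y \<in> ball x r0" using y(2) a r by (auto simp: dist_commute r_def)
    then have "h (y \<bullet> e) = y \<bullet> e'" using r0(3) y by simp
    then have yc: "y = c 0 (y \<bullet> e)" using orthonormal_frame_expansion[OF e, of y] by (simp add: c_def)
    have "\<bar>y \<bullet> e - s0\<bar> = \<bar>(y - x) \<bullet> e\<bar>" by (simp add: s0_def inner_diff_left)
    also have "\<dots> \<le> norm (y - x) * norm e" by (rule Cauchy_Schwarz_ineq2)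
    finally have "y \<bullet> e \<in> I" using y(2) e by (simp add: I dist_norm)
    moreover have "x = c 0 s0" using xs by (simp add: c_def)
    moreover have "s0 \<in> I" using a by (simp add: I)
    ultimately show ?thesis using const yc by metis
  qed
  then show ?thesis unfolding eventually_at using a(1) by blast
qed

text \<open>The domain is not convex, so the estimate along segments does not apply to arbitrary pairs of
points. Near a frontier point two points are joined by three segments of small total length: up to a
common height, across, and down again. Compactness of the closure, by a Lebesgue number, turns the
resulting bounds on local oscillation into uniform continuity.\<close>

lemma uniformly_continuous_of_segment_Lipschitz:
  fixes V :: "plane \<Rightarrow> 'b::real_normed_vector"
  assumes \<Omega>: "open \<Omega>" "bounded \<Omega>" and nrm: "\<forall>x\<in>frontier \<Omega>. outer_unit_normal \<gamma> \<Omega> x (nrm x)"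
    and V: "\<And>y z. closed_segment y z \<subseteq> \<Omega> \<Longrightarrow> norm (V y - V z) \<le> B * norm (y - z)" and B: "B > 0"
  shows "uniformly_continuous_on \<Omega> V"
proof -
  have osc: "\<exists>\<rho>>0. \<forall>y\<in>\<Omega> \<inter> ball x \<rho>. \<forall>z\<in>\<Omega> \<inter> ball x \<rho>. norm (V y - V z) < \<epsilon>"
    if x: "x \<in> closure \<Omega>" and \<epsilon>: "\<epsilon> > 0" for x \<epsilon>
  proof (cases "x \<in> \<Omega>")
    case True
    then obtain \<rho>0 where \<rho>0: "\<rho>0 > 0" "ball x \<rho>0 \<subseteq> \<Omega>" using \<Omega>(1) open_contains_ball by blast
    define \<rho> where "\<rho> = min \<rho>0 (\<epsilon> / (4 * B))"
    have \<rho>: "\<rho> > 0" "ball x \<rho> \<subseteq> \<Omega>" "B * (2 * \<rho>) < \<epsilon>"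
    proof -
      have "\<rho> \<le> \<epsilon> / (4 * B)" by (simp add: \<rho>_def)
      then have "B * (2 * \<rho>) \<le> B * (2 * (\<epsilon> / (4 * B)))" using B by (intro mult_left_mono) auto
      also have "\<dots> < \<epsilon>" using B \<epsilon> by simp
      finally show "B * (2 * \<rho>) < \<epsilon>" .
    qed (use \<rho>0 \<epsilon> B in \<open>auto simp: \<rho>_def\<close>)
    have "norm (V y - V z) < \<epsilon>" if "y \<in> ball x \<rho>" "z \<in> ball x \<rho>" for y z
    proof -
      have "closed_segment y z \<subseteq> \<Omega>" using that \<rho>(2) closed_segment_subset[OF that convex_ball] by blast
      then have "norm (V y - V z) \<le> B * norm (y - z)" by (rule V)
      also have "norm (y - z) \<le> 2 * \<rho>" using that dist_triangle2[of y z x] by (simp add: dist_norm norm_minus_commute)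
      finally show ?thesis using \<rho>(3) B by (smt (verit) mult_left_mono)
    qed
    then show ?thesis using \<rho>(1) by blast
  next
    case False
    then have xf: "x \<in> frontier \<Omega>" using x \<Omega>(1) by (simp add: frontier_def interior_open)
    obtain e e' h where lg: "local_graph \<gamma> \<Omega> x e e' h"
      using nrm xf unfolding outer_unit_normal_def by blast
    have e: "norm e = 1" "norm e' = 1" "e \<bullet> e' = 0" and hC: "C2_holder \<gamma> h"
      using lg by (auto simp: local_graph_def)
    have ee: "e \<bullet> e = 1" "e' \<bullet> e' = 1" "e' \<bullet> e = 0" using e by (simp_all add: dot_square_norm inner_commute)
    obtain r where r: "r > 0"
      "\<And>y. y \<in> ball x r \<Longrightarrow> y \<in> \<Omega> \<longleftrightarrow> h (y \<bullet> e) < y \<bullet> e'"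
      "\<And>y. y \<in> ball x r \<Longrightarrow> y \<in> frontier \<Omega> \<longleftrightarrow> h (y \<bullet> e) = y \<bullet> e'"
      using local_graph_frontier[OF \<Omega>(1) lg] by metis
    define s0 where "s0 = x \<bullet> e"
    have hx: "h s0 = x \<bullet> e'" using r(3)[of x] r(1) xf by (simp add: s0_def)
    define p where "p s t = s *\<^sub>R e + t *\<^sub>R e'" for s t
    have pe: "p s t \<bullet> e = s" "p s t \<bullet> e' = t" for s t by (simp_all add: p_def inner_add_left ee e)
    have py: "p (y \<bullet> e) (y \<bullet> e') = y" for y using orthonormal_frame_expansion[OF e] by (simp add: p_def)
    have pd: "norm (p s t - p s' t') \<le> \<bar>s - s'\<bar> + \<bar>t - t'\<bar>" for s t s' t'
    proof -
      have "p s t - p s' t' = (s - s') *\<^sub>R e + (t - t') *\<^sub>R e'" by (simp add: p_def algebra_simps)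
      then show ?thesis using norm_triangle_ineq[of "(s - s') *\<^sub>R e" "(t - t') *\<^sub>R e'"] by (simp add: e)
    qed
    define \<kappa> where "\<kappa> = min (r / 4) (\<epsilon> / (8 * B))"
    have \<kappa>: "\<kappa> > 0" "\<kappa> \<le> r / 4" using r \<epsilon> B by (auto simp: \<kappa>_def)
    have \<kappa>B: "B * (6 * \<kappa>) < \<epsilon>"
    proof -
      have "B * (6 * \<kappa>) \<le> B * (6 * (\<epsilon> / (8 * B)))" using B by (intro mult_left_mono) (auto simp: \<kappa>_def)
      also have "\<dots> < \<epsilon>" using B \<epsilon> by simp
      finally show ?thesis .
    qed
    have ch: "isCont h s0" using hC DERIV_isCont unfolding C2_holder_def by blast
    obtain a0 where a0: "a0 > 0" "\<And>s. \<bar>s - s0\<bar> < a0 \<Longrightarrow> \<bar>h s - h s0\<bar> < \<kappa> / 2"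
      using isCont_realD[OF ch, of "\<kappa> / 2"] \<kappa>(1) by auto
    define \<rho> where "\<rho> = min a0 (\<kappa> / 2)"
    have \<rho>: "\<rho> > 0" "\<rho> \<le> a0" "\<rho> \<le> \<kappa> / 2" using a0 \<kappa> by (auto simp: \<rho>_def)
    have in\<Omega>: "p s t \<in> \<Omega>" if "\<bar>s - s0\<bar> < \<rho>" "\<bar>t - h s0\<bar> \<le> \<kappa>" "t > h s" for s t
    proof -
      have "x = p s0 (h s0)" using py[of x] by (simp add: s0_def hx[unfolded s0_def])
      then have "norm (x - p s t) \<le> \<bar>s0 - s\<bar> + \<bar>h s0 - t\<bar>" using pd by metis
      also have "\<dots> < r" using that \<rho> \<kappa> r(1) by linarith
      finally have "p s t \<in> ball x r" by (simp add: dist_norm)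
      then show ?thesis using r(2) that by (simp add: pe)
    qed
    \<comment> \<open>a height above the graph over the whole interval\<close>
    define t0 where "t0 = h s0 + \<kappa>"
    have t0: "t0 > h s" if "\<bar>s - s0\<bar> < \<rho>" for s using a0(2)[of s] that \<rho> \<kappa>(1) unfolding t0_def by linarith
    have vert: "norm (V (p s t) - V (p s t0)) \<le> B * (2 * \<kappa>)" if s: "\<bar>s - s0\<bar> < \<rho>" and t: "\<bar>t - h s0\<bar> \<le> \<kappa>" "t > h s" for s t
    proof -
      have "closed_segment (p s t) (p s t0) \<subseteq> \<Omega>"
      proof
        fix z assume "z \<in> closed_segment (p s t) (p s t0)"
        then obtain u where u: "0 \<le> u" "u \<le> 1" "z = (1 - u) *\<^sub>R p s t + u *\<^sub>R p s t0" by (auto simp: closed_segment_def)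
        then have z: "z = p s ((1 - u) * t + u * t0)" by (simp add: p_def algebra_simps)
        have m: "(1 - u) * t + u * t0 = t + u * (t0 - t)" by (simp add: algebra_simps)
        have tt: "t \<le> t0" using t(1) by (simp add: t0_def)
        have "0 \<le> u * (t0 - t)" "u * (t0 - t) \<le> t0 - t" using u tt by (auto simp: mult_left_le_one_le)
        then have "(1 - u) * t + u * t0 \<ge> t" "(1 - u) * t + u * t0 \<le> t0" unfolding m by auto
        then show "z \<in> \<Omega>" unfolding z using t s by (intro in\<Omega>) (auto simp: t0_def)
      qed
      then have "norm (V (p s t) - V (p s t0)) \<le> B * norm (p s t - p s t0)" by (rule V)
      also have "\<dots> \<le> B * (2 * \<kappa>)" using pd[of s t s t0] t B \<kappa>(1) unfolding t0_def by (intro mult_left_mono) auto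
      finally show ?thesis .
    qed
    have "norm (V y - V z) < \<epsilon>" if yz: "y \<in> \<Omega> \<inter> ball x \<rho>" "z \<in> \<Omega> \<inter> ball x \<rho>" for y z
    proof -
      have co: "\<bar>w \<bullet> e - s0\<bar> < \<rho> \<and> \<bar>w \<bullet> e' - h s0\<bar> \<le> \<kappa> \<and> w \<bullet> e' > h (w \<bullet> e)" if w: "w \<in> \<Omega> \<inter> ball x \<rho>" for w
      proof -
        have "\<bar>w \<bullet> e - s0\<bar> = \<bar>(w - x) \<bullet> e\<bar>" "\<bar>w \<bullet> e' - h s0\<bar> = \<bar>(w - x) \<bullet> e'\<bar>" by (simp_all add: s0_def inner_diff_left hx[unfolded s0_def])
        moreover have "\<bar>(w - x) \<bullet> e\<bar> \<le> norm (w - x) * norm e" "\<bar>(w - x) \<bullet> e'\<bar> \<le> norm (w - x) * norm e'" by (rule Cauchy_Schwarz_ineq2)+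
        moreover have "norm (w - x) < \<rho>" using w by (simp add: dist_norm norm_minus_commute)
        moreover have "w \<in> ball x r" using w \<rho> \<kappa> r(1) by auto
        then have "w \<bullet> e' > h (w \<bullet> e)" using r(2) w by blast
        ultimately show ?thesis using e \<rho> \<kappa> by auto
      qed
      note cy = co[OF yz(1)] and cz = co[OF yz(2)]
      have "closed_segment (p (y \<bullet> e) t0) (p (z \<bullet> e) t0) \<subseteq> \<Omega>"
      proof
        fix w assume "w \<in> closed_segment (p (y \<bullet> e) t0) (p (z \<bullet> e) t0)"
        then obtain u where u: "0 \<le> u" "u \<le> 1" "w = (1 - u) *\<^sub>R p (y \<bullet> e) t0 + u *\<^sub>R p (z \<bullet> e) t0" by (auto simp: closed_segment_def)
        then have w: "w = p ((1 - u) * (y \<bullet> e) + u * (z \<bullet> e)) t0" by (simp add: p_def algebra_simps)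
        have "(1 - u) *\<^sub>R (y \<bullet> e) + u *\<^sub>R (z \<bullet> e) \<in> ball s0 \<rho>"
          using cy cz u by (intro convexD[OF convex_ball]) (auto simp: dist_real_def)
        then have "\<bar>((1 - u) * (y \<bullet> e) + u * (z \<bullet> e)) - s0\<bar> < \<rho>" by (simp add: dist_real_def)
        then show "w \<in> \<Omega>" unfolding w using t0 \<kappa> by (intro in\<Omega>) (auto simp: t0_def)
      qed
      then have "norm (V (p (y \<bullet> e) t0) - V (p (z \<bullet> e) t0)) \<le> B * norm (p (y \<bullet> e) t0 - p (z \<bullet> e) t0)" by (rule V)
      also have "\<dots> \<le> B * (2 * \<kappa>)" using pd[of "y \<bullet> e" t0 "z \<bullet> e" t0] cy cz B \<rho> by (intro mult_left_mono) auto
      finally have hor: "norm (V (p (y \<bullet> e) t0) - V (p (z \<bullet> e) t0)) \<le> B * (2 * \<kappa>)" .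
      have vy: "norm (V y - V (p (y \<bullet> e) t0)) \<le> B * (2 * \<kappa>)" using vert[of "y \<bullet> e" "y \<bullet> e'"] cy py[of y] by simp
      have vz: "norm (V z - V (p (z \<bullet> e) t0)) \<le> B * (2 * \<kappa>)" using vert[of "z \<bullet> e" "z \<bullet> e'"] cz py[of z] by simp
      have "V y - V z = (V y - V (p (y \<bullet> e) t0)) + (V (p (y \<bullet> e) t0) - V (p (z \<bullet> e) t0)) - (V z - V (p (z \<bullet> e) t0))" by simp
      also have "norm \<dots> \<le> norm (V y - V (p (y \<bullet> e) t0)) + norm (V (p (y \<bullet> e) t0) - V (p (z \<bullet> e) t0)) + norm (V z - V (p (z \<bullet> e) t0))"
        by (meson add_right_mono norm_triangle_ineq norm_triangle_ineq4 order_trans)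
      also have "\<dots> < \<epsilon>" using hor vy vz \<kappa>B by linarith
      finally show ?thesis .
    qed
    then show ?thesis using \<rho>(1) by blast
  qed
  show ?thesis
    unfolding uniformly_continuous_on_def
  proof (intro allI impI)
    fix \<epsilon> :: real assume \<epsilon>: "\<epsilon> > 0"
    obtain \<rho> where \<rho>: "\<And>x. x \<in> closure \<Omega> \<Longrightarrow> \<rho> x > 0"
       "\<And>x y z. x \<in> closure \<Omega> \<Longrightarrow> y \<in> \<Omega> \<inter> ball x (\<rho> x) \<Longrightarrow> z \<in> \<Omega> \<inter> ball x (\<rho> x) \<Longrightarrow> norm (V y - V z) < \<epsilon>"
      using osc[OF _ \<epsilon>] by metis
    have cc: "compact (closure \<Omega>)" using \<Omega>(2) by (simp add: compact_closure)
    show "\<exists>d>0. \<forall>x\<in>\<Omega>. \<forall>x'\<in>\<Omega>. dist x' x < d \<longrightarrow> dist (V x') (V x) < \<epsilon>"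
    proof (cases "\<Omega> = {}")
      case False
      define \<C> where "\<C> = (\<lambda>x. ball x (\<rho> x)) ` closure \<Omega>"
      have C1: "\<C> \<noteq> {}" using False by (simp add: \<C>_def)
      have C2: "closure \<Omega> \<subseteq> \<Union>\<C>"
      proof
        fix x assume "x \<in> closure \<Omega>"
        then show "x \<in> \<Union>\<C>" using \<rho>(1)[of x] unfolding \<C>_def by (intro UnionI[of "ball x (\<rho> x)"]) auto
      qed
      have C3: "\<And>U. U \<in> \<C> \<Longrightarrow> open U" unfolding \<C>_def by auto
      obtain d where d: "d > 0" "\<And>T. T \<subseteq> closure \<Omega> \<Longrightarrow> diameter T < d \<Longrightarrow> \<exists>U\<in>\<C>. T \<subseteq> U"
        using Lebesgue_number_lemma[OF cc C1 C2 C3] by blast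
      have "dist (V y) (V z) < \<epsilon>" if "y \<in> \<Omega>" "z \<in> \<Omega>" "dist y z < d" for y z
      proof -
        have "diameter {y, z} \<le> dist y z"
          by (rule diameter_le) (auto simp: dist_norm norm_minus_commute)
        then have "diameter {y, z} < d" using that by simp
        moreover have "{y, z} \<subseteq> closure \<Omega>" using that closure_subset by blast
        ultimately obtain U where "U \<in> \<C>" "{y, z} \<subseteq> U" using d(2) by blast
        then obtain x where "x \<in> closure \<Omega>" "{y, z} \<subseteq> ball x (\<rho> x)" unfolding \<C>_def by blast
        then show ?thesis using \<rho>(2)[of x y z] that by (simp add: dist_norm)
      qed
      with d(1) show ?thesis by blast
    qed (auto intro: exI[of _ 1])
  qed
qed

section \<open>The Neumann problem in complex coordinates\<close>

text \<open>Schwarz's theorem in the form that assumes differentiability of the gradient \<open>G\<close> at the single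
point \<open>x\<close>. The second difference \<open>\<Delta> t\<close> is symmetric in \<open>a\<close> and \<open>b\<close>, and by the mean value theorem it
is \<open>t * t * (A b \<bullet> a)\<close> up to an error of smaller order.\<close>

lemma second_derivative_symmetric:
  fixes u :: "'a::real_inner \<Rightarrow> real"
  assumes \<Omega>: "open \<Omega>" "x \<in> \<Omega>" and u: "\<And>y. y \<in> \<Omega> \<Longrightarrow> GDERIV u y :> G y"
    and G: "(G has_derivative A) (at x)"
  shows "A a \<bullet> b = A b \<bullet> a"
proof -
  have lin: "linear A" using G by (rule has_derivative_linear)
  obtain r where r: "r > 0" "ball x r \<subseteq> \<Omega>" using \<Omega> open_contains_ball by blast
  define N where "N = norm a + norm b + 1"
  have N: "N > 0" by (simp add: N_def add_nonneg_pos)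
  define \<Delta> where "\<Delta> t = u (x + t *\<^sub>R a + t *\<^sub>R b) - u (x + t *\<^sub>R a) - u (x + t *\<^sub>R b) + u x" for t
  have key: "\<bar>u (x + t *\<^sub>R a + t *\<^sub>R b) - u (x + t *\<^sub>R a) - u (x + t *\<^sub>R b) + u x - t * (t * (A b \<bullet> a))\<bar> \<le> t * (t * (2 * \<epsilon> * N * N))"
    if ab: "norm a + norm b \<le> N" and t: "0 < t" "t * N < d" "t * N < r" and \<epsilon>: "\<epsilon> > 0"
      and d: "\<And>v. norm v < d \<Longrightarrow> norm (G (x + v) - G x - A v) \<le> \<epsilon> * norm v"
    for a b t d \<epsilon>
  proof -
    have sm: "norm (s *\<^sub>R a + t' *\<^sub>R b) \<le> t * N" if "0 \<le> s" "s \<le> t" "0 \<le> t'" "t' \<le> t" for s t'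
    proof -
      have "norm (s *\<^sub>R a + t' *\<^sub>R b) \<le> s * norm a + t' * norm b" using norm_triangle_ineq[of "s *\<^sub>R a" "t' *\<^sub>R b"] that by simp
      also have "\<dots> \<le> t * norm a + t * norm b" using that by (intro add_mono mult_right_mono) auto
      also have "\<dots> \<le> t * N" using ab t by (simp add: distrib_left[symmetric])
      finally show ?thesis .
    qed
    have inO: "x + (s *\<^sub>R a + t' *\<^sub>R b) \<in> \<Omega>" if "0 \<le> s" "s \<le> t" "0 \<le> t'" "t' \<le> t" for s t'
    proof -
      have "norm (s *\<^sub>R a + t' *\<^sub>R b) < r" using sm[OF that] t by linarith
      then have "x + (s *\<^sub>R a + t' *\<^sub>R b) \<in> ball x r" 
        by (subst mem_ball, subst dist_commute) (simp add: dist_norm)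
      then show ?thesis using r by blast
    qed
    define \<phi> where "\<phi> s = u (x + (s *\<^sub>R a + t *\<^sub>R b)) - u (x + (s *\<^sub>R a + 0 *\<^sub>R b))" for s
    define \<phi>' where "\<phi>' s = (G (x + (s *\<^sub>R a + t *\<^sub>R b)) - G (x + (s *\<^sub>R a + 0 *\<^sub>R b))) \<bullet> a" for s
    have der: "(\<phi> has_real_derivative \<phi>' s) (at s)" if s: "0 \<le> s" "s \<le> t" for s
    proof -
      have d1: "((\<lambda>s. u (x + (s *\<^sub>R a + t' *\<^sub>R b))) has_real_derivative (a \<bullet> G (x + (s *\<^sub>R a + t' *\<^sub>R b)))) (at s)"
        if "0 \<le> t'" "t' \<le> t" for t'
      proof -
        have "((\<lambda>s. x + (s *\<^sub>R a + t' *\<^sub>R b)) has_derivative (\<lambda>\<tau>. \<tau> *\<^sub>R a)) (at s)"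
          by (auto intro!: derivative_eq_intros)
        from has_derivative_compose[OF this u[OF inO[OF s that], unfolded gderiv_def]]
        have "((\<lambda>s. u (x + (s *\<^sub>R a + t' *\<^sub>R b))) has_derivative (\<lambda>\<tau>. (\<tau> *\<^sub>R a) \<bullet> G (x + (s *\<^sub>R a + t' *\<^sub>R b)))) (at s)" .
        then show ?thesis by (simp add: has_field_derivative_def mult.commute[of _ "a \<bullet> _"])
      qed
      show ?thesis unfolding \<phi>_def \<phi>'_def using DERIV_diff[OF d1[of t] d1[of 0]] t
        by (simp add: inner_diff_left inner_diff_right inner_commute)
    qed
    obtain \<xi> where \<xi>: "0 < \<xi>" "\<xi> < t" "\<phi> t - \<phi> 0 = (t - 0) * \<phi>' \<xi>"
      using MVT2[OF t(1), of \<phi> \<phi>'] der by auto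
    define v w where "v = \<xi> *\<^sub>R a + t *\<^sub>R b" and "w = \<xi> *\<^sub>R a + 0 *\<^sub>R b"
    have vw: "norm v \<le> t * N" "norm w \<le> t * N" using sm[of \<xi> t] sm[of \<xi> 0] \<xi> t unfolding v_def w_def by auto
    have Avw: "A v - A w = t *\<^sub>R A b"
      unfolding v_def w_def by (simp add: linear_add[OF lin] linear_scale[OF lin])
    have "\<phi>' \<xi> - t * (A b \<bullet> a) = ((G (x + v) - G x - A v) - (G (x + w) - G x - A w)) \<bullet> a"
    proof -
      have 1: "\<phi>' \<xi> = (G (x + v) - G (x + w)) \<bullet> a" by (simp only: \<phi>'_def v_def w_def)
      have 2: "t * (A b \<bullet> a) = (A v - A w) \<bullet> a" by (simp only: Avw inner_scaleR_left)
      show ?thesis unfolding 1 2 by (simp add: inner_diff_left)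
    qed
    also have "\<bar>\<dots>\<bar> \<le> norm ((G (x + v) - G x - A v) - (G (x + w) - G x - A w)) * norm a" by (rule Cauchy_Schwarz_ineq2)
    also have "\<dots> \<le> (\<epsilon> * (t * N) + \<epsilon> * (t * N)) * N"
    proof (intro mult_mono)
      have "norm (G (x + v) - G x - A v) \<le> \<epsilon> * (t * N)" "norm (G (x + w) - G x - A w) \<le> \<epsilon> * (t * N)"
        using d[of v] d[of w] vw t(2) \<epsilon> by (smt (verit) mult_left_mono)+
      then show "norm ((G (x + v) - G x - A v) - (G (x + w) - G x - A w)) \<le> \<epsilon> * (t * N) + \<epsilon> * (t * N)"
        by (meson add_mono norm_triangle_ineq4 order_trans)
      show "norm a \<le> N" using ab norm_ge_zero[of b] by linarith
    qed (use \<epsilon> t ab in \<open>auto intro!: add_nonneg_nonneg mult_nonneg_nonneg simp: N_def\<close>)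
    finally have "\<bar>\<phi>' \<xi> - t * (A b \<bullet> a)\<bar> \<le> t * (2 * \<epsilon> * N * N)" by (simp add: algebra_simps)
    then have "t * \<bar>\<phi>' \<xi> - t * (A b \<bullet> a)\<bar> \<le> t * (t * (2 * \<epsilon> * N * N))" using t by (intro mult_left_mono) auto
    moreover have "\<phi> t - \<phi> 0 - t * (t * (A b \<bullet> a)) = t * (\<phi>' \<xi> - t * (A b \<bullet> a))" using \<xi>(3) by (simp add: algebra_simps)
    ultimately have "\<bar>\<phi> t - \<phi> 0 - t * (t * (A b \<bullet> a))\<bar> \<le> t * (t * (2 * \<epsilon> * N * N))"
      using t by (simp add: abs_mult)
    moreover have "\<phi> t - \<phi> 0 = u (x + t *\<^sub>R a + t *\<^sub>R b) - u (x + t *\<^sub>R a) - u (x + t *\<^sub>R b) + u x"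
      by (simp add: \<phi>_def algebra_simps)
    ultimately show ?thesis by simp
  qed
  have "\<bar>A a \<bullet> b - A b \<bullet> a\<bar> \<le> 0"
  proof (rule le_of_le_add_small[of 1 _ _ "4 * N * N"])
    fix \<epsilon> :: real assume \<epsilon>: "0 < \<epsilon>" "\<epsilon> < 1"
    obtain d where d: "d > 0" "\<And>y. norm (y - x) < d \<Longrightarrow> norm (G y - G x - A (y - x)) \<le> \<epsilon> * norm (y - x)"
      using G \<epsilon> unfolding has_derivative_at_alt by blast
    have d': "norm (G (x + v) - G x - A v) \<le> \<epsilon> * norm v" if "norm v < d" for v using d(2)[of "x + v"] that by simp
    define t where "t = min d r / (2 * N)"
    have t: "0 < t" "t * N < d" "t * N < r" using d r N by (auto simp: t_def)
    have 1: "\<bar>u (x + t *\<^sub>R a + t *\<^sub>R b) - u (x + t *\<^sub>R a) - u (x + t *\<^sub>R b) + u x - t * (t * (A b \<bullet> a))\<bar> \<le> t * (t * (2 * \<epsilon> * N * N))"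
      by (rule key[OF _ t \<epsilon>(1) d']) (auto simp: N_def)
    have "\<bar>u (x + t *\<^sub>R b + t *\<^sub>R a) - u (x + t *\<^sub>R b) - u (x + t *\<^sub>R a) + u x - t * (t * (A a \<bullet> b))\<bar> \<le> t * (t * (2 * \<epsilon> * N * N))"
      by (rule key[OF _ t \<epsilon>(1) d']) (auto simp: N_def)
    moreover have "x + t *\<^sub>R b + t *\<^sub>R a = x + t *\<^sub>R a + t *\<^sub>R b" by simp
    ultimately have 2: "\<bar>u (x + t *\<^sub>R a + t *\<^sub>R b) - u (x + t *\<^sub>R b) - u (x + t *\<^sub>R a) + u x - t * (t * (A a \<bullet> b))\<bar> \<le> t * (t * (2 * \<epsilon> * N * N))" by simp
    have "\<bar>t * (t * (A a \<bullet> b)) - t * (t * (A b \<bullet> a))\<bar> \<le> 2 * (t * (t * (2 * \<epsilon> * N * N)))" using 1 2 by linarith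
    then have "(t * t) * \<bar>A a \<bullet> b - A b \<bullet> a\<bar> \<le> (t * t) * (4 * N * N * \<epsilon>)"
      using t(1) by (simp add: right_diff_distrib[symmetric] abs_mult mult_ac)
    then show "\<bar>A a \<bullet> b - A b \<bullet> a\<bar> \<le> 0 + 4 * N * N * \<epsilon>" using t(1) by simp
  qed simp
  then show ?thesis by simp
qed

text \<open>In the coordinates \<open>X = lam * x $ 1\<close> and \<open>Y = x $ 2\<close> the equation \<open>div (L \<nabla> u) = 0\<close> is Laplace's
equation.\<close>

definition stretch :: "real \<Rightarrow> plane \<Rightarrow> complex" where
  "stretch lam x = Complex (lam * x $ 1) (x $ 2)"

definition unstretch :: "real \<Rightarrow> complex \<Rightarrow> plane" where
  "unstretch lam z = vector [Re z / lam, Im z]"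

text \<open>For a gradient \<open>p\<close> of \<open>u\<close> in the original coordinates this is \<open>u\<^sub>X - \<i> * u\<^sub>Y\<close>, the
derivative of a holomorphic function with real part \<open>u\<close>.\<close>

definition complex_gradient :: "real \<Rightarrow> plane \<Rightarrow> complex" where
  "complex_gradient lam p = Complex (p $ 1 / lam) (- p $ 2)"

definition gradient_of_complex :: "real \<Rightarrow> complex \<Rightarrow> plane" where
  "gradient_of_complex lam c = vector [lam * Re c, - Im c]"

lemma bounded_linear_stretch: "bounded_linear (stretch lam)"
  unfolding linear_conv_bounded_linear[symmetric]
  by (rule linearI) (simp_all add: stretch_def complex_eq_iff algebra_simps)

lemma bounded_linear_unstretch: "bounded_linear (unstretch lam)"
  unfolding linear_conv_bounded_linear[symmetric]
  by (rule linearI) (simp_all add: unstretch_def vec_eq_iff forall_2 add_divide_distrib)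

lemma bounded_linear_complex_gradient: "bounded_linear (complex_gradient lam)"
  unfolding linear_conv_bounded_linear[symmetric]
  by (rule linearI) (simp_all add: complex_gradient_def complex_eq_iff add_divide_distrib)

lemma bounded_linear_gradient_of_complex: "bounded_linear (gradient_of_complex lam)"
  unfolding linear_conv_bounded_linear[symmetric]
  by (rule linearI) (simp_all add: gradient_of_complex_def vec_eq_iff forall_2 algebra_simps)

lemma unstretch_stretch: "lam \<noteq> 0 \<Longrightarrow> unstretch lam (stretch lam x) = x"
  by (simp add: stretch_def unstretch_def vec_eq_iff forall_2)

lemma stretch_unstretch: "lam \<noteq> 0 \<Longrightarrow> stretch lam (unstretch lam z) = z"
  by (simp add: stretch_def unstretch_def complex_eq_iff)

lemma gradient_of_complex_gradient: "lam \<noteq> 0 \<Longrightarrow> gradient_of_complex lam (complex_gradient lam p) = p"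
  by (simp add: gradient_of_complex_def complex_gradient_def vec_eq_iff forall_2)

lemma stretch_inj: "lam \<noteq> 0 \<Longrightarrow> stretch lam x = stretch lam y \<longleftrightarrow> x = y"
  by (metis unstretch_stretch)

lemma stretch_diff: "stretch lam (x - y) = stretch lam x - stretch lam y"
  by (simp add: stretch_def complex_eq_iff algebra_simps)

lemma L_mat_mult: "(L_mat \<mu> lam *v p) $ 1 = \<mu> * p $ 1" "(L_mat \<mu> lam *v p) $ 2 = \<mu> * lam\<^sup>2 * p $ 2"
  by (simp_all add: L_mat_def matrix_vector_mult_def sum_2)

text \<open>The flux through a curve is the increment of the harmonic conjugate, whose differential is the
imaginary part of the complex gradient times \<open>dz\<close>.\<close>

lemma cross2_L_mat:
  assumes "lam \<noteq> 0"
  shows "cross2 (L_mat \<mu> lam *v p) v = \<mu> * lam * Im (complex_gradient lam p * stretch lam v)"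
  using assms by (simp add: cross2_def L_mat_mult complex_gradient_def stretch_def power2_eq_square field_simps)

text \<open>The kernel is \<open>\<beta> / (2 * pi)\<close> times the gradient of the angle of \<open>stretch lam x - stretch lam y\<close>, that
is, of the real part of \<open>- \<i> * Ln (stretch lam x - stretch lam y)\<close>.\<close>

lemma complex_gradient_burgers_kernel:
  assumes "lam \<noteq> 0" "x \<noteq> y"
  shows "complex_gradient lam (burgers_kernel lam \<beta> x y) = - \<i> * of_real (\<beta> / (2 * pi)) * inverse (stretch lam x - stretch lam y)"
proof -
  define d where "d = x - y"
  define n where "n = (lam * d $ 1)\<^sup>2 + (d $ 2)\<^sup>2"
  have "d \<noteq> 0" using assms by (simp add: d_def)
  then have n0: "n \<noteq> 0" using assms(1) by (auto simp: n_def vec_eq_iff forall_2 sum_power2_eq_zero_iff)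
  have nn: "(norm (Lambda_mat lam *v d))\<^sup>2 = n"
    by (simp add: n_def Lambda_mat_def norm_vec_def L2_set_def sum_2 matrix_vector_mult_def)
  have Jd: "transpose J_mat *v d = vector [- d $ 2, d $ 1]"
    by (simp add: J_mat_def transpose_def matrix_vector_mult_def sum_2 vec_eq_iff forall_2)
  have k: "burgers_kernel lam \<beta> x y = vector [(\<beta> / (2 * pi)) * (lam / n) * (- d $ 2), (\<beta> / (2 * pi)) * (lam / n) * d $ 1]"
    unfolding burgers_kernel_def d_def[symmetric] nn Jd by (simp add: vec_eq_iff forall_2)
  have s: "stretch lam x - stretch lam y = Complex (lam * d $ 1) (d $ 2)"
    by (simp add: d_def stretch_def complex_eq_iff algebra_simps)
  have Q: "complex_gradient lam (burgers_kernel lam \<beta> x y) = Complex ((\<beta> / (2 * pi)) * (- d $ 2) / n) (- ((\<beta> / (2 * pi)) * (lam * d $ 1) / n))"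
    using assms(1) by (simp add: k complex_gradient_def complex_eq_iff)
  have i: "inverse (Complex (lam * d $ 1) (d $ 2)) = Complex (lam * d $ 1 / n) (- d $ 2 / n)"
    by (simp add: complex_eq_iff n_def)
  show ?thesis unfolding s i Q by (simp add: complex_eq_iff)
qed

text \<open>One Cauchy--Riemann equation is the symmetry of the second derivative, the other one is the
differential equation.\<close>

lemma holomorphic_complex_gradient:
  assumes lam: "lam \<noteq> 0" and \<mu>: "\<mu> \<noteq> 0" and \<Omega>: "open \<Omega>"
    and u: "\<And>x. x \<in> \<Omega> \<Longrightarrow> GDERIV u x :> Du x"
    and D2u: "\<And>x. x \<in> \<Omega> \<Longrightarrow> (Du has_derivative (\<lambda>v. D2u x *v v)) (at x)"
    and div: "\<And>x. x \<in> \<Omega> \<Longrightarrow> divergence (\<lambda>y. L_mat \<mu> lam *v Du y) x = 0"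
  shows "(\<lambda>z. complex_gradient lam (Du (unstretch lam z))) holomorphic_on (stretch lam ` \<Omega>)"
proof -
  have "\<exists>c. ((\<lambda>z. complex_gradient lam (Du (unstretch lam z))) has_field_derivative c) (at z)" if z: "z \<in> stretch lam ` \<Omega>" for z
  proof -
    obtain x where x: "x \<in> \<Omega>" "z = stretch lam x" using z by auto
    have xz: "unstretch lam z = x" using x lam by (simp add: unstretch_stretch)
    define p q q' s where "p = D2u x $ 1 $ 1" and "q = D2u x $ 1 $ 2" and "q' = D2u x $ 2 $ 1" and "s = D2u x $ 2 $ 2"
    have "(D2u x *v (axis 1 1)) \<bullet> axis 2 1 = (D2u x *v (axis 2 1)) \<bullet> axis 1 1"
      by (rule second_derivative_symmetric[OF \<Omega> x(1) u D2u[OF x(1)]])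
    then have sym: "q' = q" by (simp add: p_def q_def q'_def s_def inner_vec_def sum_2 matrix_vector_mult_def axis_def)
    have "((\<lambda>y. L_mat \<mu> lam *v Du y) has_derivative (\<lambda>v. L_mat \<mu> lam *v (D2u x *v v))) (at x)"
      by (rule bounded_linear.has_derivative[OF matrix_vector_mul_bounded_linear D2u[OF x(1)]])
    then have "frechet_derivative (\<lambda>y. L_mat \<mu> lam *v Du y) (at x) = (\<lambda>v. L_mat \<mu> lam *v (D2u x *v v))"
      using frechet_derivative_at by metis
    then have "jacobian (\<lambda>y. L_mat \<mu> lam *v Du y) (at x) = L_mat \<mu> lam ** D2u x"
      by (simp add: jacobian_def matrix_vector_mul_assoc)
    then have "\<mu> * p + \<mu> * lam\<^sup>2 * s = 0"
      using div[OF x(1)] by (simp add: divergence_def trace_def sum_2 matrix_matrix_mult_def L_mat_def p_def s_def)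
    then have "\<mu> * (p + lam\<^sup>2 * s) = 0" by (simp add: algebra_simps)
    then have p: "p = - lam\<^sup>2 * s" using \<mu> by simp
    have "((\<lambda>z. complex_gradient lam (Du (unstretch lam z))) has_derivative (\<lambda>v. complex_gradient lam (D2u x *v (unstretch lam v)))) (at z)"
      by (intro bounded_linear.has_derivative[OF bounded_linear_complex_gradient]
          has_derivative_compose[OF bounded_linear_imp_has_derivative[OF bounded_linear_unstretch]]) (use D2u[OF x(1)] in \<open>simp add: xz\<close>)
    moreover have "complex_gradient lam (D2u x *v (unstretch lam v)) = Complex (- s) (- q / lam) * v" for v
      using lam by (simp add: complex_gradient_def unstretch_def matrix_vector_mult_def sum_2 complex_eq_iff
         p_def[symmetric] q_def[symmetric] q'_def[symmetric] s_def[symmetric] sym p power2_eq_square field_simps)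
    ultimately show ?thesis unfolding has_field_derivative_def by (intro exI[of _ "Complex (- s) (- q / lam)"]) simp
  qed
  then show ?thesis
    unfolding holomorphic_on_def field_differentiable_def by (blast intro: has_field_derivative_at_within)
qed

lemma open_stretch_image: "lam \<noteq> 0 \<Longrightarrow> open \<Omega> \<Longrightarrow> open (stretch lam ` \<Omega>)"
proof -
  assume lam: "lam \<noteq> 0" and \<Omega>: "open \<Omega>"
  have "stretch lam ` \<Omega> = unstretch lam -` \<Omega>"
    using lam by (auto simp: unstretch_stretch image_iff) (metis stretch_unstretch)
  moreover have "open (unstretch lam -` \<Omega>)"
    by (intro open_vimage \<Omega> linear_continuous_on bounded_linear_unstretch)
  ultimately show ?thesis by simp
qed

lemma closure_stretch_image: "lam \<noteq> 0 \<Longrightarrow> closure (stretch lam ` \<Omega>) = stretch lam ` closure \<Omega>"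
  by (rule closure_injective_linear_image[symmetric])
     (auto simp: bounded_linear.linear[OF bounded_linear_stretch] inj_def stretch_inj)

lemma frontier_stretch_image:
  assumes "lam \<noteq> 0" "open \<Omega>"
  shows "frontier (stretch lam ` \<Omega>) = stretch lam ` frontier \<Omega>"
proof -
  have "inj (stretch lam)" using assms(1) by (auto simp: inj_def stretch_inj)
  then show ?thesis
    using assms open_stretch_image[OF assms]
    by (simp add: frontier_def interior_open closure_stretch_image image_set_diff)
qed

lemma homeomorphic_stretch_image: "lam \<noteq> 0 \<Longrightarrow> \<Omega> homeomorphic (stretch lam ` \<Omega>)"
  unfolding homeomorphic_def
  by (intro exI[of _ "stretch lam"] exI[of _ "unstretch lam"] homeomorphismI)
     (auto intro!: linear_continuous_on bounded_linear_stretch bounded_linear_unstretch simp: unstretch_stretch)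

text \<open>The theorem on frontiers of simply connected sets is about the complex plane, hence the detour
through \<open>stretch 1\<close>.\<close>

lemma connected_frontier_simply_connected:
  fixes \<Omega> :: "plane set"
  assumes "open \<Omega>" "bounded \<Omega>" "simply_connected \<Omega>"
  shows "connected (frontier \<Omega>)"
proof -
  have op: "open (stretch 1 ` \<Omega>)" using assms(1) by (intro open_stretch_image) auto
  have "simply_connected (stretch 1 ` \<Omega>)"
    using assms(3) homeomorphic_simply_connected_eq[OF homeomorphic_stretch_image[of 1 \<Omega>]] by simp
  moreover have "bounded (stretch 1 ` \<Omega>)" by (intro bounded_linear_image assms(2) bounded_linear_stretch)
  ultimately have "connected (frontier (stretch 1 ` \<Omega>))"
    using simply_connected_eq_frontier_properties[OF op] by simp
  from connected_continuous_image[OF linear_continuous_on[OF bounded_linear_unstretch] this]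
  have "connected (unstretch 1 ` stretch 1 ` frontier \<Omega>)"
    using assms(1) by (simp add: frontier_stretch_image)
  then show ?thesis by (simp add: image_image unstretch_stretch)
qed

text \<open>Here \<open>kk\<close> is a combination of kernels with harmonic conjugate \<open>- \<beta>\<close>. The primitive \<open>V\<close> of the
complex gradient of \<open>P\<close> has a bounded derivative and extends continuously to the closure. By
the Neumann condition \<open>Im V - \<beta>\<close> is locally constant on the frontier, hence equal to a constant \<open>\<kappa>\<close>
there because the frontier is connected. So \<open>\<bar>Im V - \<kappa>\<bar> \<le> M\<close> on the frontier. The functions
\<open>exp (- \<i> * V / M)\<close> and \<open>exp (\<i> * V / M)\<close> are inverse to each other and have modulus
\<open>exp (Im V / M)\<close> and \<open>exp (- Im V / M)\<close>, which the maximum modulus principle bounds inside. Cauchy's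
inequality for the derivative of the first one gives the estimate; dividing \<open>V\<close> by \<open>M\<close> makes the
bound linear in \<open>M\<close>.\<close>

lemma neumann_interior_estimate:
  fixes P kk :: "plane \<Rightarrow> plane" and \<beta> :: "plane \<Rightarrow> real"
  assumes \<Omega>: "open \<Omega>" "bounded \<Omega>" "simply_connected \<Omega>"
    and nrm: "\<forall>x\<in>frontier \<Omega>. outer_unit_normal \<gamma> \<Omega> x (nrm x)"
    and lam: "lam \<noteq> 0" and \<mu>: "\<mu> > 0"
    and P: "continuous_on (closure \<Omega>) P"
    and hol: "(\<lambda>z. complex_gradient lam (P (unstretch lam z))) holomorphic_on (stretch lam ` \<Omega>)"
    and K: "finite K" "K \<subseteq> \<Omega>"
    and kk: "continuous_on (- K) kk"
    and \<beta>: "\<And>y. y \<notin> K \<Longrightarrow> (\<beta> has_derivative (\<lambda>v. - (cross2 (L_mat \<mu> lam *v kk y) v / (\<mu> * lam)))) (at y)"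
    and bdry: "\<And>x. x \<in> frontier \<Omega> \<Longrightarrow> (L_mat \<mu> lam *v (P x + kk x)) \<bullet> nrm x = 0"
    and M: "M > 0" "\<And>x. x \<in> frontier \<Omega> \<Longrightarrow> \<bar>\<beta> x\<bar> \<le> M"
    and r: "r > 0" "cball \<eta> r \<subseteq> stretch lam ` \<Omega>"
  shows "cmod (complex_gradient lam (P (unstretch lam \<eta>))) \<le> exp 2 / r * M"
proof -
  define D where "D = stretch lam ` \<Omega>"
  define W where "W z = complex_gradient lam (P (unstretch lam z))" for z
  have D: "open D" "bounded D" "simply_connected D"
    unfolding D_def using open_stretch_image[OF lam \<Omega>(1)] bounded_linear_image[OF \<Omega>(2) bounded_linear_stretch]
      \<Omega>(3) homeomorphic_simply_connected_eq[OF homeomorphic_stretch_image[OF lam]] by auto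
  have Dcl: "closure D = stretch lam ` closure \<Omega>" "frontier D = stretch lam ` frontier \<Omega>"
    unfolding D_def using closure_stretch_image[OF lam] frontier_stretch_image[OF lam \<Omega>(1)] by auto
  have frc: "frontier \<Omega> \<subseteq> closure \<Omega> - K" using K(2) \<Omega>(1) by (auto simp: frontier_def interior_open)
  have hol: "W holomorphic_on D" using hol unfolding W_def D_def .
  obtain V where V: "\<And>z. z \<in> D \<Longrightarrow> (V has_field_derivative W z) (at z)"
    using simply_connected_eq_global_primitive[OF D(1)] D(3) hol by blast
  obtain B where B: "B > 0" "\<And>z. z \<in> D \<Longrightarrow> cmod (W z) \<le> B"
  proof -
    have "compact (P ` closure \<Omega>)" using P \<Omega>(2) by (intro compact_continuous_image) (auto simp: compact_closure)
    then have "bounded (complex_gradient lam ` P ` closure \<Omega>)"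
      by (intro bounded_linear_image[OF _ bounded_linear_complex_gradient] compact_imp_bounded)
    then obtain B where "B > 0" "\<And>u. u \<in> complex_gradient lam ` P ` closure \<Omega> \<Longrightarrow> cmod u \<le> B"
      unfolding bounded_pos by blast
    then show thesis using closure_subset[of \<Omega>] unstretch_stretch[OF lam] by (intro that[of B]) (auto simp: D_def W_def)
  qed
  obtain c where c: "c > 0" "\<And>x. norm (stretch lam x) \<le> norm x * c"
    using bounded_linear.pos_bounded[OF bounded_linear_stretch, of lam] by blast
  have uc: "uniformly_continuous_on \<Omega> (\<lambda>x. V (stretch lam x))"
  proof (rule uniformly_continuous_of_segment_Lipschitz[OF \<Omega>(1,2) nrm])
    fix y z assume yz: "closed_segment y z \<subseteq> \<Omega>"
    have seg: "closed_segment (stretch lam y) (stretch lam z) \<subseteq> D"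
      using yz closed_segment_linear_image[OF bounded_linear.linear[OF bounded_linear_stretch], of lam y z] by (auto simp: D_def)
    have "cmod (V (stretch lam y) - V (stretch lam z)) \<le> B * cmod (stretch lam y - stretch lam z)"
      by (rule field_differentiable_bound[where S = "closed_segment (stretch lam y) (stretch lam z)" and f' = W])
        (use seg V B(2) in \<open>auto intro: has_field_derivative_at_within\<close>)
    also have "\<dots> \<le> B * (norm (y - z) * c)" using c(2)[of "y - z"] B(1) by (simp add: stretch_diff)
    finally show "cmod (V (stretch lam y) - V (stretch lam z)) \<le> (B * c) * norm (y - z)" by (simp add: mult_ac)
  qed (use B c in simp)
  obtain g where g: "uniformly_continuous_on (closure \<Omega>) g" "\<And>x. x \<in> \<Omega> \<Longrightarrow> V (stretch lam x) = g x"
  proof (rule uniformly_continuous_on_extension_on_closure[OF uc])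
    fix g assume "uniformly_continuous_on (closure \<Omega>) g" "\<And>x. x \<in> \<Omega> \<Longrightarrow> V (stretch lam x) = g x"
    then show thesis by (rule that)
  qed
  have gc: "continuous_on (closure \<Omega>) g" using g(1) by (rule uniformly_continuous_imp_continuous)
  have g': "(g has_derivative (\<lambda>v. W (stretch lam x) * stretch lam v)) (at x)" if x: "x \<in> \<Omega>" for x
  proof -
    have "stretch lam x \<in> D" using x by (simp add: D_def)
    from has_derivative_compose[OF bounded_linear_imp_has_derivative[OF bounded_linear_stretch] V[OF this, unfolded has_field_derivative_def]]
    have "((\<lambda>x. V (stretch lam x)) has_derivative (\<lambda>v. W (stretch lam x) * stretch lam v)) (at x)" .
    then show ?thesis by (rule has_derivative_transform_within_open[OF _ \<Omega>(1) x]) (use g(2) in auto)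
  qed
  define F where "F x = Im (g x) - \<beta> x" for x
  have \<beta>c: "continuous_on (- K) \<beta>"
    using \<beta> by (intro continuous_at_imp_continuous_on) (auto intro: has_derivative_continuous)
  have sub: "closure \<Omega> - K \<subseteq> closure \<Omega>" "closure \<Omega> - K \<subseteq> - K" by auto
  have ev: "eventually (\<lambda>y. F x = F y) (at x within frontier \<Omega>)" if x: "x \<in> frontier \<Omega>" for x
  proof (rule locally_constant_on_frontier[OF \<Omega>(1) nrm finite_imp_closed[OF K(1)] K(2) _ _ _ _ x])
    show "continuous_on (closure \<Omega> - K) F"
      unfolding F_def by (intro continuous_intros continuous_on_subset[OF gc sub(1)] continuous_on_subset[OF \<beta>c sub(2)])
    define PP where "PP x = (1 / (\<mu> * lam)) *\<^sub>R (L_mat \<mu> lam *v (P x + kk x))" for x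
    show "continuous_on (closure \<Omega> - K) PP"
      unfolding PP_def
      by (intro continuous_intros matrix_vector_mult_linear_continuous_on
          continuous_on_compose2[OF linear_continuous_on[OF matrix_vector_mul_bounded_linear]]
          continuous_on_add continuous_on_subset[OF P sub(1)] continuous_on_subset[OF kk sub(2)]) auto
    show "PP x \<bullet> nrm x = 0" if "x \<in> frontier \<Omega>" for x using bdry[OF that] by (simp add: PP_def)
    fix y assume y: "y \<in> \<Omega> - K"
    have "(F has_derivative (\<lambda>v. Im (W (stretch lam y) * stretch lam v) - - (cross2 (L_mat \<mu> lam *v kk y) v / (\<mu> * lam)))) (at y)"
      unfolding F_def using y by (intro has_derivative_diff bounded_linear.has_derivative[OF bounded_linear_Im] g' \<beta>) auto
    moreover have "Im (W (stretch lam y) * stretch lam v) - - (cross2 (L_mat \<mu> lam *v kk y) v / (\<mu> * lam)) = cross2 (PP y) v" for v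
    proof -
      have "cross2 (PP y) v = (cross2 (L_mat \<mu> lam *v P y) v + cross2 (L_mat \<mu> lam *v kk y) v) / (\<mu> * lam)"
        by (simp add: PP_def cross2_def matrix_vector_right_distrib algebra_simps add_divide_distrib diff_divide_distrib)
      also have "cross2 (L_mat \<mu> lam *v P y) v = \<mu> * lam * Im (W (stretch lam y) * stretch lam v)"
        unfolding cross2_L_mat[OF lam] W_def unstretch_stretch[OF lam] ..
      finally show ?thesis using lam \<mu> by (simp add: add_divide_distrib)
    qed
    ultimately show "(F has_derivative cross2 (PP y)) (at y)" by simp
  qed
  have "\<exists>\<kappa>. \<forall>x\<in>frontier \<Omega>. F x = \<kappa>"
  proof (cases "frontier \<Omega> = {}")
    case False
    then obtain x0 where "x0 \<in> frontier \<Omega>" by blast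
    then show ?thesis
      using connected_local_const[OF connected_frontier_simply_connected[OF \<Omega>], of _ x0 F] ev by blast
  qed auto
  then obtain \<kappa> where F\<kappa>: "\<forall>x\<in>frontier \<Omega>. F x = \<kappa>" by blast
  have \<kappa>: "Im (g x) = \<beta> x + \<kappa>" if "x \<in> frontier \<Omega>" for x using F\<kappa> that by (force simp: F_def)
  \<comment> \<open>the continuous extension of \<open>V\<close> to the closure of \<open>D\<close>\<close>
  define U where "U z = g (unstretch lam z)" for z
  have Uc: "continuous_on (closure D) U"
    unfolding U_def Dcl by (intro continuous_on_compose2[OF gc] linear_continuous_on bounded_linear_unstretch)
      (auto simp: unstretch_stretch[OF lam])
  have UD: "U z = V z" if "z \<in> D" for z
  proof -
    obtain x where "x \<in> \<Omega>" "z = stretch lam x" using \<open>z \<in> D\<close> by (auto simp: D_def)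
    then show ?thesis using g(2)[of x] by (simp add: U_def unstretch_stretch[OF lam])
  qed
  have U': "(U has_field_derivative W z) (at z)" if "z \<in> D" for z
    using V[OF that] by (rule has_field_derivative_transform_within_open[OF _ D(1) that]) (simp add: UD)
  have Ubd: "Im (U z) \<le> \<kappa> + M" "Im (U z) \<ge> \<kappa> - M" if "z \<in> frontier D" for z
  proof -
    obtain x where "x \<in> frontier \<Omega>" "z = stretch lam x" using \<open>z \<in> frontier D\<close> by (auto simp: Dcl)
    then show "Im (U z) \<le> \<kappa> + M" "Im (U z) \<ge> \<kappa> - M" using \<kappa>[of x] M(2)[of x] by (auto simp: U_def unstretch_stretch[OF lam])
  qed
  define \<Phi> where "\<Phi> s z = exp (of_real (s / M) * (- \<i> * U z))" for s :: real and z
  have n\<Phi>: "cmod (\<Phi> s z) = exp (s * Im (U z) / M)" for s z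
    by (simp add: \<Phi>_def norm_exp_eq_Re)
  have \<Phi>': "(\<Phi> s has_field_derivative (of_real (s / M) * (- \<i> * W z)) * \<Phi> s z) (at z)" if "z \<in> D" for s z
    unfolding \<Phi>_def using U'[OF that] M(1) by (auto intro!: derivative_eq_intros)
  have \<Phi>hol: "\<Phi> s holomorphic_on D" for s
    using \<Phi>' by (meson holomorphic_on_open D(1))
  have \<Phi>max: "cmod (\<Phi> s z) \<le> exp ((s * \<kappa> + M) / M)" if "z \<in> D" "s = 1 \<or> s = -1" for s z
  proof (rule maximum_modulus_frontier[OF _ _ D(2) _ that(1)])
    show "\<Phi> s holomorphic_on (interior D)" using \<Phi>hol D(1) by (simp add: interior_open)
    show "continuous_on (closure D) (\<Phi> s)" unfolding \<Phi>_def by (intro continuous_intros Uc)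
    fix x assume "x \<in> frontier D"
    then show "cmod (\<Phi> s x) \<le> exp ((s * \<kappa> + M) / M)"
      unfolding n\<Phi> using Ubd[of x] M(1) that(2) by (auto intro!: divide_right_mono)
  qed
  have \<eta>D: "\<eta> \<in> D" using r by (auto simp: D_def)
  have ball: "ball \<eta> r \<subseteq> D" "cball \<eta> r \<subseteq> D" using r(2) ball_subset_cball[of \<eta> r] by (auto simp: D_def)
  have "cmod ((deriv ^^ 1) (\<Phi> 1) \<eta>) \<le> fact 1 * exp ((1 * \<kappa> + M) / M) / r ^ 1"
  proof (rule Cauchy_inequality)
    show "\<Phi> 1 holomorphic_on ball \<eta> r" using \<Phi>hol ball(1) by (rule holomorphic_on_subset)
    show "continuous_on (cball \<eta> r) (\<Phi> 1)" using \<Phi>hol ball(2) by (meson holomorphic_on_imp_continuous_on holomorphic_on_subset)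
    fix x assume "cmod (\<eta> - x) = r"
    then have "x \<in> D" using ball(2) by (auto simp: dist_norm)
    then show "cmod (\<Phi> 1 x) \<le> exp ((1 * \<kappa> + M) / M)" by (rule \<Phi>max) simp
  qed (use r in auto)
  moreover have "deriv (\<Phi> 1) \<eta> = (of_real (1 / M) * (- \<i> * W \<eta>)) * \<Phi> 1 \<eta>"
    by (rule DERIV_imp_deriv[OF \<Phi>'[OF \<eta>D]])
  ultimately have c1: "cmod (W \<eta>) / M * cmod (\<Phi> 1 \<eta>) \<le> exp ((\<kappa> + M) / M) / r"
    using M(1) by (simp add: norm_mult norm_divide)
  have inv: "cmod (\<Phi> 1 \<eta>) * cmod (\<Phi> (-1) \<eta>) = 1" unfolding n\<Phi> by (simp add: exp_add[symmetric] add_divide_distrib[symmetric])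
  have c2: "cmod (\<Phi> (-1) \<eta>) \<le> exp ((- \<kappa> + M) / M)" using \<Phi>max[OF \<eta>D, of "-1"] by simp
  have "cmod (W \<eta>) / M = (cmod (W \<eta>) / M * cmod (\<Phi> 1 \<eta>)) * cmod (\<Phi> (-1) \<eta>)" using inv by (simp add: mult.assoc)
  also have "\<dots> \<le> (exp ((\<kappa> + M) / M) / r) * exp ((- \<kappa> + M) / M)"
    using c1 c2 r(1) M(1) by (intro mult_mono) auto
  also have "\<dots> = exp ((\<kappa> + M) / M + (- \<kappa> + M) / M) / r" by (simp add: exp_add)
  also have "(\<kappa> + M) / M + (- \<kappa> + M) / M = 2" using M(1) by (simp add: field_simps)
  finally show ?thesis using M(1) by (simp add: W_def field_simps)
qed

section \<open>Dependence of the force on the configuration\<close>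

lemma open_configurations:
  assumes "open \<Omega>"
  shows "open (configurations \<Omega> :: (plane^'n::finite) set)"
proof -
  have "configurations \<Omega> = (\<Inter>i. (\<lambda>Z::plane^'n. Z $ i) -` \<Omega>) \<inter> (\<Inter>i. \<Inter>j\<in>{j. i \<noteq> j}. {Z. Z $ i \<noteq> Z $ j})"
    by (auto simp: configurations_def)
  moreover have "open ((\<lambda>Z::plane^'n. Z $ i) -` \<Omega>)" for i
    by (intro open_vimage assms continuous_intros)
  moreover have "open {Z::plane^'n. Z $ i \<noteq> Z $ j}" for i j
    by (intro open_Collect_neq continuous_intros)
  ultimately show ?thesis by (auto intro!: open_Int open_INT)
qed

lemma uniformly_C11_cong:
  assumes f: "uniformly_C11 Q S f" and S: "open S" and eq: "\<And>q x. q \<in> Q \<Longrightarrow> x \<in> S \<Longrightarrow> f q x = g q x"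
  shows "uniformly_C11 Q S g"
proof -
  obtain f' B where fB: "\<forall>q\<in>Q. \<forall>x\<in>S. (f q has_derivative f' q x) (at x) \<and>
      norm (f q x) \<le> B \<and> (\<forall>v. norm (f' q x v) \<le> B * norm v) \<and>
      (\<forall>y\<in>S. \<forall>v. norm (f' q x v - f' q y v) \<le> B * norm (x - y) * norm v)"
    using f unfolding uniformly_C11_def by blast
  show ?thesis
  proof (rule uniformly_C11I[where g' = f' and ?B1.0 = B and ?B2.0 = B and ?B3.0 = B])
    fix q x assume q: "q \<in> Q" and x: "x \<in> S"
    then have "(f q has_derivative f' q x) (at x)" using fB by blast
    then show "(g q has_derivative f' q x) (at x)"
      by (rule has_derivative_transform_within_open[OF _ S x]) (use eq q in auto)
    show "norm (g q x) \<le> B" using fB eq q x by metis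
  qed (use fB in blast)+
qed

lemma burgers_kernel_eq:
  assumes "lam \<noteq> 0" "x \<noteq> y"
  shows "burgers_kernel lam \<beta> x y =
    gradient_of_complex lam (- \<i> * of_real (\<beta> / (2 * pi)) * inverse (stretch lam x - stretch lam y))"
  using complex_gradient_burgers_kernel[OF assms, of \<beta>] gradient_of_complex_gradient[OF assms(1)] by metis

lemma continuous_on_burgers_kernel:
  assumes "lam \<noteq> 0" "y \<notin> A"
  shows "continuous_on A (\<lambda>x. burgers_kernel lam \<beta> x y)"
proof -
  have nz: "stretch lam x - stretch lam y \<noteq> 0" if "x \<in> A" for x
    using that assms by (auto simp: stretch_inj)
  have "continuous_on A (\<lambda>x. gradient_of_complex lam (- \<i> * of_real (\<beta> / (2 * pi)) * inverse (stretch lam x - stretch lam y)))"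
    by (rule continuous_on_compose2[OF linear_continuous_on[OF bounded_linear_gradient_of_complex]])
      (intro continuous_intros linear_continuous_on bounded_linear_stretch | use nz in auto)+
  then show ?thesis
    by (rule continuous_on_eq) (metis burgers_kernel_eq assms)
qed

text \<open>The boundary values, up to an additive constant, of the harmonic conjugate of the solution for the
configuration \<open>Y\<close>.\<close>

definition burgers_log :: "real \<Rightarrow> ('n::finite \<Rightarrow> real) \<Rightarrow> plane^'n \<Rightarrow> plane \<Rightarrow> real" where
  "burgers_log lam b Y x = (\<Sum>i\<in>UNIV. b i / (2 * pi) * ln (cmod (stretch lam x - stretch lam (Y $ i))))"

text \<open>The harmonic conjugate of the angle is minus the logarithm of the modulus, hence the sign.\<close>

lemma has_derivative_burgers_log:
  assumes lam: "lam \<noteq> 0" and \<mu>: "\<mu> \<noteq> 0" and y: "y \<notin> range (($) Y)"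
  shows "(burgers_log lam b Y has_derivative
     (\<lambda>v. - (cross2 (L_mat \<mu> lam *v (\<Sum>i\<in>UNIV. burgers_kernel lam (b i) y (Y $ i))) v / (\<mu> * lam)))) (at y)"
proof -
  have nz: "stretch lam y - stretch lam (Y $ i) \<noteq> 0" "y \<noteq> Y $ i" for i
    using y lam by (auto simp: stretch_inj)
  have "(burgers_log lam b Y has_derivative (\<lambda>v. \<Sum>i\<in>UNIV. b i / (2 * pi) * Re (stretch lam v * inverse (stretch lam y - stretch lam (Y $ i))))) (at y)"
    unfolding burgers_log_def
  proof (intro has_derivative_sum has_derivative_mult_right has_derivative_ln_cmod nz)
    fix i
    show "((\<lambda>x. stretch lam x - stretch lam (Y $ i)) has_derivative stretch lam) (at y)"
      using has_derivative_diff[OF bounded_linear_imp_has_derivative[OF bounded_linear_stretch] has_derivative_const] by simp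
  qed
  moreover have "(\<Sum>i\<in>UNIV. b i / (2 * pi) * Re (stretch lam v * inverse (stretch lam y - stretch lam (Y $ i))))
      = - (cross2 (L_mat \<mu> lam *v (\<Sum>i\<in>UNIV. burgers_kernel lam (b i) y (Y $ i))) v / (\<mu> * lam))" for v
  proof -
    have "cross2 (L_mat \<mu> lam *v (\<Sum>i\<in>UNIV. burgers_kernel lam (b i) y (Y $ i))) v / (\<mu> * lam)
      = Im (complex_gradient lam (\<Sum>i\<in>UNIV. burgers_kernel lam (b i) y (Y $ i)) * stretch lam v)"
      using lam \<mu> by (simp add: cross2_L_mat[OF lam])
    also have "complex_gradient lam (\<Sum>i\<in>UNIV. burgers_kernel lam (b i) y (Y $ i))
       = (\<Sum>i\<in>UNIV. - \<i> * of_real (b i / (2 * pi)) * inverse (stretch lam y - stretch lam (Y $ i)))"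
      by (subst linear_sum[OF bounded_linear.linear[OF bounded_linear_complex_gradient]])
        (simp only: o_def complex_gradient_burgers_kernel[OF lam nz(2)])
    also have "Im (\<dots> * stretch lam v) = (\<Sum>i\<in>UNIV. - (b i / (2 * pi) * Re (stretch lam v * inverse (stretch lam y - stretch lam (Y $ i)))))"
      unfolding sum_distrib_right Im_sum
    proof (rule sum.cong[OF refl])
      fix i
      have "Im (- \<i> * of_real s * z * w) = - (s * Re (w * z))" for s z w by (simp add: algebra_simps)
      then show "Im (- \<i> * of_real (b i / (2 * pi)) * inverse (stretch lam y - stretch lam (Y $ i)) * stretch lam v)
         = - (b i / (2 * pi) * Re (stretch lam v * inverse (stretch lam y - stretch lam (Y $ i))))" by blast
    qed
    finally show ?thesis by (simp add: sum_negf)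
  qed
  ultimately show ?thesis by simp
qed

text \<open>Only the gradient of \<open>u0 Z\<close> at the moving point \<open>Z $ l\<close> is not explicit. Cauchy's formula on a fixed
circle around \<open>Z1 $ l\<close> expresses it through values \<open>w Z \<eta>\<close> at fixed points \<open>\<eta>\<close>, with the weight
\<open>1 / (\<eta> - stretch lam (Z $ l))\<close>. A real linear combination of functions \<open>w Z\<close> is controlled at \<open>\<eta>\<close>
by the same combination of boundary values \<open>burgers_log lam b Z\<close>; treating real and imaginary parts
of the weights separately, one obtains the hypothesis of \<open>four_point_transfer\<close> for the explicit
family \<open>g (\<eta>, p) Z\<close>, the product of the boundary value at \<open>p\<close> and the weight at \<open>\<eta>\<close>.\<close>

lemma peach_koehler_locally_C11:
  fixes Z1 :: "plane^'n::finite"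
  assumes \<Omega>: "open \<Omega>" "bounded \<Omega>" "simply_connected \<Omega>"
    and nrm: "\<forall>x\<in>frontier \<Omega>. outer_unit_normal \<gamma> \<Omega> x (nrm x)"
    and lam: "lam \<noteq> 0" and \<mu>: "\<mu> > 0"
    and neu: "\<forall>Y\<in>configurations \<Omega>. neumann_solution \<Omega> nrm \<mu> lam b Y (u0 Y)"
    and Z1: "Z1 \<in> configurations \<Omega>"
  shows "\<exists>\<delta>>0. ball Z1 \<delta> \<subseteq> configurations \<Omega> \<and> uniformly_C11 {()} (ball Z1 \<delta>) (\<lambda>_. peach_koehler \<mu> lam b u0 l)"
proof -
  define D where "D = stretch lam ` \<Omega>"
  have Do: "open D" unfolding D_def by (rule open_stretch_image[OF lam \<Omega>(1)])
  define Pr where "Pr Y D' \<longleftrightarrow> continuous_on (closure \<Omega>) D' \<and> (\<forall>x\<in>\<Omega>. GDERIV (u0 Y) x :> D' x) \<and>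
     (\<lambda>z. complex_gradient lam (D' (unstretch lam z))) holomorphic_on D \<and>
     (\<forall>x\<in>frontier \<Omega>. (L_mat \<mu> lam *v (D' x + (\<Sum>i\<in>UNIV. burgers_kernel lam (b i) x (Y $ i)))) \<bullet> nrm x = 0)" for Y D'
  have "\<exists>D'. Pr Y D'" if Y: "Y \<in> configurations \<Omega>" for Y
  proof -
    obtain Du D2u where Du: "continuous_on (closure \<Omega>) Du" "\<And>x. x\<in>\<Omega> \<Longrightarrow> GDERIV (u0 Y) x :> Du x"
      "\<And>x. x\<in>\<Omega> \<Longrightarrow> (Du has_derivative (\<lambda>v. D2u x *v v)) (at x)"
      "\<And>x. x\<in>\<Omega> \<Longrightarrow> divergence (\<lambda>y. L_mat \<mu> lam *v Du y) x = 0"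
      "\<forall>x\<in>frontier \<Omega>. (L_mat \<mu> lam *v (Du x + (\<Sum>i\<in>UNIV. burgers_kernel lam (b i) x (Y $ i)))) \<bullet> nrm x = 0"
      using neu Y unfolding neumann_solution_def by blast
    have "(\<lambda>z. complex_gradient lam (Du (unstretch lam z))) holomorphic_on D"
      unfolding D_def using \<mu> by (intro holomorphic_complex_gradient[OF lam _ \<Omega>(1) Du(2,3,4)]) auto
    with Du show ?thesis unfolding Pr_def by blast
  qed
  then obtain Du where Du: "\<And>Y. Y \<in> configurations \<Omega> \<Longrightarrow> Pr Y (Du Y)" by metis
  define w where "w Y z = complex_gradient lam (Du Y (unstretch lam z))" for Y z
  have whol: "w Y holomorphic_on D" if "Y \<in> configurations \<Omega>" for Y
    using Du[OF that] unfolding Pr_def w_def by blast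
  have Zin: "Z1 $ i \<in> \<Omega>" for i using Z1 by (simp add: configurations_def)
  have "\<exists>d>0. cball (stretch lam (Z1 $ i)) d \<subseteq> D" for i
  proof -
    have "stretch lam (Z1 $ i) \<in> D" using Zin[of i] by (simp add: D_def)
    then show ?thesis using Do open_contains_cball[of D] by blast
  qed
  then obtain dd where dd: "\<And>i. dd i > 0" "\<And>i. cball (stretch lam (Z1 $ i)) (dd i) \<subseteq> D" by metis
  \<comment> \<open>While every dislocation moves by at most \<open>\<rho>\<close>, the circle of radius \<open>2 * \<rho>\<close> stays at distance \<open>\<rho>\<close>
from the dislocation \<open>l\<close> and from the frontier, and the frontier at distance \<open>2 * \<rho>\<close> from all
dislocations.\<close>
  define \<rho> where "\<rho> = Min (range dd) / 3"
  have \<rho>: "\<rho> > 0" using dd(1) by (simp add: \<rho>_def)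
  have \<rho>D: "cball (stretch lam (Z1 $ i)) (3 * \<rho>) \<subseteq> D" for i
  proof -
    have "3 * \<rho> \<le> dd i" by (simp add: \<rho>_def)
    then have "cball (stretch lam (Z1 $ i)) (3 * \<rho>) \<subseteq> cball (stretch lam (Z1 $ i)) (dd i)" by (rule subset_cball)
    then show ?thesis using dd(2) by blast
  qed
  \<comment> \<open>the distance of the other dislocations from the dislocation \<open>l\<close>, with a dummy value at \<open>l\<close> itself\<close>
  define sep where "sep i = (if i = l then 1 else cmod (stretch lam (Z1 $ l) - stretch lam (Z1 $ i)))" for i
  define dm where "dm = Min (range sep)"
  have seppos: "sep i > 0" for i
    using Z1 lam by (auto simp: sep_def configurations_def stretch_inj)
  have dm: "dm > 0" unfolding dm_def using seppos by simp
  have dms: "dm \<le> cmod (stretch lam (Z1 $ l) - stretch lam (Z1 $ i))" if "i \<noteq> l" for i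
  proof -
    have "dm \<le> sep i" by (simp add: dm_def)
    then show ?thesis using that by (simp add: sep_def)
  qed
  obtain c where c: "c > 0" "\<And>x. norm (stretch lam x) \<le> norm x * c"
    using bounded_linear.pos_bounded[OF bounded_linear_stretch, of lam] by blast
  obtain \<delta>0 where \<delta>0: "\<delta>0 > 0" "ball Z1 \<delta>0 \<subseteq> configurations \<Omega>"
    using open_configurations[OF \<Omega>(1)] Z1 open_contains_ball by blast
  define \<delta> where "\<delta> = min \<delta>0 (min \<rho> (dm / 4) / c)"
  have \<delta>: "\<delta> > 0" "\<delta> \<le> \<delta>0" "\<delta> * c \<le> \<rho>" "\<delta> * c \<le> dm / 4"
  proof -
    show "\<delta> > 0" using \<delta>0 \<rho> dm c by (simp add: \<delta>_def)
    have "\<delta> \<le> min \<rho> (dm / 4) / c" by (simp add: \<delta>_def)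
    then have "\<delta> * c \<le> min \<rho> (dm / 4)" using c(1) by (simp add: pos_le_divide_eq)
    then show "\<delta> * c \<le> \<rho>" "\<delta> * c \<le> dm / 4" by auto
  qed (simp add: \<delta>_def)
  define S where "S = ball Z1 \<delta>"
  have S: "convex S" "open S" "bounded S" "S \<subseteq> configurations \<Omega>"
    using \<delta>(2) \<delta>0(2) subset_ball[OF \<delta>(2), of Z1] by (auto simp: S_def)
  have move: "cmod (stretch lam (Z $ i) - stretch lam (Z1 $ i)) < \<delta> * c" if "Z \<in> S" for Z i
  proof -
    have "cmod (stretch lam (Z $ i - Z1 $ i)) \<le> norm (Z $ i - Z1 $ i) * c" by (rule c(2))
    also have "norm (Z $ i - Z1 $ i) \<le> norm (Z - Z1)" using Finite_Cartesian_Product.norm_nth_le[of "Z - Z1" i] by simp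
    also have "norm (Z - Z1) < \<delta>" using that by (simp add: S_def dist_norm norm_minus_commute)
    finally show ?thesis using c(1) by (simp add: stretch_diff)
  qed
  define \<zeta>0 where "\<zeta>0 = stretch lam (Z1 $ l)"
  define Q where "Q = sphere \<zeta>0 (2 * \<rho>) \<times> frontier \<Omega>"
  define g where "g q Z = complex_of_real (burgers_log lam b Z (snd q)) * inverse (fst q - stretch lam (Z $ l))" for q Z
  define h where "h Z = w Z (stretch lam (Z $ l))" for Z
  have nthlin: "bounded_linear (\<lambda>Z::plane^'n. - stretch lam (Z $ i))" for i
    by (intro bounded_linear_minus bounded_linear_compose[OF bounded_linear_stretch] bounded_linear_vec_nth)
  have fst_ge: "\<rho> \<le> cmod (\<eta> + - stretch lam (Z $ l))" if "\<eta> \<in> sphere \<zeta>0 (2 * \<rho>)" "Z \<in> S" for \<eta> Z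
  proof -
    have "2 * \<rho> = cmod ((\<eta> - stretch lam (Z $ l)) + (stretch lam (Z $ l) - \<zeta>0))" using that(1) by (simp add: dist_norm norm_minus_commute)
    also have "\<dots> \<le> cmod (\<eta> - stretch lam (Z $ l)) + cmod (stretch lam (Z $ l) - \<zeta>0)" by (rule norm_triangle_ineq)
    also have "\<dots> \<le> cmod (\<eta> - stretch lam (Z $ l)) + \<rho>" using move[OF that(2), of l] \<delta>(3) by (simp add: \<zeta>0_def)
    finally show ?thesis by simp
  qed
  have snd_ge: "2 * \<rho> \<le> cmod (stretch lam p + - stretch lam (Z $ i))" if "p \<in> frontier \<Omega>" "Z \<in> S" for p Z i
  proof -
    have "p \<notin> \<Omega>" using that(1) \<Omega>(1) by (simp add: frontier_def interior_open)
    then have "stretch lam p \<notin> D" using lam by (auto simp: D_def stretch_inj)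
    then have "stretch lam p \<notin> cball (stretch lam (Z1 $ i)) (3 * \<rho>)" using \<rho>D by blast
    then have "3 * \<rho> < cmod ((stretch lam p - stretch lam (Z $ i)) + (stretch lam (Z $ i) - stretch lam (Z1 $ i)))" by (simp add: dist_norm norm_minus_commute)
    also have "\<dots> \<le> cmod (stretch lam p - stretch lam (Z $ i)) + cmod (stretch lam (Z $ i) - stretch lam (Z1 $ i))" by (rule norm_triangle_ineq)
    also have "\<dots> \<le> cmod (stretch lam p - stretch lam (Z $ i)) + \<rho>" using move[OF that(2), of i] \<delta>(3) by simp
    finally show ?thesis by simp
  qed
  have ug: "uniformly_C11 Q S g"
  proof -
    have "bounded (frontier \<Omega>)" 
      by (rule bounded_subset[OF bounded_closure[OF \<Omega>(2)]]) (simp add: frontier_def)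
    then have "bounded (stretch lam ` frontier \<Omega>)" by (intro bounded_linear_image bounded_linear_stretch)
    then obtain R1 where R1: "\<And>p. p \<in> frontier \<Omega> \<Longrightarrow> cmod (stretch lam p) \<le> R1" by (auto simp: bounded_iff)
    have "bounded (sphere \<zeta>0 (2 * \<rho>))" by simp
    then obtain R2 where R2: "\<And>\<eta>. \<eta> \<in> sphere \<zeta>0 (2 * \<rho>) \<Longrightarrow> cmod \<eta> \<le> R2" unfolding bounded_iff by blast
    have u1: "uniformly_C11 Q S (\<lambda>q Z. stretch lam (snd q) + - stretch lam (Z $ i))" for i
      by (intro uniformly_C11_add uniformly_C11_const[where B = R1] uniformly_C11_linear nthlin S) (auto simp: Q_def R1)
    have u2: "uniformly_C11 Q S (\<lambda>q Z. fst q + - stretch lam (Z $ l))"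
      by (intro uniformly_C11_add uniformly_C11_const[where B = R2] uniformly_C11_linear nthlin S) (use R2 in \<open>auto simp: Q_def\<close>)
    have u3: "uniformly_C11 Q S (\<lambda>q Z. inverse (fst q + - stretch lam (Z $ l)))"
      by (rule uniformly_C11_inverse[OF u2 S(1) \<rho>]) (use fst_ge in \<open>auto simp: Q_def\<close>)
    have u4: "uniformly_C11 Q S (\<lambda>q Z. ln (cmod (stretch lam (snd q) + - stretch lam (Z $ i))))" for i
      by (rule uniformly_C11_ln_norm[OF u1 S(1), of "2 * \<rho>"]) (use snd_ge \<rho> in \<open>auto simp: Q_def\<close>)
    have u5: "uniformly_C11 Q S (\<lambda>q Z. \<Sum>i\<in>UNIV. b i / (2 * pi) * ln (cmod (stretch lam (snd q) + - stretch lam (Z $ i))))"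
      by (intro uniformly_C11_sum uniformly_C11_mult uniformly_C11_const[OF order_refl] u4 S) auto
    have u6: "uniformly_C11 Q S (\<lambda>q Z. complex_of_real (\<Sum>i\<in>UNIV. b i / (2 * pi) * ln (cmod (stretch lam (snd q) + - stretch lam (Z $ i)))))"
      by (rule uniformly_C11_compose_linear[OF u5 S(1) bounded_linear_of_real])
    show ?thesis
      using uniformly_C11_mult[OF u6 u3 S(1)] by (simp add: g_def[abs_def] burgers_log_def)
  qed
  have sum4: "(\<Sum>i<4. f i) = f 0 + f 1 + f 2 + f 3" for f :: "nat \<Rightarrow> 'z::comm_monoid_add"
    by (simp add: eval_nat_numeral)
  have comb_w: "cmod (\<Sum>i<4. a i *\<^sub>R w (X i) \<eta>) \<le> exp 2 / \<rho> * M"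
    if X: "\<And>i::nat. i < 4 \<Longrightarrow> X i \<in> S" and M: "M > 0" and \<eta>: "\<eta> \<in> sphere \<zeta>0 (2 * \<rho>)"
      and le: "\<And>p. p \<in> frontier \<Omega> \<Longrightarrow> \<bar>\<Sum>i<4. a i * burgers_log lam b (X i) p\<bar> \<le> M" for a X M \<eta>
  proof -
    have Xc: "X i \<in> configurations \<Omega>" if "i < 4" for i using X[OF that] S(4) by blast
    note pr = Du[OF Xc, unfolded Pr_def]
    define P where "P x = (\<Sum>i<4. a i *\<^sub>R Du (X i) x)" for x
    define kk where "kk x = (\<Sum>i<4. a i *\<^sub>R (\<Sum>j\<in>UNIV. burgers_kernel lam (b j) x (X i $ j)))" for x
    define \<beta> where "\<beta> p = (\<Sum>i<4. a i * burgers_log lam b (X i) p)" for p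
    define K where "K = (\<Union>i<4. range (($) (X i)))"
    have PW: "complex_gradient lam (P (unstretch lam z)) = (\<Sum>i<4. a i *\<^sub>R w (X i) z)" for z
      unfolding P_def w_def
      by (simp add: linear_sum[OF bounded_linear.linear[OF bounded_linear_complex_gradient]]
          linear_scale[OF bounded_linear.linear[OF bounded_linear_complex_gradient]])
    have "cmod (complex_gradient lam (P (unstretch lam \<eta>))) \<le> exp 2 / \<rho> * M"
    proof (rule neumann_interior_estimate[OF \<Omega> nrm lam \<mu>, where kk = kk and \<beta> = \<beta> and K = K])
      show "continuous_on (closure \<Omega>) P" unfolding P_def using pr by (intro continuous_intros) auto
      show "(\<lambda>z. complex_gradient lam (P (unstretch lam z))) holomorphic_on stretch lam ` \<Omega>"
        unfolding PW D_def[symmetric] scaleR_conv_of_real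
        by (intro holomorphic_intros) (use whol[OF Xc] in auto)
      show "finite K" by (simp add: K_def)
      show "K \<subseteq> \<Omega>" using Xc by (auto simp: K_def configurations_def)
      show "continuous_on (- K) kk"
        unfolding kk_def by (intro continuous_intros continuous_on_burgers_kernel lam) (auto simp: K_def)
      show "(\<beta> has_derivative (\<lambda>v. - (cross2 (L_mat \<mu> lam *v kk y) v / (\<mu> * lam)))) (at y)" if y: "y \<notin> K" for y
      proof -
        have "(\<beta> has_derivative (\<lambda>v. \<Sum>i<4. a i * - (cross2 (L_mat \<mu> lam *v (\<Sum>j\<in>UNIV. burgers_kernel lam (b j) y (X i $ j))) v / (\<mu> * lam)))) (at y)"
          unfolding \<beta>_def using y \<mu>
          by (intro has_derivative_sum has_derivative_mult_right has_derivative_burgers_log lam) (auto simp: K_def)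
        moreover have "(\<Sum>i<4. a i * - (cross2 (L_mat \<mu> lam *v (\<Sum>j\<in>UNIV. burgers_kernel lam (b j) y (X i $ j))) v / (\<mu> * lam)))
           = - (cross2 (L_mat \<mu> lam *v kk y) v / (\<mu> * lam))" for v
          unfolding kk_def cross2_def L_mat_mult sum4
          by (simp add: algebra_simps add_divide_distrib diff_divide_distrib)
        ultimately show ?thesis by simp
      qed
      show "(L_mat \<mu> lam *v (P x + kk x)) \<bullet> nrm x = 0" if x: "x \<in> frontier \<Omega>" for x
      proof -
        have "P x + kk x = (\<Sum>i<4. a i *\<^sub>R (Du (X i) x + (\<Sum>j\<in>UNIV. burgers_kernel lam (b j) x (X i $ j))))"
          by (simp add: P_def kk_def sum.distrib[symmetric] scaleR_add_right)
        then have "(L_mat \<mu> lam *v (P x + kk x)) \<bullet> nrm x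
           = (\<Sum>i<4. a i * ((L_mat \<mu> lam *v (Du (X i) x + (\<Sum>j\<in>UNIV. burgers_kernel lam (b j) x (X i $ j)))) \<bullet> nrm x))"
          by (simp add: linear_sum[OF matrix_vector_mul_linear] linear_scale[OF matrix_vector_mul_linear] inner_sum_left)
        also have "\<dots> = 0" using pr x by (intro sum.neutral) auto
        finally show ?thesis .
      qed
      show "\<bar>\<beta> x\<bar> \<le> M" if "x \<in> frontier \<Omega>" for x using le[OF that] by (simp add: \<beta>_def)
      show "cball \<eta> \<rho> \<subseteq> stretch lam ` \<Omega>"
      proof -
        have "cball \<eta> \<rho> \<subseteq> cball \<zeta>0 (3 * \<rho>)"
        proof
          fix z assume "z \<in> cball \<eta> \<rho>"
          then have "dist \<zeta>0 z \<le> 2 * \<rho> + \<rho>" using \<eta> dist_triangle[of \<zeta>0 z \<eta>] by simp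
          then show "z \<in> cball \<zeta>0 (3 * \<rho>)" by simp
        qed
        then show ?thesis using \<rho>D[of l] by (auto simp: \<zeta>0_def D_def)
      qed
    qed (use M \<rho> in auto)
    then show ?thesis unfolding PW .
  qed
  have uh: "uniformly_C11 {()} S (\<lambda>_. h)"
  proof (rule four_point_transfer[OF ug S(1,2)])
    show "0 \<le> 4 * exp (2::real)" by simp
    fix a1 a2 a3 a4 x1 x2 x3 x4 and M :: real
    assume x: "x1 \<in> S" "x2 \<in> S" "x3 \<in> S" "x4 \<in> S" and M: "M > 0"
      and le: "\<And>q. q \<in> Q \<Longrightarrow> norm (a1 *\<^sub>R g q x1 + a2 *\<^sub>R g q x2 + a3 *\<^sub>R g q x3 + a4 *\<^sub>R g q x4) \<le> M"
    \<comment> \<open>Indexing by numbers below \<open>4\<close> makes the combinations sums.\<close>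
    define a where "a = (!) [a1, a2, a3, a4]"
    define X where "X = (!) [x1, x2, x3, x4]"
    have X: "X i \<in> S" if "i < 4" for i
      using that x by (auto simp: X_def less_Suc_eq numeral_eq_Suc)
    have Xc: "X i \<in> configurations \<Omega>" if "i < 4" for i using X[OF that] S(4) by blast
    have le': "cmod (\<Sum>i<4. a i *\<^sub>R g q (X i)) \<le> M" if "q \<in> Q" for q
      using le[OF that] by (simp add: sum4 a_def X_def numeral_eq_Suc)
    define \<zeta> where "\<zeta> i = stretch lam (X i $ l)" for i
    have \<zeta>: "cmod (\<zeta> i - \<zeta>0) < 2 * \<rho>" if "i < 4" for i
      using move[OF X[OF that], of l] \<delta>(3) \<rho> by (simp add: \<zeta>_def \<zeta>0_def)
    define J where "J \<eta> = (\<Sum>i<4. of_real (a i) * (w (X i) \<eta> / (\<eta> - \<zeta> i)))" for \<eta>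
    have subD: "cball \<zeta>0 (2 * \<rho>) \<subseteq> D" "ball \<zeta>0 (2 * \<rho>) \<subseteq> D"
      using \<rho>D[of l] \<rho> by (auto simp: \<zeta>0_def subset_iff)
    have contour: "(J has_contour_integral (\<Sum>i<4. of_real (a i) * (2 * of_real pi * \<i> * w (X i) (\<zeta> i)))) (circlepath \<zeta>0 (2 * \<rho>))"
      unfolding J_def
    proof (intro has_contour_integral_sum has_contour_integral_lmul Cauchy_integral_circlepath)
      fix i :: nat assume "i \<in> {..<4}"
      then have i: "i < 4" by simp
      show "continuous_on (cball \<zeta>0 (2 * \<rho>)) (w (X i))" "w (X i) holomorphic_on ball \<zeta>0 (2 * \<rho>)"
        using whol[OF Xc[OF i]] subD by (meson holomorphic_on_imp_continuous_on holomorphic_on_subset)+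
      show "cmod (\<zeta> i - \<zeta>0) < 2 * \<rho>" using \<zeta>[OF i] .
    qed simp
    have "cmod (\<Sum>i<4. of_real (a i) * (2 * of_real pi * \<i> * w (X i) (\<zeta> i))) \<le> (2 * (exp 2 / \<rho> * M)) * (2 * pi * (2 * \<rho>))"
    proof (rule has_contour_integral_bound_circlepath[OF contour])
      fix \<eta> assume "cmod (\<eta> - \<zeta>0) = 2 * \<rho>"
      then have \<eta>: "\<eta> \<in> sphere \<zeta>0 (2 * \<rho>)" by (simp add: dist_norm norm_minus_commute)
      define \<alpha> where "\<alpha> i = inverse (\<eta> - \<zeta> i)" for i
      have 1: "cmod (\<Sum>i<4. (a i * Re (\<alpha> i)) *\<^sub>R w (X i) \<eta>) \<le> exp 2 / \<rho> * M"
      proof (rule comb_w[OF X M \<eta>])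
        fix p assume p: "p \<in> frontier \<Omega>"
        have "\<bar>Re (\<Sum>i<4. a i *\<^sub>R g (\<eta>, p) (X i))\<bar> \<le> M"
          by (rule order_trans[OF abs_Re_le_cmod le']) (use \<eta> p in \<open>simp add: Q_def\<close>)
        then show "\<bar>\<Sum>i<4. a i * Re (\<alpha> i) * burgers_log lam b (X i) p\<bar> \<le> M"
          by (simp add: g_def \<alpha>_def \<zeta>_def mult_ac)
      qed
      have 2: "cmod (\<Sum>i<4. (a i * Im (\<alpha> i)) *\<^sub>R w (X i) \<eta>) \<le> exp 2 / \<rho> * M"
      proof (rule comb_w[OF X M \<eta>])
        fix p assume p: "p \<in> frontier \<Omega>"
        have "\<bar>Im (\<Sum>i<4. a i *\<^sub>R g (\<eta>, p) (X i))\<bar> \<le> M"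
          by (rule order_trans[OF abs_Im_le_cmod le']) (use \<eta> p in \<open>simp add: Q_def\<close>)
        then show "\<bar>\<Sum>i<4. a i * Im (\<alpha> i) * burgers_log lam b (X i) p\<bar> \<le> M"
          by (simp add: g_def \<alpha>_def \<zeta>_def mult_ac)
      qed
      have "J \<eta> = (\<Sum>i<4. (a i * Re (\<alpha> i)) *\<^sub>R w (X i) \<eta>) + \<i> * (\<Sum>i<4. (a i * Im (\<alpha> i)) *\<^sub>R w (X i) \<eta>)"
        unfolding J_def sum_distrib_left sum.distrib[symmetric]
      proof (rule sum.cong[OF refl])
        fix i :: nat
        have "w (X i) \<eta> / (\<eta> - \<zeta> i) = (of_real (Re (\<alpha> i)) + \<i> * of_real (Im (\<alpha> i))) * w (X i) \<eta>"
          unfolding complex_eq[of "\<alpha> i", symmetric] by (simp add: \<alpha>_def divide_inverse mult.commute)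
        then show "of_real (a i) * (w (X i) \<eta> / (\<eta> - \<zeta> i)) = (a i * Re (\<alpha> i)) *\<^sub>R w (X i) \<eta> + \<i> * ((a i * Im (\<alpha> i)) *\<^sub>R w (X i) \<eta>)"
          by (simp add: scaleR_conv_of_real algebra_simps)
      qed
      also have "cmod \<dots> \<le> cmod (\<Sum>i<4. (a i * Re (\<alpha> i)) *\<^sub>R w (X i) \<eta>) + cmod (\<Sum>i<4. (a i * Im (\<alpha> i)) *\<^sub>R w (X i) \<eta>)"
        by (rule order_trans[OF norm_triangle_ineq]) (simp add: norm_mult)
      also have "\<dots> \<le> 2 * (exp 2 / \<rho> * M)" unfolding mult_2 using 1 2 by (rule add_mono)
      finally show "cmod (J \<eta>) \<le> 2 * (exp 2 / \<rho> * M)" .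
    qed (use M \<rho> in auto)
    moreover have "(\<Sum>i<4. of_real (a i) * (2 * of_real pi * \<i> * w (X i) (\<zeta> i))) = (2 * of_real pi * \<i>) * (\<Sum>i<4. a i *\<^sub>R h (X i))"
      unfolding sum_distrib_left by (intro sum.cong refl) (simp add: h_def \<zeta>_def scaleR_conv_of_real)
    ultimately have "2 * pi * cmod (\<Sum>i<4. a i *\<^sub>R h (X i)) \<le> (2 * (exp 2 / \<rho> * M)) * (2 * pi * (2 * \<rho>))"
      by (simp add: norm_mult)
    also have "\<dots> = 2 * pi * (4 * exp 2 * M)" using \<rho> by simp
    finally have "cmod (\<Sum>i<4. a i *\<^sub>R h (X i)) \<le> 4 * exp 2 * M" by (simp add: mult_ac)
    then show "norm (a1 *\<^sub>R h x1 + a2 *\<^sub>R h x2 + a3 *\<^sub>R h x3 + a4 *\<^sub>R h x4) \<le> 4 * exp 2 * M"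
      by (simp add: sum4 a_def X_def numeral_eq_Suc)
  qed
  have uk: "uniformly_C11 {()} S (\<lambda>_ Z. - \<i> * of_real (b i / (2 * pi)) * inverse (stretch lam (Z $ l) + - stretch lam (Z $ i)))" if il: "i \<noteq> l" for i
  proof -
    have "bounded_linear (\<lambda>Z::plane^'n. stretch lam (Z $ l))"
      by (intro bounded_linear_compose[OF bounded_linear_stretch] bounded_linear_vec_nth)
    then have u: "uniformly_C11 {()} S (\<lambda>_ Z. stretch lam (Z $ l) + - stretch lam (Z $ i))"
      by (intro uniformly_C11_add uniformly_C11_linear nthlin S)
    have "dm / 2 \<le> cmod (stretch lam (Z $ l) + - stretch lam (Z $ i))" if Z: "Z \<in> S" for Z
    proof -
      have eq: "stretch lam (Z1 $ l) - stretch lam (Z1 $ i) = (stretch lam (Z $ l) - stretch lam (Z $ i))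
        - (stretch lam (Z $ l) - stretch lam (Z1 $ l)) + (stretch lam (Z $ i) - stretch lam (Z1 $ i))" by simp
      have "cmod (stretch lam (Z1 $ l) - stretch lam (Z1 $ i)) \<le> cmod (stretch lam (Z $ l) - stretch lam (Z $ i))
        + cmod (stretch lam (Z $ l) - stretch lam (Z1 $ l)) + cmod (stretch lam (Z $ i) - stretch lam (Z1 $ i))"

        unfolding eq by (rule order_trans[OF norm_triangle_ineq add_right_mono[OF norm_triangle_ineq4]])
      then show ?thesis using dms[OF il] move[OF Z, of l] move[OF Z, of i] \<delta>(4) by simp
    qed
    then have "uniformly_C11 {()} S (\<lambda>_ Z. inverse (stretch lam (Z $ l) + - stretch lam (Z $ i)))"
      using dm by (intro uniformly_C11_inverse[OF u S(1), of "dm / 2"]) auto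
    then show ?thesis by (intro uniformly_C11_mult uniformly_C11_const[OF order_refl] S)
  qed
  have us: "uniformly_C11 {()} S (\<lambda>_ Z. (\<Sum>i\<in>UNIV - {l}. - \<i> * of_real (b i / (2 * pi)) * inverse (stretch lam (Z $ l) + - stretch lam (Z $ i))) + h Z)"
    by (intro uniformly_C11_add uniformly_C11_sum uk uh S) auto
  define T where "T z = b l *\<^sub>R ((J_mat ** L_mat \<mu> lam) *v gradient_of_complex lam z)" for z
  have T: "bounded_linear T"
    unfolding T_def
    by (rule bounded_linear_compose[OF bounded_linear_scaleR_right
          bounded_linear_compose[OF matrix_vector_mul_bounded_linear bounded_linear_gradient_of_complex]])
  have "uniformly_C11 {()} S (\<lambda>_. peach_koehler \<mu> lam b u0 l)"
  proof (rule uniformly_C11_cong[OF uniformly_C11_compose_linear[OF us S(1) T] S(2)])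
    fix Z assume "Z \<in> S"
    then have Z: "Z \<in> configurations \<Omega>" using S(4) by blast
    have ne: "Z $ l \<noteq> Z $ i" if "i \<noteq> l" for i using Z that by (simp add: configurations_def)
    have gd: "GDERIV (u0 Z) (Z $ l) :> Du Z (Z $ l)" using Du[OF Z] Z unfolding Pr_def configurations_def by blast
    have "grad (u0 Z) (Z $ l) = Du Z (Z $ l)"
      unfolding grad_def
    proof (rule the_equality, rule gd)
      fix D' assume "GDERIV (u0 Z) (Z $ l) :> D'"
      then have eq: "(\<lambda>h. h \<bullet> D') = (\<lambda>h. h \<bullet> Du Z (Z $ l))"
        using gd unfolding gderiv_def by (rule has_derivative_unique)
      have "\<forall>x. x \<bullet> D' = x \<bullet> Du Z (Z $ l)" using fun_cong[OF eq] by simp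
      then show "D' = Du Z (Z $ l)" by (simp only: vector_eq_ldot)
    qed
    moreover have "Du Z (Z $ l) = gradient_of_complex lam (h Z)"
      by (simp add: h_def w_def unstretch_stretch[OF lam] gradient_of_complex_gradient[OF lam])
    moreover have "(\<Sum>i\<in>UNIV - {l}. burgers_kernel lam (b i) (Z $ l) (Z $ i))
      = gradient_of_complex lam (\<Sum>i\<in>UNIV - {l}. - \<i> * of_real (b i / (2 * pi)) * inverse (stretch lam (Z $ l) - stretch lam (Z $ i)))"
      unfolding linear_sum[OF bounded_linear.linear[OF bounded_linear_gradient_of_complex]]
      by (intro sum.cong refl burgers_kernel_eq lam ne) auto
    ultimately show "T ((\<Sum>i\<in>UNIV - {l}. - \<i> * of_real (b i / (2 * pi)) * inverse (stretch lam (Z $ l) + - stretch lam (Z $ i))) + h Z)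
       = peach_koehler \<mu> lam b u0 l Z"
      by (simp add: peach_koehler_def T_def linear_add[OF bounded_linear.linear[OF bounded_linear_gradient_of_complex]])
  qed
  then show ?thesis using \<delta>(1) S(4) unfolding S_def by blast
qed

section \<open>Normals of level sets\<close>

lemma uniformly_C11_subset: "uniformly_C11 Q S f \<Longrightarrow> S' \<subseteq> S \<Longrightarrow> uniformly_C11 Q S' f"
  unfolding uniformly_C11_def by (meson subsetD)

lemma C11_data_singleD:
  assumes "C11_data {()} S (\<lambda>_. g) (\<lambda>_. g') B"
  shows "B > 0"
    "\<And>x. x \<in> S \<Longrightarrow> (g has_derivative g' x) (at x)"
    "\<And>x. x \<in> S \<Longrightarrow> norm (g x) \<le> B"
    "\<And>x v. x \<in> S \<Longrightarrow> norm (g' x v) \<le> B * norm v"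
    "\<And>x y v. x \<in> S \<Longrightarrow> y \<in> S \<Longrightarrow> norm (g' x v - g' y v) \<le> B * norm (x - y) * norm v"
    "\<And>x y. x \<in> S \<Longrightarrow> y \<in> S \<Longrightarrow> norm (g x - g y) \<le> B * norm (x - y)"
    "\<And>x y. x \<in> S \<Longrightarrow> y \<in> S \<Longrightarrow> norm (g y - g x - g' x (y - x)) \<le> B * norm (y - x) * norm (y - x)"
  using C11_dataD[OF assms] by auto

text \<open>The vector \<open>\<nu>\<close> is only known to be orthogonal to velocities of \<open>C\<^sup>1\<close> curves in \<open>A\<close>. Let \<open>p\<close> be the
gradient of \<open>\<phi>\<close> at \<open>x1\<close> and \<open>n\<close> its direction. The map \<open>f\<close> below straightens the level sets of
\<open>\<phi>\<close> and has derivative the identity at \<open>x1\<close>. By the inverse function theorem every \<open>w\<close> orthogonal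
to \<open>p\<close> is the velocity of the curve \<open>c\<close> in \<open>{\<phi> = 0}\<close> that \<open>f\<close> maps to a straight line. Hence \<open>\<nu>\<close> is
parallel to \<open>p\<close>, and the positivity of \<open>\<phi>\<close> on the ray along \<open>\<nu>\<close> determines the sign.\<close>

lemma normal_of_C11_hypersurface:
  fixes \<phi> :: "'a::euclidean_space \<Rightarrow> real"
  assumes r: "r > 0" and \<phi>: "C11_data {()} (ball x1 r) (\<lambda>_. \<phi>) (\<lambda>_. \<phi>') B"
    and z: "\<phi> x1 = 0" and nz: "\<phi>' x1 \<noteq> (\<lambda>v. 0)"
    and A: "\<And>x. x \<in> ball x1 r \<Longrightarrow> \<phi> x = 0 \<Longrightarrow> x \<in> A"
    and \<nu>: "norm \<nu> = 1" "\<forall>v\<in>tangent_vectors A x1. v \<bullet> \<nu> = 0"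
    and pos: "h > 0" "\<And>s. 0 < s \<Longrightarrow> s < h \<Longrightarrow> \<phi> (x1 + s *\<^sub>R \<nu>) > 0"
  shows "\<exists>c>0. \<forall>v. \<phi>' x1 v = c * (v \<bullet> \<nu>)"
proof -
  note D = C11_data_singleD[OF \<phi>]
  have der: "(\<phi> has_derivative \<phi>' x) (at x)" if "x \<in> ball x1 r" for x using D(2) that by simp
  have lin: "linear (\<phi>' x)" if "x \<in> ball x1 r" for x using der[OF that] by (rule has_derivative_linear)
  have blin: "bounded_linear (\<phi>' x)" if "x \<in> ball x1 r" for x using der[OF that] by (rule has_derivative_bounded_linear)
  have x1: "x1 \<in> ball x1 r" using r by simp
  define p where "p = (\<Sum>b\<in>Basis. \<phi>' x1 b *\<^sub>R b)"
  have p: "\<phi>' x1 v = v \<bullet> p" for v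
  proof -
    have "\<phi>' x1 v = \<phi>' x1 (\<Sum>b\<in>Basis. (v \<bullet> b) *\<^sub>R b)" by (simp add: euclidean_representation)
    also have "\<dots> = (\<Sum>b\<in>Basis. (v \<bullet> b) * \<phi>' x1 b)"
      by (simp add: linear_sum[OF lin[OF x1]] linear_scale[OF lin[OF x1]])
    finally show ?thesis by (simp add: p_def inner_sum_right mult.commute)
  qed
  have p0: "p \<noteq> 0" using nz p by auto
  define n where "n = sgn p"
  have n: "norm n = 1" "n \<bullet> n = 1" using p0 by (simp_all add: n_def norm_sgn dot_square_norm)
  have pn: "p = norm p *\<^sub>R n" using p0 by (simp add: n_def sgn_div_norm)
  have pinn: "v \<bullet> p = norm p * (v \<bullet> n)" for v by (subst pn) simp
  have tangent: "w \<in> tangent_vectors A x1" if w: "w \<bullet> p = 0" for w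
  proof -
    have wn: "w \<bullet> n = 0" using w p0 pinn[of w] by simp
    define f where "f Y = Y + (\<phi> Y / norm p - (Y - x1) \<bullet> n) *\<^sub>R n" for Y
    define f' where "f' Y v = v + (\<phi>' Y v / norm p - v \<bullet> n) *\<^sub>R n" for Y v
    have fder: "(f has_derivative f' Y) (at Y)" if "Y \<in> ball x1 r" for Y
      unfolding f_def f'_def using p0 by (auto intro!: derivative_eq_intros der[OF that])
    have fbl: "bounded_linear (f' Y)" if "Y \<in> ball x1 r" for Y using fder[OF that] by (rule has_derivative_bounded_linear)
    have fB: "blinfun_apply (Blinfun (f' Y)) = f' Y" if "Y \<in> ball x1 r" for Y
      using fbl[OF that] by (rule bounded_linear_Blinfun_apply)
    have fcont: "continuous_on (ball x1 r) (\<lambda>Y. Blinfun (f' Y))"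
    proof (rule continuous_on_blinfun_componentwise)
      fix i :: 'a assume "i \<in> Basis"
      have "continuous_on (ball x1 r) (\<lambda>Y. \<phi>' Y i)"
      proof (rule lipschitz_on_continuous_on[of "B * norm i"], rule lipschitz_onI)
        fix x y assume "x \<in> ball x1 r" "y \<in> ball x1 r"
        then show "dist (\<phi>' x i) (\<phi>' y i) \<le> (B * norm i) * dist x y"
          using D(5)[of x y i] by (simp add: dist_norm mult_ac)
      qed (use D(1) in simp)
      then have "continuous_on (ball x1 r) (\<lambda>Y. f' Y i)"
        unfolding f'_def using p0 by (intro continuous_intros) auto
      then show "continuous_on (ball x1 r) (\<lambda>Y. blinfun_apply (Blinfun (f' Y)) i)"
        by (rule continuous_on_eq) (simp add: fB)
    qed
    have f'1: "f' x1 = (\<lambda>v. v)" using p0 by (auto simp: f'_def p pinn)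
    have inv: "id_blinfun o\<^sub>L Blinfun (f' x1) = id_blinfun"
      by (rule blinfun_eqI) (simp add: fB[OF x1, unfolded f'1] f'1)
    have f1: "f x1 = x1" by (simp add: f_def z)
    obtain U V g g' where UV: "open U" "U \<subseteq> ball x1 r" "x1 \<in> U" "open V" "f x1 \<in> V" "homeomorphism U V f g"
      and gder: "\<And>y. y \<in> V \<Longrightarrow> (g has_derivative (g' y)) (at y)"
    proof (rule inverse_function_theorem[where f = f and f' = "\<lambda>Y. Blinfun (f' Y)" and U = "ball x1 r" and ?x0.0 = x1 and invf = id_blinfun])
      show "(f has_derivative blinfun_apply (Blinfun (f' x))) (at x)" if "x \<in> ball x1 r" for x
        using fder[OF that] by (simp add: fB[OF that])
    next
      fix U V g and g' :: "'a \<Rightarrow> 'a \<Rightarrow> 'a"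
      assume "open U" "U \<subseteq> ball x1 r" "x1 \<in> U" "open V" "f x1 \<in> V" "homeomorphism U V f g"
        "\<And>y. y \<in> V \<Longrightarrow> (g has_derivative g' y) (at y)"
      then show thesis by (rule that)
    qed (use fcont x1 inv in auto)
    have fg: "f (g y) = y" "g y \<in> U" if "y \<in> V" for y
      using UV(6) that by (auto simp: homeomorphism_def)
    have gf1: "g x1 = x1" using UV(3,6) f1 by (auto simp: homeomorphism_def)
    have x1V: "x1 \<in> V" using UV(5) f1 by simp
    have "isCont (\<lambda>s. x1 + s *\<^sub>R w) 0" by (intro continuous_intros)
    then have "eventually (\<lambda>s. x1 + s *\<^sub>R w \<in> V) (at 0)"
      unfolding isCont_def using UV(4) x1V by (intro topological_tendstoD) auto
    then obtain d1 where d1': "d1 > 0" "\<forall>s. s \<noteq> 0 \<and> \<bar>s\<bar> < d1 \<longrightarrow> x1 + s *\<^sub>R w \<in> V"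
      unfolding eventually_at by (auto simp: dist_real_def)
    have d1: "d1 > 0" "\<And>s. \<bar>s\<bar> < d1 \<Longrightarrow> x1 + s *\<^sub>R w \<in> V"
    proof -
      show "x1 + s *\<^sub>R w \<in> V" if "\<bar>s\<bar> < d1" for s
        using d1'(2) that x1V by (cases "s = 0") auto
    qed (rule d1')
    define c where "c s = g (x1 + s *\<^sub>R w)" for s
    define d where "d s = g' (x1 + s *\<^sub>R w) w" for s
    have cder: "(c has_vector_derivative d s) (at s)" if "\<bar>s\<bar> < d1" for s
    proof -
      have h: "((\<lambda>s. x1 + s *\<^sub>R w) has_derivative (\<lambda>t. t *\<^sub>R w)) (at s)"
        by (auto intro!: derivative_eq_intros)
      have gs: "(g has_derivative g' (x1 + s *\<^sub>R w)) (at (x1 + s *\<^sub>R w))" using gder d1(2) that by blast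
      from has_derivative_compose[OF h gs]
      have "(c has_derivative (\<lambda>t. g' (x1 + s *\<^sub>R w) (t *\<^sub>R w))) (at s)" by (simp add: c_def[abs_def])
      then show ?thesis
        by (simp add: has_vector_derivative_def d_def linear_scale[OF has_derivative_linear[OF gs]])
    qed
    have cU: "c s \<in> ball x1 r" "f (c s) = x1 + s *\<^sub>R w" if "\<bar>s\<bar> < d1" for s
      using fg[OF d1(2)[OF that]] UV(2) by (auto simp: c_def)
    have \<phi>c: "\<phi> (c s) = 0" if s: "\<bar>s\<bar> < d1" for s
    proof -
      have "f (c s) \<bullet> n = \<phi> (c s) / norm p + x1 \<bullet> n"
        by (simp add: f_def inner_add_left inner_diff_left n)
      moreover have "f (c s) \<bullet> n = x1 \<bullet> n" unfolding cU(2)[OF s] by (simp add: inner_add_left wn)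
      ultimately show ?thesis using p0 by simp
    qed
    have c0: "c 0 = x1" by (simp add: c_def gf1)
    have ccont: "continuous_on {-d1<..<d1} c"

    proof (intro continuous_at_imp_continuous_on ballI)
      fix s assume "s \<in> {-d1<..<d1}"
      then have "\<bar>s\<bar> < d1" by auto
      then show "isCont c s" by (rule has_vector_derivative_continuous[OF cder])
    qed
    have \<phi>'cont: "continuous_on {-d1<..<d1} (\<lambda>s. \<phi>' (c s) v)" for v
    proof (rule continuous_on_compose2[OF _ ccont])
      show "continuous_on (ball x1 r) (\<lambda>x. \<phi>' x v)"
      proof (rule lipschitz_on_continuous_on[of "B * norm v"], rule lipschitz_onI)
        fix x y assume "x \<in> ball x1 r" "y \<in> ball x1 r"
        then show "dist (\<phi>' x v) (\<phi>' y v) \<le> (B * norm v) * dist x y"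
          using D(5)[of x y v] by (simp add: dist_norm mult_ac)
      qed (use D(1) in simp)
      show "c ` {-d1<..<d1} \<subseteq> ball x1 r" using cU(1) by (auto simp: abs_less_iff)
    qed
    have "isCont (\<lambda>s. \<phi>' (c s) n) 0"
      using \<phi>'cont[of n] d1(1) by (intro continuous_on_interior[of "{-d1<..<d1}"]) auto
    moreover have pos0: "\<phi>' (c 0) n > 0" using p0 by (simp add: c0 p pinn n)
    ultimately have "eventually (\<lambda>s. \<phi>' (c s) n > 0) (at 0)"
      unfolding isCont_def by (rule order_tendstoD)
    then obtain d2 where d2': "d2 > 0" "\<forall>s. s \<noteq> 0 \<and> \<bar>s\<bar> < d2 \<longrightarrow> \<phi>' (c s) n > 0"
      unfolding eventually_at by (auto simp: dist_real_def)
    have d2: "d2 > 0" "\<And>s. \<bar>s\<bar> < d2 \<Longrightarrow> \<phi>' (c s) n > 0"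
    proof -
      show "\<phi>' (c s) n > 0" if "\<bar>s\<bar> < d2" for s
        using d2'(2) that pos0 by (cases "s = 0") auto
    qed (rule d2')
    define \<epsilon> where "\<epsilon> = min d1 d2"
    have \<epsilon>: "\<epsilon> > 0" "\<epsilon> \<le> d1" "\<epsilon> \<le> d2" using d1 d2 by (auto simp: \<epsilon>_def)
    \<comment> \<open>This formula, obtained by differentiating \<open>f (c s)\<close> and \<open>\<phi> (c s)\<close>, shows that \<open>d\<close> is continuous.\<close>
    have dform: "d s = w - (\<phi>' (c s) w / \<phi>' (c s) n) *\<^sub>R n" if s: "\<bar>s\<bar> < \<epsilon>" for s
    proof -
      have s1: "\<bar>s\<bar> < d1" "\<bar>s\<bar> < d2" using s \<epsilon> by auto
      note cb = cU(1)[OF s1(1)]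
      have cd: "(c has_derivative (\<lambda>t. t *\<^sub>R d s)) (at s)" using cder[OF s1(1)] by (simp add: has_vector_derivative_def)
      have op: "open {-d1<..<d1}" "s \<in> {-d1<..<d1}" using s1 by auto
      have "((\<lambda>s. \<phi> (c s)) has_derivative (\<lambda>t. \<phi>' (c s) (t *\<^sub>R d s))) (at s)"
        using has_derivative_compose[OF cd der[OF cb]] .
      moreover have "((\<lambda>s. \<phi> (c s)) has_derivative (\<lambda>t. 0)) (at s)"
        by (rule has_derivative_transform_within_open[OF has_derivative_const op]) (simp add: \<phi>c abs_less_iff)
      ultimately have "(\<lambda>t. \<phi>' (c s) (t *\<^sub>R d s)) = (\<lambda>t. 0)" by (rule has_derivative_unique)
      from fun_cong[OF this, of 1] have z0: "\<phi>' (c s) (d s) = 0" by simp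
      have "((\<lambda>s. f (c s)) has_derivative (\<lambda>t. f' (c s) (t *\<^sub>R d s))) (at s)"
        using has_derivative_compose[OF cd fder[OF cb]] .
      moreover have "((\<lambda>s. f (c s)) has_derivative (\<lambda>t. t *\<^sub>R w)) (at s)"
      proof (rule has_derivative_transform_within_open[OF _ op])
        show "((\<lambda>s. x1 + s *\<^sub>R w) has_derivative (\<lambda>t. t *\<^sub>R w)) (at s)" by (auto intro!: derivative_eq_intros)
      qed (simp add: cU(2) abs_less_iff)
      ultimately have "(\<lambda>t. f' (c s) (t *\<^sub>R d s)) = (\<lambda>t. t *\<^sub>R w)" by (rule has_derivative_unique)
      from fun_cong[OF this, of 1] have "f' (c s) (d s) = w" by simp
      then have dw: "d s = w + (d s \<bullet> n) *\<^sub>R n" unfolding f'_def z0 by (simp add: algebra_simps)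
      have "\<phi>' (c s) w + (d s \<bullet> n) * \<phi>' (c s) n = 0"
        using z0 by (subst (asm) dw) (simp add: linear_add[OF lin[OF cb]] linear_scale[OF lin[OF cb]])
      then have "d s \<bullet> n = - (\<phi>' (c s) w / \<phi>' (c s) n)" using d2(2)[OF s1(2)] by (simp add: field_simps)
      with dw show ?thesis by simp
    qed
    have dcont: "continuous_on {-\<epsilon><..<\<epsilon>} d"
    proof -
      have sub: "{-\<epsilon><..<\<epsilon>} \<subseteq> {-d1<..<d1}" using \<epsilon> by auto
      have "\<forall>s\<in>{-\<epsilon><..<\<epsilon>}. \<phi>' (c s) n \<noteq> 0"
      proof
        fix s assume "s \<in> {-\<epsilon><..<\<epsilon>}"
        then have "\<bar>s\<bar> < d2" using \<epsilon> by auto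
        then show "\<phi>' (c s) n \<noteq> 0" using d2(2)[of s] by simp
      qed
      then have "continuous_on {-\<epsilon><..<\<epsilon>} (\<lambda>s. w - (\<phi>' (c s) w / \<phi>' (c s) n) *\<^sub>R n)"
        by (intro continuous_intros continuous_on_subset[OF \<phi>'cont sub])
      then show ?thesis by (rule continuous_on_eq) (simp add: dform abs_less_iff)
    qed
    have "d 0 = w" using dform[of 0] \<epsilon>(1) w by (simp add: c0 p)
    then have "(c has_vector_derivative w) (at 0)" using cder[of 0] d1(1) by simp
    moreover have "c C1_differentiable_on {-\<epsilon><..<\<epsilon>}"
      unfolding C1_differentiable_on_def using cder dcont \<epsilon> by (intro exI[of _ d]) (auto simp: abs_less_iff)
    moreover have "c ` {-\<epsilon><..<\<epsilon>} \<subseteq> A"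
      using A cU(1) \<phi>c \<epsilon> by (auto simp: abs_less_iff)
    ultimately show ?thesis unfolding tangent_vectors_def using \<epsilon>(1) c0 by blast
  qed
  define w where "w = \<nu> - (\<nu> \<bullet> n) *\<^sub>R n"
  have "w \<bullet> p = 0" by (simp add: pinn w_def inner_diff_left n)
  then have "w \<bullet> \<nu> = 0" using tangent \<nu>(2) by blast
  moreover have "w \<bullet> n = 0" by (simp add: w_def inner_diff_left n)
  ultimately have "w \<bullet> w = 0" by (subst (2) w_def) (simp add: inner_diff_right)
  then have \<nu>n: "\<nu> = (\<nu> \<bullet> n) *\<^sub>R n" by (simp add: w_def)
  have t0: "\<nu> \<bullet> n \<noteq> 0" using \<nu>n \<nu>(1) by auto
  have "0 \<le> \<phi>' x1 \<nu>"
  proof (rule le_of_le_add_small[of "min h r" _ _ B])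
    fix s assume s: "0 < s" "s < min h r"
    have "x1 + s *\<^sub>R \<nu> \<in> ball x1 r" using s \<nu>(1) by (simp add: dist_norm)
    from D(7)[OF x1 this] have "\<bar>\<phi> (x1 + s *\<^sub>R \<nu>) - s * \<phi>' x1 \<nu>\<bar> \<le> B * s * s"
      using s \<nu>(1) z by (simp add: linear_scale[OF lin[OF x1]])
    then have "0 \<le> s * \<phi>' x1 \<nu> + B * s * s" using pos(2)[of s] s by auto
    then have "0 \<le> s * (\<phi>' x1 \<nu> + B * s)" by (simp add: algebra_simps)
    then show "0 \<le> \<phi>' x1 \<nu> + B * s" using s by (simp add: zero_le_mult_iff)
  qed (use pos r in auto)
  then have "0 \<le> norm p * (\<nu> \<bullet> n)" by (simp add: p pinn)
  then have tpos: "\<nu> \<bullet> n > 0" using p0 t0 by (simp add: zero_le_mult_iff)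
  have "\<phi>' x1 v = (norm p / (\<nu> \<bullet> n)) * (v \<bullet> \<nu>)" for v
  proof -
    have "v \<bullet> \<nu> = (\<nu> \<bullet> n) * (v \<bullet> n)" by (subst \<nu>n) simp
    then show ?thesis using t0 by (simp add: p pinn)
  qed
  then show ?thesis using tpos p0 by (intro exI[of _ "norm p / (\<nu> \<bullet> n)"]) simp
qed

text \<open>Both points vary near \<open>x1\<close>, so a single linear form \<open>q\<close> controls \<open>\<phi>\<close> along a whole trajectory close
to \<open>x1\<close>.\<close>

definition strictly_differentiable :: "('a::real_normed_vector \<Rightarrow> real) \<Rightarrow> ('a \<Rightarrow> real) \<Rightarrow> 'a \<Rightarrow> bool" where
  "strictly_differentiable \<phi> q x1 \<longleftrightarrow> bounded_linear q \<and>
     (\<forall>\<epsilon>>0. \<exists>r>0. \<forall>x\<in>ball x1 r. \<forall>y\<in>ball x1 r. \<bar>\<phi> y - \<phi> x - q (y - x)\<bar> \<le> \<epsilon> * norm (y - x))"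

lemma C11_data_strictly_differentiable:
  assumes "r > 0" "C11_data {()} (ball x1 r) (\<lambda>_. \<phi>) (\<lambda>_. \<phi>') B"
  shows "strictly_differentiable \<phi> (\<phi>' x1) x1"
proof -
  note D = C11_data_singleD[OF assms(2)]
  have x1: "x1 \<in> ball x1 r" using assms(1) by simp
  have bl: "bounded_linear (\<phi>' x1)" using D(2) x1 by (metis has_derivative_bounded_linear mem_ball)
  show ?thesis
    unfolding strictly_differentiable_def
  proof (intro conjI bl allI impI)
    fix \<epsilon> :: real assume \<epsilon>: "\<epsilon> > 0"
    define r' where "r' = min r (\<epsilon> / (4 * B))"
    have r': "r' > 0" "r' \<le> r" "4 * B * r' \<le> \<epsilon>"
      using assms(1) \<epsilon> D(1) by (auto simp: r'_def min_def field_simps)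
    have "\<bar>\<phi> y - \<phi> x - \<phi>' x1 (y - x)\<bar> \<le> \<epsilon> * norm (y - x)" if xy: "x \<in> ball x1 r'" "y \<in> ball x1 r'" for x y
    proof -
      have b: "x \<in> ball x1 r" "y \<in> ball x1 r" using xy r' by auto
      have 1: "\<bar>\<phi> y - \<phi> x - \<phi>' x (y - x)\<bar> \<le> B * norm (y - x) * norm (y - x)" using D(7) b by simp
      have 2: "\<bar>\<phi>' x (y - x) - \<phi>' x1 (y - x)\<bar> \<le> B * norm (x - x1) * norm (y - x)" using D(5)[of x x1 "y - x"] b x1 by simp
      have n1: "norm (x - x1) \<le> r'" using xy by (simp add: dist_norm norm_minus_commute)
      have n2: "norm (y - x) \<le> 2 * r'" using xy dist_triangle2[of y x x1] by (simp add: dist_norm norm_minus_commute)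
      have "B * norm (y - x) + B * norm (x - x1) \<le> B * (2 * r') + B * r'"
        using n1 n2 D(1) by (intro add_mono mult_left_mono) auto
      also have "\<dots> \<le> \<epsilon>"
      proof -
        have "0 \<le> B * r'" using r'(1) D(1) by simp
        moreover have "B * (2 * r') + B * r' = 3 * (B * r')" "4 * B * r' = 4 * (B * r')" by simp_all
        ultimately show ?thesis using r'(3) by linarith
      qed
      finally have "(B * norm (y - x) + B * norm (x - x1)) * norm (y - x) \<le> \<epsilon> * norm (y - x)" by (intro mult_right_mono) auto
      with 1 2 show ?thesis by (simp add: algebra_simps)
    qed
    with r'(1) show "\<exists>r>0. \<forall>x\<in>ball x1 r. \<forall>y\<in>ball x1 r. \<bar>\<phi> y - \<phi> x - \<phi>' x1 (y - x)\<bar> \<le> \<epsilon> * norm (y - x)" by blast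
  qed
qed

section \<open>Sliding on the intersection of two surfaces\<close>

lemma bounded_linear_absE:
  assumes "bounded_linear (q :: 'a::real_normed_vector \<Rightarrow> real)"
  obtains K where "K > 0" "\<And>z. \<bar>q z\<bar> \<le> K * norm z"
  using bounded_linear.pos_bounded[OF assms] by (metis mult.commute real_norm_def)

lemma strictly_differentiableD:
  assumes "strictly_differentiable \<phi> q x1" "\<epsilon> > 0"
  shows "\<exists>r>0. \<forall>x\<in>ball x1 r. \<forall>y\<in>ball x1 r. \<bar>\<phi> y - \<phi> x - q (y - x)\<bar> \<le> \<epsilon> * norm (y - x)"
  using assms unfolding strictly_differentiable_def by blast

text \<open>To first order \<open>\<phi> (W w) - \<phi> (W u)\<close> is \<open>(w - u) * q v\<close>. The error \<open>\<theta>\<close> comes from the derivative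
of \<open>W\<close>, the error \<open>\<epsilon>\<close> from strict differentiability, and both together are absorbed by \<open>\<eta>\<close>.\<close>

lemma descending_along_trajectory:
  fixes W :: "real \<Rightarrow> 'a::real_normed_vector"
  assumes W: "(W has_vector_derivative v) (at t within I)" and v: "norm v \<le> B" "q v \<le> - \<eta>"
    and q: "bounded_linear q" and K: "\<And>z. \<bar>q z\<bar> \<le> K * norm z" and \<theta>: "\<theta> > 0" "K * \<theta> + \<epsilon> * (B + \<theta>) \<le> \<eta>" "\<epsilon> \<ge> 0" "K \<ge> 0"
    and sd: "\<And>x y. x \<in> U \<Longrightarrow> y \<in> U \<Longrightarrow> \<bar>\<phi> y - \<phi> x - q (y - x)\<bar> \<le> \<epsilon> * norm (y - x)"
    and U: "\<And>s. s \<in> I \<Longrightarrow> W s \<in> U"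
  shows "\<exists>r>0. \<forall>u\<in>I. \<forall>w\<in>I. u \<le> t \<and> t \<le> w \<and> t - r < u \<and> w < t + r \<longrightarrow> \<phi> (W w) \<le> \<phi> (W u)"
proof -
  obtain r where r: "r > 0" "\<And>u w. u \<in> I \<Longrightarrow> w \<in> I \<Longrightarrow> u \<le> t \<and> t \<le> w \<and> t - r < u \<and> w < t + r \<Longrightarrow>
           norm (W w - W u - (w - u) *\<^sub>R v) \<le> \<theta> * (w - u)"
    using has_vector_derivative_straddle[OF W \<theta>(1)] by blast
  have "\<phi> (W w) \<le> \<phi> (W u)" if uw: "u \<in> I" "w \<in> I" "u \<le> t \<and> t \<le> w \<and> t - r < u \<and> w < t + r" for u w
  proof -
    define e where "e = W w - W u - (w - u) *\<^sub>R v"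
    have e: "norm e \<le> \<theta> * (w - u)" using r(2)[OF uw] by (simp add: e_def)
    have Wd: "W w - W u = (w - u) *\<^sub>R v + e" by (simp add: e_def)
    have n: "norm (W w - W u) \<le> (w - u) * (B + \<theta>)"
    proof -
      have "norm (W w - W u) \<le> norm ((w - u) *\<^sub>R v) + norm e" unfolding Wd by (rule norm_triangle_ineq)
      also have "\<dots> \<le> (w - u) * B + \<theta> * (w - u)" using e v(1) uw by (intro add_mono) (auto intro: mult_left_mono)
      finally show ?thesis by (simp add: algebra_simps)
    qed
    have "q (W w - W u) = (w - u) * q v + q e"
      unfolding Wd by (simp add: linear_add[OF bounded_linear.linear[OF q]] linear_scale[OF bounded_linear.linear[OF q]])
    also have "\<dots> \<le> (w - u) * (- \<eta>) + K * (\<theta> * (w - u))"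
    proof (rule add_mono)
      show "(w - u) * q v \<le> (w - u) * - \<eta>" using uw v(2) by (intro mult_left_mono) auto
      have "K * norm e \<le> K * (\<theta> * (w - u))" using e \<theta>(4) by (rule mult_left_mono)
      then show "q e \<le> K * (\<theta> * (w - u))" using K[of e] by linarith
    qed
    finally have qq: "q (W w - W u) \<le> (w - u) * (- \<eta>) + K * (\<theta> * (w - u))" .
    have "\<phi> (W w) - \<phi> (W u) \<le> q (W w - W u) + \<epsilon> * norm (W w - W u)" using sd[OF U[OF uw(1)] U[OF uw(2)]] by linarith
    also have "\<dots> \<le> (w - u) * (- \<eta>) + K * (\<theta> * (w - u)) + \<epsilon> * ((w - u) * (B + \<theta>))"
      using qq n \<theta>(3) by (intro add_mono mult_left_mono) auto
    also have "\<dots> = (w - u) * (K * \<theta> + \<epsilon> * (B + \<theta>) - \<eta>)" by (simp add: algebra_simps)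
    also have "\<dots> \<le> 0" using uw \<theta>(2) by (intro mult_nonneg_nonpos) auto
    finally show ?thesis by simp
  qed
  with r(1) show ?thesis by blast
qed

definition trajectory_on :: "('a::real_normed_vector \<Rightarrow> 'a set) \<Rightarrow> real \<Rightarrow> real \<Rightarrow> (real \<Rightarrow> 'a) \<Rightarrow> bool" where
  "trajectory_on H a b W \<longleftrightarrow> absolutely_continuous_fun_on {a..b} W \<and>
     (AE t in lebesgue. t \<in> {a<..<b} \<longrightarrow> (\<exists>v\<in>H (W t). (W has_vector_derivative v) (at t within {a..b})))"

lemma trajectory_onD:
  assumes "trajectory_on H a b W"
  shows "absolutely_continuous_fun_on {a..b} W"
    "AE t in lebesgue. t \<in> {a<..<b} \<longrightarrow> (\<exists>v\<in>H (W t). (W has_vector_derivative v) (at t within {a..b}))"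
  using assms by (auto simp: trajectory_on_def)

lemma trajectory_stays_below:
  fixes W :: "real \<Rightarrow> 'a::real_normed_vector"
  assumes tr: "trajectory_on H a b W" and \<phi>a: "\<phi> (W a) \<le> 0"
    and H: "\<And>x v. x \<in> U \<Longrightarrow> v \<in> H x \<Longrightarrow> norm v \<le> B" "\<And>x v. x \<in> U \<Longrightarrow> v \<in> H x \<Longrightarrow> \<phi> x > 0 \<Longrightarrow> q v \<le> - \<eta>"
    and q: "bounded_linear q" and K: "\<And>z. \<bar>q z\<bar> \<le> K * norm z" and \<theta>: "\<theta> > 0" "K * \<theta> + \<epsilon> * (B + \<theta>) \<le> \<eta>" "\<epsilon> \<ge> 0" "K \<ge> 0"
    and sd: "\<And>x y. x \<in> U \<Longrightarrow> y \<in> U \<Longrightarrow> \<bar>\<phi> y - \<phi> x - q (y - x)\<bar> \<le> \<epsilon> * norm (y - x)"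
    and U: "\<And>s. s \<in> {a..b} \<Longrightarrow> W s \<in> U" and t: "t \<in> {a..b}"
  shows "\<phi> (W t) \<le> 0"
proof (rule absolutely_continuous_barrier[where f = "\<lambda>s. \<phi> (W s)" and a = a and b = b])
  note ac = trajectory_onD(1)[OF tr] and ae = trajectory_onD(2)[OF tr]
  show "absolutely_continuous_fun_on {a..b} (\<lambda>s. \<phi> (W s))"
  proof (rule absolutely_continuous_fun_on_lipschitz[OF ac])
    fix s t assume st: "s \<in> {a..b}" "t \<in> {a..b}"
    have "\<bar>\<phi> (W t) - \<phi> (W s) - q (W t - W s)\<bar> \<le> \<epsilon> * norm (W t - W s)" using sd U st by blast
    then have "\<bar>\<phi> (W t) - \<phi> (W s)\<bar> \<le> \<epsilon> * norm (W t - W s) + K * norm (W t - W s)" using K[of "W t - W s"] by linarith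
    then show "norm (\<phi> (W t) - \<phi> (W s)) \<le> (\<epsilon> + K) * norm (W t - W s)" by (simp add: distrib_right)
  qed (use \<theta> in auto)
  show "AE t in lebesgue. t \<in> {a<..<b} \<longrightarrow> 0 < \<phi> (W t) \<longrightarrow>
      (\<exists>r>0. \<forall>u v. a \<le> u \<and> u \<le> t \<and> t \<le> v \<and> v \<le> b \<and> t - r < u \<and> v < t + r \<longrightarrow> \<phi> (W v) \<le> \<phi> (W u))"
    using ae
  proof (rule AE_mp, intro AE_I2 impI)
    fix t assume 1: "t \<in> {a<..<b} \<longrightarrow> (\<exists>v\<in>H (W t). (W has_vector_derivative v) (at t within {a..b}))"
      and 2: "t \<in> {a<..<b}" "0 < \<phi> (W t)"
    then obtain v where v: "v \<in> H (W t)" "(W has_vector_derivative v) (at t within {a..b})" by blast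
    have Wt: "W t \<in> U" using U 2 by simp
    have "\<exists>r>0. \<forall>u\<in>{a..b}. \<forall>w\<in>{a..b}. u \<le> t \<and> t \<le> w \<and> t - r < u \<and> w < t + r \<longrightarrow> \<phi> (W w) \<le> \<phi> (W u)"
      by (rule descending_along_trajectory[OF v(2) H(1)[OF Wt v(1)] H(2)[OF Wt v(1) 2(2)] q K \<theta> sd U])
    then obtain r where r: "r > 0" "\<And>u w. u\<in>{a..b} \<Longrightarrow> w\<in>{a..b} \<Longrightarrow> u \<le> t \<and> t \<le> w \<and> t - r < u \<and> w < t + r \<Longrightarrow> \<phi> (W w) \<le> \<phi> (W u)"
      by blast
    show "\<exists>r>0. \<forall>u v. a \<le> u \<and> u \<le> t \<and> t \<le> v \<and> v \<le> b \<and> t - r < u \<and> v < t + r \<longrightarrow> \<phi> (W v) \<le> \<phi> (W u)"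
      using r(1) by (intro exI[of _ r] conjI allI impI r) auto
  qed
qed (use \<phi>a t in auto)

text \<open>Up to the first exit time the speed is at most \<open>B\<close>, so the distance covered by then is less than \<open>r\<close>.\<close>

lemma trajectory_confined:
  fixes W :: "real \<Rightarrow> 'a::real_inner"
  assumes tr: "trajectory_on H a b W" and B: "B \<ge> 0" "B * (b - a) < r" and r: "r > 0"
    and H: "\<And>x v. x \<in> ball (W a) r \<Longrightarrow> v \<in> H x \<Longrightarrow> norm v \<le> B" and t: "t \<in> {a..b}"
  shows "W t \<in> ball (W a) r"
proof (rule ccontr)
  note ac = trajectory_onD(1)[OF tr] and ae = trajectory_onD(2)[OF tr]
  assume nt: "W t \<notin> ball (W a) r"
  have cont: "continuous_on {a..b} W" using ac by (rule absolutely_continuous_fun_on_imp_continuous)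
  define A where "A = {s \<in> {a..b}. r \<le> dist (W a) (W s)}"
  have "closed A" unfolding A_def by (intro continuous_on_closed_Collect_le continuous_intros cont)
  moreover have "A \<noteq> {}" "bdd_below A" using nt t by (auto simp: A_def not_less)
  ultimately have "Inf A \<in> A" using closed_contains_Inf by blast
  define s where "s = Inf A"
  have s: "a \<le> s" "s \<le> b" "r \<le> dist (W a) (W s)" using \<open>Inf A \<in> A\<close> by (auto simp: A_def s_def)
  have before: "W x \<in> ball (W a) r" if "x \<in> {a..<s}" for x
  proof (rule ccontr)
    assume "W x \<notin> ball (W a) r"
    then have "x \<in> A" using that s by (auto simp: A_def)
    then have "s \<le> x" unfolding s_def using \<open>bdd_below A\<close> by (rule cInf_lower)
    with that show False by simp
  qed
  have "norm (W s - W a) \<le> B * (s - a)"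
  proof (rule absolutely_continuous_speed_bound[OF absolutely_continuous_fun_on_subset[OF ac] s(1)])
    show "AE t in lebesgue. t \<in> {a<..<s} \<longrightarrow> (\<exists>v. (W has_vector_derivative v) (at t within {a..s}) \<and> norm v \<le> B)"
      using ae
    proof (rule AE_mp, intro AE_I2 impI)
      fix t assume 1: "t \<in> {a<..<b} \<longrightarrow> (\<exists>v\<in>H (W t). (W has_vector_derivative v) (at t within {a..b}))" and 2: "t \<in> {a<..<s}"
      then obtain v where v: "v \<in> H (W t)" "(W has_vector_derivative v) (at t within {a..b})" using s by auto
      have "norm v \<le> B" using H[OF before v(1)] 2 by simp
      moreover have "(W has_vector_derivative v) (at t within {a..s})"
        using v(2) by (rule has_vector_derivative_within_subset) (use s in auto)
      ultimately show "\<exists>v. (W has_vector_derivative v) (at t within {a..s}) \<and> norm v \<le> B" by blast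
    qed
  qed (use s in auto)
  also have "\<dots> \<le> B * (b - a)" using s B by (intro mult_left_mono) auto
  also have "\<dots> < r" by (rule B(2))
  finally show False using s(3) by (simp add: dist_norm norm_minus_commute)
qed

text \<open>The set-valued map \<open>H\<close> pushes trajectories back to \<open>{\<phi> = 0}\<close> and to \<open>{\<psi> = 0}\<close>, so they remain on both
surfaces. There the velocities are \<open>f x\<close> up to the span of the fixed vectors \<open>E\<close> and \<open>F\<close>. Let \<open>P\<close>
be the projection with kernel spanned by \<open>E\<close> and \<open>F\<close> onto the common kernel of \<open>p\<close> and \<open>q\<close>; it
exists by the determinant condition. For the difference \<open>D\<close> of two trajectories the velocity of
\<open>P D\<close> is at most a constant times \<open>norm D\<close>. On the other hand \<open>p D\<close> and \<open>q D\<close> are at most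
\<open>\<epsilon> * norm D\<close>, because both trajectories lie on both surfaces, hence \<open>norm D \<le> 2 * norm (P D)\<close>. On
a short interval the two bounds force \<open>D\<close> to vanish.\<close>

lemma codimension_two_sliding:
  fixes x1 :: "'a::euclidean_space" and H :: "'a \<Rightarrow> 'a set"
  assumes \<phi>: "strictly_differentiable \<phi> p x1" "\<phi> x1 = 0" and \<psi>: "strictly_differentiable \<psi> q x1" "\<psi> x1 = 0"
    and det: "p E * q F - p F * q E \<noteq> 0"
    and r: "r > 0" and \<eta>: "\<eta> > 0" and B: "B > 0"
    and HB: "\<And>x v. x \<in> ball x1 r \<Longrightarrow> v \<in> H x \<Longrightarrow> norm v \<le> B"
    and H1: "\<And>x v. x \<in> ball x1 r \<Longrightarrow> v \<in> H x \<Longrightarrow> \<phi> x > 0 \<Longrightarrow> p v \<le> - \<eta>"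
    and H2: "\<And>x v. x \<in> ball x1 r \<Longrightarrow> v \<in> H x \<Longrightarrow> \<phi> x < 0 \<Longrightarrow> p v \<ge> \<eta>"
    and H3: "\<And>x v. x \<in> ball x1 r \<Longrightarrow> v \<in> H x \<Longrightarrow> \<psi> x > 0 \<Longrightarrow> q v \<le> - \<eta>"
    and H4: "\<And>x v. x \<in> ball x1 r \<Longrightarrow> v \<in> H x \<Longrightarrow> \<psi> x < 0 \<Longrightarrow> q v \<ge> \<eta>"
    and H0: "\<And>x v. x \<in> ball x1 r \<Longrightarrow> v \<in> H x \<Longrightarrow> \<phi> x = 0 \<Longrightarrow> \<psi> x = 0 \<Longrightarrow> \<exists>\<alpha> \<beta>. v = f x + \<alpha> *\<^sub>R E + \<beta> *\<^sub>R F"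
    and f: "\<And>x y. x \<in> ball x1 r \<Longrightarrow> y \<in> ball x1 r \<Longrightarrow> norm (f x - f y) \<le> L * norm (x - y)" "L \<ge> 0"
  obtains \<delta> where "\<delta> > 0"
    and "\<And>a b W t. b \<le> a + \<delta> \<Longrightarrow> trajectory_on H a b W \<Longrightarrow> W a = x1 \<Longrightarrow> t \<in> {a..b} \<Longrightarrow>
       W t \<in> ball x1 r \<and> \<phi> (W t) = 0 \<and> \<psi> (W t) = 0"
    and "\<And>a b W W' t. b \<le> a + \<delta> \<Longrightarrow> trajectory_on H a b W \<Longrightarrow> W a = x1 \<Longrightarrow>
       trajectory_on H a b W' \<Longrightarrow> W' a = x1 \<Longrightarrow> t \<in> {a..b} \<Longrightarrow> W t = W' t"
proof -
  have p: "bounded_linear p" and q: "bounded_linear q" using \<phi>(1) \<psi>(1) by (auto simp: strictly_differentiable_def)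
  note plin = bounded_linear.linear[OF p] and qlin = bounded_linear.linear[OF q]
  obtain Kp where Kp: "Kp > 0" "\<And>z. \<bar>p z\<bar> \<le> Kp * norm z" using bounded_linear_absE[OF p] by blast
  obtain Kq where Kq: "Kq > 0" "\<And>z. \<bar>q z\<bar> \<le> Kq * norm z" using bounded_linear_absE[OF q] by blast
  define K where "K = max Kp Kq"
  have K: "K > 0" "\<And>z. \<bar>p z\<bar> \<le> K * norm z" "\<And>z. \<bar>q z\<bar> \<le> K * norm z"
  proof -
    show "K > 0" using Kp by (simp add: K_def)
    show "\<bar>p z\<bar> \<le> K * norm z" "\<bar>q z\<bar> \<le> K * norm z" for z

      using Kp(2)[of z] Kq(2)[of z] mult_right_mono[of Kp K "norm z"] mult_right_mono[of Kq K "norm z"]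
      by (auto simp: K_def)
  qed
  define d where "d = p E * q F - p F * q E"
  have d: "d \<noteq> 0" using det by (simp add: d_def)
  \<comment> \<open>Cramer's rule for \<open>p (x - \<alpha> x *\<^sub>R E - \<beta> x *\<^sub>R F) = 0\<close> and \<open>q (x - \<alpha> x *\<^sub>R E - \<beta> x *\<^sub>R F) = 0\<close>\<close>
  define \<alpha> where "\<alpha> x = (q F * p x - p F * q x) / d" for x
  define \<beta> where "\<beta> x = (p E * q x - q E * p x) / d" for x
  define P where "P x = x - \<alpha> x *\<^sub>R E - \<beta> x *\<^sub>R F" for x
  have bl\<alpha>: "bounded_linear \<alpha>" "bounded_linear \<beta>"
    unfolding \<alpha>_def[abs_def] \<beta>_def[abs_def]
    by (intro bounded_linear_divide[THEN bounded_linear_compose] bounded_linear_sub bounded_linear_const_mult p q)+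
  have P: "bounded_linear P"
    unfolding P_def[abs_def]
    by (intro bounded_linear_sub bounded_linear_ident bounded_linear_scaleR_const bl\<alpha>)
  note Plin = bounded_linear.linear[OF P]
  have PE: "P E = 0" "P F = 0"
  proof -
    have "\<alpha> E = 1" "\<beta> E = 0" "\<alpha> F = 0" "\<beta> F = 1" using d by (simp_all add: \<alpha>_def \<beta>_def d_def mult.commute)
    then show "P E = 0" "P F = 0" by (simp_all add: P_def)
  qed
  obtain KP where KP: "KP > 0" "\<And>z. norm (P z) \<le> norm z * KP" using bounded_linear.pos_bounded[OF P] by blast
  define C where "C = ((\<bar>q F\<bar> + \<bar>p F\<bar>) * norm E + (\<bar>p E\<bar> + \<bar>q E\<bar>) * norm F) / \<bar>d\<bar>"
  have C: "C \<ge> 0" by (simp add: C_def)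
  have Pdiff: "norm (x - P x) \<le> C * m" if m: "\<bar>p x\<bar> \<le> m" "\<bar>q x\<bar> \<le> m" for x m
  proof -
    have m0: "m \<ge> 0" using m by linarith
    have a1: "\<bar>\<alpha> x\<bar> \<le> ((\<bar>q F\<bar> + \<bar>p F\<bar>) * m) / \<bar>d\<bar>"
    proof -
      have "\<bar>q F * p x - p F * q x\<bar> \<le> \<bar>q F\<bar> * \<bar>p x\<bar> + \<bar>p F\<bar> * \<bar>q x\<bar>"
        by (metis abs_mult abs_triangle_ineq4)
      also have "\<dots> \<le> \<bar>q F\<bar> * m + \<bar>p F\<bar> * m" using m by (intro add_mono mult_left_mono) auto
      finally show ?thesis by (simp add: \<alpha>_def abs_divide divide_right_mono distrib_right)
    qed
    have a2: "\<bar>\<beta> x\<bar> \<le> ((\<bar>p E\<bar> + \<bar>q E\<bar>) * m) / \<bar>d\<bar>"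
    proof -
      have "\<bar>p E * q x - q E * p x\<bar> \<le> \<bar>p E\<bar> * \<bar>q x\<bar> + \<bar>q E\<bar> * \<bar>p x\<bar>"
        by (metis abs_mult abs_triangle_ineq4)
      also have "\<dots> \<le> \<bar>p E\<bar> * m + \<bar>q E\<bar> * m" using m by (intro add_mono mult_left_mono) auto
      finally show ?thesis by (simp add: \<beta>_def abs_divide divide_right_mono distrib_right)
    qed
    have a3: "norm (x - P x) \<le> \<bar>\<alpha> x\<bar> * norm E + \<bar>\<beta> x\<bar> * norm F"
      using norm_triangle_ineq[of "\<alpha> x *\<^sub>R E" "\<beta> x *\<^sub>R F"] by (simp add: P_def add.commute)
    have "norm (x - P x) \<le> ((\<bar>q F\<bar> + \<bar>p F\<bar>) * m) / \<bar>d\<bar> * norm E + ((\<bar>p E\<bar> + \<bar>q E\<bar>) * m) / \<bar>d\<bar> * norm F"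

      by (rule order_trans[OF a3 add_mono[OF mult_right_mono[OF a1 norm_ge_zero] mult_right_mono[OF a2 norm_ge_zero]]])
    also have "\<dots> = C * m" by (simp add: C_def add_divide_distrib distrib_left distrib_right mult_ac)
    finally show ?thesis .
  qed
  define \<theta> where "\<theta> = min 1 (\<eta> / (2 * K))"
  have \<theta>: "\<theta> > 0" "\<theta> \<le> 1" "K * \<theta> \<le> \<eta> / 2"
  proof -
    have "K * \<theta> \<le> K * (\<eta> / (2 * K))" using K(1) by (intro mult_left_mono) (auto simp: \<theta>_def)
    then show "K * \<theta> \<le> \<eta> / 2" using K(1) by simp
  qed (use \<eta> K(1) in \<open>auto simp: \<theta>_def\<close>)
  \<comment> \<open>The first bound on \<open>\<epsilon>\<close> serves invariance of the surfaces, the second one uniqueness.\<close>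
  define \<epsilon> where "\<epsilon> = min (\<eta> / (2 * (B + 1))) (1 / (2 * (C + 1)))"
  have \<epsilon>: "\<epsilon> > 0" "\<epsilon> * (B + \<theta>) \<le> \<eta> / 2" "C * \<epsilon> \<le> 1 / 2"
  proof -
    show e0: "\<epsilon> > 0" using \<eta> B C by (auto simp: \<epsilon>_def intro!: divide_pos_pos)
    have "\<epsilon> * (B + \<theta>) \<le> (\<eta> / (2 * (B + 1))) * (B + 1)"
      using e0 B \<theta> by (intro mult_mono) (auto simp: \<epsilon>_def)
    also have "\<dots> = \<eta> / 2" using B by (simp add: field_simps)
    finally show "\<epsilon> * (B + \<theta>) \<le> \<eta> / 2" .
    have "C * \<epsilon> \<le> (C + 1) * (1 / (2 * (C + 1)))" using e0 C by (intro mult_mono) (auto simp: \<epsilon>_def)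
    also have "\<dots> = 1 / 2" using C by (simp add: field_simps)
    finally show "C * \<epsilon> \<le> 1 / 2" .
  qed
  have \<theta>\<epsilon>: "K * \<theta> + \<epsilon> * (B + \<theta>) \<le> \<eta>" using \<theta>(3) \<epsilon>(2) by linarith
  obtain r1 where r1: "r1 > 0" "\<And>x y. x \<in> ball x1 r1 \<Longrightarrow> y \<in> ball x1 r1 \<Longrightarrow> \<bar>\<phi> y - \<phi> x - p (y - x)\<bar> \<le> \<epsilon> * norm (y - x)"
    using strictly_differentiableD[OF \<phi>(1) \<epsilon>(1)] by blast
  obtain r2 where r2: "r2 > 0" "\<And>x y. x \<in> ball x1 r2 \<Longrightarrow> y \<in> ball x1 r2 \<Longrightarrow> \<bar>\<psi> y - \<psi> x - q (y - x)\<bar> \<le> \<epsilon> * norm (y - x)"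
    using strictly_differentiableD[OF \<psi>(1) \<epsilon>(1)] by blast
  define \<rho> where "\<rho> = min r (min r1 r2)"
  have \<rho>: "\<rho> > 0" "ball x1 \<rho> \<subseteq> ball x1 r" "ball x1 \<rho> \<subseteq> ball x1 r1" "ball x1 \<rho> \<subseteq> ball x1 r2"
    using r r1 r2 by (auto simp: \<rho>_def)
  define U where "U = ball x1 \<rho>"
  have UHB: "\<And>x v. x \<in> U \<Longrightarrow> v \<in> H x \<Longrightarrow> norm v \<le> B" using HB \<rho>(2) by (auto simp: U_def)
  have sd\<phi>: "\<And>x y. x \<in> U \<Longrightarrow> y \<in> U \<Longrightarrow> \<bar>\<phi> y - \<phi> x - p (y - x)\<bar> \<le> \<epsilon> * norm (y - x)"
    using r1(2) \<rho>(3) unfolding U_def by blast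
  have sd\<psi>: "\<And>x y. x \<in> U \<Longrightarrow> y \<in> U \<Longrightarrow> \<bar>\<psi> y - \<psi> x - q (y - x)\<bar> \<le> \<epsilon> * norm (y - x)"
    using r2(2) \<rho>(4) unfolding U_def by blast
  \<comment> \<open>The first bound on \<open>\<delta>\<close> confines trajectories to \<open>U\<close>, the second one makes the final estimate a
contraction.\<close>
  define \<delta> where "\<delta> = min (\<rho> / (2 * B)) (1 / (4 * (KP * L + 1)))"
  have \<delta>: "\<delta> > 0" "B * \<delta> < \<rho>" "2 * (KP * L) * \<delta> < 1"
  proof -
    have kl: "KP * L \<ge> 0" using KP f(2) by simp
    show d0: "\<delta> > 0" using \<rho>(1) B kl by (auto simp: \<delta>_def intro!: divide_pos_pos add_nonneg_pos)
    have "B * \<delta> \<le> B * (\<rho> / (2 * B))" using B by (intro mult_left_mono) (auto simp: \<delta>_def)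
    also have "\<dots> < \<rho>" using B \<rho>(1) by simp
    finally show "B * \<delta> < \<rho>" .
    have "2 * (KP * L) * \<delta> \<le> 2 * (KP * L + 1) * (1 / (4 * (KP * L + 1)))"
      using kl d0 by (intro mult_mono) (auto simp: \<delta>_def)
    also have "\<dots> < 1" using kl by (simp add: field_simps)
    finally show "2 * (KP * L) * \<delta> < 1" .
  qed
  have slide: "W t \<in> U \<and> \<phi> (W t) = 0 \<and> \<psi> (W t) = 0"
    if ab: "b \<le> a + \<delta>" and tr: "trajectory_on H a b W" and Wa: "W a = x1" and t: "t \<in> {a..b}" for a b W t
  proof -
    have "B * (b - a) \<le> B * \<delta>" using ab B by (intro mult_left_mono) auto
    then have Bab: "B * (b - a) < \<rho>" using \<delta>(2) by linarith
    have WU: "W s \<in> U" if "s \<in> {a..b}" for s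
      using trajectory_confined[OF tr _ Bab \<rho>(1) _ that] B UHB unfolding Wa U_def by auto
    \<comment> \<open>This is applied to \<open>\<phi>\<close>, \<open>\<psi>\<close> and to their negatives.\<close>
    have *: "\<xi> (W t) \<le> 0"
      if "\<xi> x1 = 0" and cq: "bounded_linear cq" "\<And>z. \<bar>cq z\<bar> \<le> K * norm z"
        and sd: "\<And>x y. x \<in> U \<Longrightarrow> y \<in> U \<Longrightarrow> \<bar>\<xi> y - \<xi> x - cq (y - x)\<bar> \<le> \<epsilon> * norm (y - x)"
        and H: "\<And>x v. x \<in> U \<Longrightarrow> v \<in> H x \<Longrightarrow> \<xi> x > 0 \<Longrightarrow> cq v \<le> - \<eta>" for \<xi> cq
      by (rule trajectory_stays_below[OF tr _ UHB H cq \<theta>(1) \<theta>\<epsilon> _ _ sd WU t])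
        (use that(1) Wa \<epsilon>(1) K(1) in auto)
    have "\<phi> (W t) \<le> 0" by (rule *[OF \<phi>(2) p K(2) sd\<phi>]) (use H1 \<rho>(2) in \<open>auto simp: U_def\<close>)
    moreover have "\<psi> (W t) \<le> 0" by (rule *[OF \<psi>(2) q K(3) sd\<psi>]) (use H3 \<rho>(2) in \<open>auto simp: U_def\<close>)
    moreover have "- \<phi> (W t) \<le> 0"
    proof (rule *[where cq = "\<lambda>v. - p v"])
      show "\<bar>- \<phi> y - - \<phi> x - - p (y - x)\<bar> \<le> \<epsilon> * norm (y - x)" if "x \<in> U" "y \<in> U" for x y
        using sd\<phi>[OF that] by linarith
      show "- p v \<le> - \<eta>" if "x \<in> U" "v \<in> H x" "- \<phi> x > 0" for x v
        using H2[of x v] that \<rho>(2) by (auto simp: U_def)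
    qed (use \<phi>(2) K(2) p in \<open>auto intro: bounded_linear_minus\<close>)
    moreover have "- \<psi> (W t) \<le> 0"
    proof (rule *[where cq = "\<lambda>v. - q v"])
      show "\<bar>- \<psi> y - - \<psi> x - - q (y - x)\<bar> \<le> \<epsilon> * norm (y - x)" if "x \<in> U" "y \<in> U" for x y
        using sd\<psi>[OF that] by linarith
      show "- q v \<le> - \<eta>" if "x \<in> U" "v \<in> H x" "- \<psi> x > 0" for x v
        using H4[of x v] that \<rho>(2) by (auto simp: U_def)
    qed (use \<psi>(2) K(3) q in \<open>auto intro: bounded_linear_minus\<close>)
    ultimately show ?thesis using WU[OF t] by auto
  qed
  have unique: "W t = W' t"
    if ab2: "b \<le> a + \<delta>" and tr: "trajectory_on H a b W" and Wa: "W a = x1"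
      and tr': "trajectory_on H a b W'" and Wa': "W' a = x1" and t: "t \<in> {a..b}" for a b W W' t
  proof -
    have ab: "a \<le> b" "b \<le> a + \<delta>" using t ab2 by auto
    note ac = trajectory_onD(1)[OF tr] and ae = trajectory_onD(2)[OF tr]
    note ac' = trajectory_onD(1)[OF tr'] and ae' = trajectory_onD(2)[OF tr']
    note sl = slide[OF ab(2) tr Wa] and sl' = slide[OF ab(2) tr' Wa']
    define D where "D s = W s - W' s" for s
    have Dcont: "continuous_on {a..b} D"
      unfolding D_def by (intro continuous_intros absolutely_continuous_fun_on_imp_continuous ac ac')
    have two: "norm (D s) \<le> 2 * norm (P (D s))" if s: "s \<in> {a..b}" for s
    proof -
      have "\<bar>p (D s)\<bar> \<le> \<epsilon> * norm (D s)" "\<bar>q (D s)\<bar> \<le> \<epsilon> * norm (D s)"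
        using sd\<phi>[of "W' s" "W s"] sd\<psi>[of "W' s" "W s"] sl[OF s] sl'[OF s] by (auto simp: D_def)
      then have "norm (D s - P (D s)) \<le> C * (\<epsilon> * norm (D s))" by (rule Pdiff)
      also have "\<dots> = (C * \<epsilon>) * norm (D s)" by simp
      also have "\<dots> \<le> (1 / 2) * norm (D s)" using \<epsilon>(3) by (intro mult_right_mono) auto
      finally show ?thesis using norm_triangle_ineq2[of "D s" "P (D s)"] by linarith
    qed
    obtain s where s: "s \<in> {a..b}" "\<And>x. x \<in> {a..b} \<Longrightarrow> norm (D x) \<le> norm (D s)"
      using continuous_attains_sup[of "{a..b}" "\<lambda>s. norm (D s)"] Dcont ab by (force intro: continuous_intros)
    define m where "m = norm (D s)"
    have m: "m \<ge> 0" by (simp add: m_def)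
    have "norm (P (D s) - P (D a)) \<le> (KP * L * m) * (s - a)"
    proof (rule absolutely_continuous_speed_bound[where f = "\<lambda>s. P (D s)"])
      show "absolutely_continuous_fun_on {a..s} (\<lambda>s. P (D s))"
      proof (rule absolutely_continuous_fun_on_dominated[OF absolutely_continuous_fun_on_subset[OF ac] absolutely_continuous_fun_on_subset[OF ac']])
        fix s1 s2
        have "norm (P (D s2) - P (D s1)) = norm (P (D s2 - D s1))" by (simp add: linear_diff[OF Plin])
        also have "\<dots> \<le> norm (D s2 - D s1) * KP" by (rule KP(2))
        also have "D s2 - D s1 = (W s2 - W s1) - (W' s2 - W' s1)" by (simp add: D_def)
        also have "norm \<dots> * KP \<le> (norm (W s2 - W s1) + norm (W' s2 - W' s1)) * KP"
          using KP(1) by (intro mult_right_mono norm_triangle_ineq4) auto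
        finally show "norm (P (D s2) - P (D s1)) \<le> KP * (norm (W s2 - W s1) + norm (W' s2 - W' s1))" by (simp add: mult.commute)
      qed (use s KP(1) in auto)
      show "AE t in lebesgue. t \<in> {a<..<s} \<longrightarrow> (\<exists>v. ((\<lambda>s. P (D s)) has_vector_derivative v) (at t within {a..s}) \<and> norm v \<le> KP * L * m)"
        using ae ae'
      proof eventually_elim
        case (elim t)
        show ?case
        proof
          assume t: "t \<in> {a<..<s}"
          then have tab: "t \<in> {a<..<b}" "t \<in> {a..b}" using s by auto
          obtain v where v: "v \<in> H (W t)" "(W has_vector_derivative v) (at t within {a..b})" using elim(1) tab by blast
          obtain v' where v': "v' \<in> H (W' t)" "(W' has_vector_derivative v') (at t within {a..b})" using elim(2) tab by blast
          have in_r: "W t \<in> ball x1 r" "W' t \<in> ball x1 r" using sl[OF tab(2)] sl'[OF tab(2)] \<rho>(2) by (auto simp: U_def)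
          obtain \<alpha>1 \<beta>1 where e1: "v = f (W t) + \<alpha>1 *\<^sub>R E + \<beta>1 *\<^sub>R F" using H0[OF in_r(1) v(1)] sl[OF tab(2)] by blast
          obtain \<alpha>2 \<beta>2 where e2: "v' = f (W' t) + \<alpha>2 *\<^sub>R E + \<beta>2 *\<^sub>R F" using H0[OF in_r(2) v'(1)] sl'[OF tab(2)] by blast
          have "P v = P (f (W t))" "P v' = P (f (W' t))"
            unfolding e1 e2 by (simp_all add: linear_add[OF Plin] linear_scale[OF Plin] PE)
          then have Pv: "P (v - v') = P (f (W t) - f (W' t))" by (simp add: linear_diff[OF Plin])
          have "norm (P (v - v')) \<le> norm (f (W t) - f (W' t)) * KP" unfolding Pv by (rule KP(2))
          also have "\<dots> \<le> (L * norm (W t - W' t)) * KP" using f(1)[OF in_r] KP(1) by (intro mult_right_mono) auto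
          also have "\<dots> \<le> (L * m) * KP" using s(2)[OF tab(2)] f(2) KP(1) by (intro mult_right_mono mult_left_mono) (auto simp: D_def m_def)
          finally have nb: "norm (P (v - v')) \<le> KP * L * m" by (simp add: mult_ac)
          have "(D has_vector_derivative (v - v')) (at t within {a..b})"
            unfolding D_def[abs_def] by (rule has_vector_derivative_diff[OF v(2) v'(2)])
          then have "((\<lambda>s. P (D s)) has_vector_derivative P (v - v')) (at t within {a..b})"
            by (rule bounded_linear.has_vector_derivative[OF P])
          then have "((\<lambda>s. P (D s)) has_vector_derivative P (v - v')) (at t within {a..s})"
            by (rule has_vector_derivative_within_subset) (use s in auto)
          with nb show "\<exists>v. ((\<lambda>s. P (D s)) has_vector_derivative v) (at t within {a..s}) \<and> norm v \<le> KP * L * m" by blast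
        qed
      qed
    qed (use s in auto)
    moreover have "P (D a) = 0" by (simp add: D_def Wa Wa' linear_0[OF Plin])
    ultimately have "norm (P (D s)) \<le> (KP * L * m) * (s - a)" by simp
    also have "\<dots> \<le> (KP * L * m) * \<delta>" using s ab m KP(1) f(2) by (intro mult_left_mono) auto
    finally have "m \<le> 2 * ((KP * L * m) * \<delta>)" using two[OF s(1)] by (simp add: m_def)
    then have "m * (1 - 2 * (KP * L) * \<delta>) \<le> 0" by (simp add: algebra_simps)
    then have "m = 0" using m \<delta>(3) by (simp add: mult_le_0_iff)
    then have "norm (D t) \<le> 0" using s(2)[OF t] by (simp add: m_def)
    then show ?thesis by (simp add: D_def)
  qed
  show thesis
  proof (rule that[OF \<delta>(1)])
    fix a b W t
    assume "b \<le> a + \<delta>" "trajectory_on H a b W" "W a = x1" "t \<in> {a..b}"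
    then have "W t \<in> U \<and> \<phi> (W t) = 0 \<and> \<psi> (W t) = 0" by (rule slide)
    then show "W t \<in> ball x1 r \<and> \<phi> (W t) = 0 \<and> \<psi> (W t) = 0" using \<rho>(2) by (auto simp: U_def)
  qed (rule unique)
qed

section \<open>Glide directions near an ambiguous configuration\<close>

lemma glide_set_eq: "glide_set G j l Z = {g \<in> G. \<forall>g'\<in>G. j l Z \<bullet> g' \<le> j l Z \<bullet> g}"
  by (auto simp: glide_set_def is_arg_max_linorder)

lemma glide_set_nonempty:
  assumes "finite G" "G \<noteq> {}"
  shows "glide_set G j l Z \<noteq> {}"
proof -
  define M where "M = Max ((\<lambda>g. j l Z \<bullet> g) ` G)"
  have "M \<in> (\<lambda>g. j l Z \<bullet> g) ` G" unfolding M_def using assms by (intro Max_in) auto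
  then obtain g where "g \<in> G" "j l Z \<bullet> g = M" by auto
  moreover have "j l Z \<bullet> g' \<le> M" if "g' \<in> G" for g' unfolding M_def using assms that by (intro Max_ge) auto
  ultimately show ?thesis by (auto simp: glide_set_eq)
qed

text \<open>The finitely many strict inequalities that exclude a direction at \<open>Z1\<close> persist near \<open>Z1\<close>.\<close>

lemma glide_set_upper_semicontinuous:
  assumes G: "finite G" "G \<noteq> {}" and j: "isCont (j l) Z1"
  shows "eventually (\<lambda>Z. glide_set G j l Z \<subseteq> glide_set G j l Z1) (nhds Z1)"
proof -
  obtain g0 where g0: "g0 \<in> glide_set G j l Z1" using glide_set_nonempty[OF G] by blast
  have "eventually (\<lambda>Z. \<forall>g\<in>G - glide_set G j l Z1. j l Z \<bullet> g < j l Z \<bullet> g0) (nhds Z1)"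
  proof (intro eventually_ball_finite ballI)
    fix g assume g: "g \<in> G - glide_set G j l Z1"
    then have "j l Z1 \<bullet> g < j l Z1 \<bullet> g0" using g0 by (force simp: glide_set_eq not_le)
    then have 0: "0 < j l Z1 \<bullet> g0 - j l Z1 \<bullet> g" by simp
    have "((\<lambda>Z. j l Z \<bullet> g0 - j l Z \<bullet> g) \<longlongrightarrow> j l Z1 \<bullet> g0 - j l Z1 \<bullet> g) (nhds Z1)"
      using j unfolding isCont_def tendsto_at_iff_tendsto_nhds by (intro tendsto_intros)
    from order_tendstoD(1)[OF this 0] show "eventually (\<lambda>Z. j l Z \<bullet> g < j l Z \<bullet> g0) (nhds Z1)" by simp
  qed (use G in auto)
  then show ?thesis
  proof eventually_elim
    case (elim Z)
    show ?case
    proof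
      fix g assume g: "g \<in> glide_set G j l Z"
      show "g \<in> glide_set G j l Z1"
      proof (rule ccontr)
        assume "g \<notin> glide_set G j l Z1"
        then have "j l Z \<bullet> g < j l Z \<bullet> g0" using elim g by (auto simp: glide_set_eq)
        moreover have "j l Z \<bullet> g0 \<le> j l Z \<bullet> g" using g g0 by (auto simp: glide_set_eq)
        ultimately show False by simp
      qed
    qed
  qed
qed

text \<open>A line meets the unit circle in at most two points.\<close>

lemma unit_vectors_same_projection:
  fixes v g1 g2 g3 :: plane
  assumes v: "v \<noteq> 0" and n: "norm g1 = 1" "norm g2 = 1" "norm g3 = 1"
    and e: "v \<bullet> g1 = v \<bullet> g2" "v \<bullet> g1 = v \<bullet> g3" and d: "g1 \<noteq> g2" "g1 \<noteq> g3"
  shows "g2 = g3"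
proof -
  define a b where "a = g1 - g2" and "b = g1 - g3"
  have "v \<bullet> a = 0" "v \<bullet> b = 0" using e by (simp_all add: a_def b_def inner_diff_right)
  then have "a \<bullet> v = 0" "b \<bullet> v = 0" by (simp_all add: inner_commute)
  then have c: "cross2 a b = 0" using cross2_orthogonal v by blast
  have gg: "g1 \<bullet> g1 = 1" "g2 \<bullet> g2 = 1" "g3 \<bullet> g3 = 1" using n by (simp_all add: dot_square_norm)
  have aa: "a \<bullet> a = 2 * (a \<bullet> g1)" "b \<bullet> b = 2 * (b \<bullet> g1)"
    using gg by (simp_all add: a_def b_def inner_diff_left inner_diff_right inner_commute)
  have a0: "a \<bullet> a \<noteq> 0" "b \<bullet> b \<noteq> 0" using d by (simp_all add: a_def b_def)
  have "(a \<bullet> a) *\<^sub>R b = (a \<bullet> b) *\<^sub>R a"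
  proof -
    have "((a \<bullet> a) *\<^sub>R b) $ 1 - ((a \<bullet> b) *\<^sub>R a) $ 1 = - (a $ 2 * cross2 a b)"
      "((a \<bullet> a) *\<^sub>R b) $ 2 - ((a \<bullet> b) *\<^sub>R a) $ 2 = a $ 1 * cross2 a b"
      by (simp_all add: inner_vec_def sum_2 cross2_def algebra_simps)
    then show ?thesis using c by (simp add: vec_eq_iff forall_2)
  qed
  then have "(1 / (a \<bullet> a)) *\<^sub>R ((a \<bullet> a) *\<^sub>R b) = (1 / (a \<bullet> a)) *\<^sub>R ((a \<bullet> b) *\<^sub>R a)" by simp
  then have b: "b = ((a \<bullet> b) / (a \<bullet> a)) *\<^sub>R a" using a0 by simp
  define t where "t = (a \<bullet> b) / (a \<bullet> a)"
  have bt: "b = t *\<^sub>R a" using b by (simp add: t_def)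
  have t0: "t \<noteq> 0" using bt a0 by auto
  have "b \<bullet> b = t * (t * (a \<bullet> a))" "b \<bullet> g1 = t * (a \<bullet> g1)" unfolding bt by simp_all
  then have "t * (t * (a \<bullet> a)) = t * (a \<bullet> a)" using aa by simp
  then have "t = 1" using t0 a0 by simp
  then show ?thesis using bt by (simp add: a_def b_def)
qed

lemma glide_set_singleton:
  assumes G: "finite G" "G \<noteq> {}" "\<And>g. g \<in> G \<Longrightarrow> norm g = 1" and j: "j l Z \<noteq> 0" and c: "card (glide_set G j l Z) \<noteq> 2"
  shows "\<exists>g. glide_set G j l Z = {g}"
proof (rule ccontr)
  assume no: "\<nexists>g. glide_set G j l Z = {g}"
  obtain g1 where g1: "g1 \<in> glide_set G j l Z" using glide_set_nonempty[OF G(1,2)] by blast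
  with no obtain g2 where g2: "g2 \<in> glide_set G j l Z" "g2 \<noteq> g1" by blast
  have "glide_set G j l Z = {g1, g2}"
  proof (rule ccontr)
    assume "glide_set G j l Z \<noteq> {g1, g2}"
    then obtain g3 where g3: "g3 \<in> glide_set G j l Z" "g3 \<noteq> g1" "g3 \<noteq> g2" using g1 g2 by blast
    have "j l Z \<bullet> g1 = j l Z \<bullet> g2" "j l Z \<bullet> g1 = j l Z \<bullet> g3"
      using g1 g2 g3 by (auto simp: glide_set_eq intro: antisym)
    then have "g2 = g3"
      using unit_vectors_same_projection[OF j, of g1 g2 g3] G(3) g1 g2 g3 by (auto simp: glide_set_eq)
    with g3 show False by simp
  qed
  with c g2 show False by simp
qed

lemma glide_set_two_directions:
  assumes G: "finite G" "G \<noteq> {}" and sub: "glide_set G j l Z \<subseteq> {gp, gm}" and g: "gp \<in> G" "gm \<in> G"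
  shows "j l Z \<bullet> (gp - gm) > 0 \<Longrightarrow> glide_set G j l Z = {gp}"
    "j l Z \<bullet> (gp - gm) < 0 \<Longrightarrow> glide_set G j l Z = {gm}"
    "j l Z \<bullet> (gp - gm) = 0 \<Longrightarrow> glide_set G j l Z = {gp, gm}"
proof -
  note ne = glide_set_nonempty[OF G, of j l Z]
  show "glide_set G j l Z = {gp}" if "j l Z \<bullet> (gp - gm) > 0"
  proof -
    have "gm \<notin> glide_set G j l Z" using that g by (force simp: glide_set_eq inner_diff_right)
    then show ?thesis using sub ne by blast
  qed
  show "glide_set G j l Z = {gm}" if "j l Z \<bullet> (gp - gm) < 0"
  proof -
    have "gp \<notin> glide_set G j l Z" using that g by (force simp: glide_set_eq inner_diff_right)
    then show ?thesis using sub ne by blast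
  qed
  show "glide_set G j l Z = {gp, gm}" if "j l Z \<bullet> (gp - gm) = 0"
  proof -
    have "gp \<in> glide_set G j l Z \<longleftrightarrow> gm \<in> glide_set G j l Z" using that g by (simp add: glide_set_eq inner_diff_right)
    then show ?thesis using sub ne by blast
  qed
qed

text \<open>Near \<open>Z1\<close> the zero set of \<open>\<phi> = (\<lambda>Z. j m Z \<bullet> (gp - gm))\<close> is contained in the ambiguity set, and
nonsingularity of \<open>Z1\<close> says that the gradient of \<open>\<phi>\<close> does not vanish there, so
\<open>normal_of_C11_hypersurface\<close> applies.\<close>

lemma ambiguity_surface_normal:
  fixes j :: "'n::finite \<Rightarrow> plane^'n \<Rightarrow> plane"
  assumes G: "finite G" "G \<noteq> {}" and amb: "Z1 \<in> ambiguity_set \<Omega> G j m" and sing: "Z1 \<notin> singular_set \<Omega> G j m"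
    and gl: "glide_set G j m Z1 = {gp, gm}" and \<nu>: "ambiguity_normal \<Omega> G j m Z1 gp gm \<nu>"
    and r: "r > 0" "ball Z1 r \<subseteq> configurations \<Omega>" and C11: "uniformly_C11 {()} (ball Z1 r) (\<lambda>_. j m)"
  shows "\<exists>c>0. strictly_differentiable (\<lambda>Z. j m Z \<bullet> (gp - gm)) (\<lambda>v. c * (v \<bullet> \<nu>)) Z1"
proof -
  have gpm: "gp \<noteq> gm" using amb gl by (auto simp: ambiguity_set_def)
  have gG: "gp \<in> G" "gm \<in> G" using gl by (auto simp: glide_set_eq)
  define \<phi> where "\<phi> Z = j m Z \<bullet> (gp - gm)" for Z
  have "uniformly_C11 {()} (ball Z1 r) (\<lambda>_. \<phi>)"
    unfolding \<phi>_def[abs_def]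
    by (rule uniformly_C11_compose_linear[OF C11 convex_ball bounded_linear_inner_left])
  moreover have "isCont (j m) Z1"
  proof -
    obtain j' B where "C11_data {()} (ball Z1 r) (\<lambda>_. j m) j' B" using uniformly_C11E[OF C11 convex_ball] by blast
    from C11_dataD(2)[OF this, of "()" Z1] r(1) show ?thesis by (auto intro: has_derivative_continuous)
  qed
  from glide_set_upper_semicontinuous[where j = j and l = m and ?Z1.0 = Z1, OF G this] obtain r1 where r1: "r1 > 0"
    "\<And>Z. dist Z Z1 < r1 \<Longrightarrow> glide_set G j m Z \<subseteq> {gp, gm}"
    unfolding eventually_nhds_metric gl by blast
  define \<rho> where "\<rho> = min r r1"
  have \<rho>: "\<rho> > 0" "ball Z1 \<rho> \<subseteq> ball Z1 r" using r r1 by (auto simp: \<rho>_def)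
  have sub: "glide_set G j m Z \<subseteq> {gp, gm}" if "Z \<in> ball Z1 \<rho>" for Z
    using r1(2)[of Z] that by (simp add: \<rho>_def dist_commute)
  ultimately have "uniformly_C11 {()} (ball Z1 \<rho>) (\<lambda>_. \<phi>)" using uniformly_C11_subset \<rho>(2) by blast
  then obtain \<phi>'' B where "C11_data {()} (ball Z1 \<rho>) (\<lambda>_. \<phi>) \<phi>'' B" using uniformly_C11E[OF _ convex_ball] by blast
  then have D: "C11_data {()} (ball Z1 \<rho>) (\<lambda>_. \<phi>) (\<lambda>_. \<phi>'' ()) B" by (simp add: C11_data_def)
  have z: "\<phi> Z1 = 0"
  proof -
    have "gp \<in> glide_set G j m Z1" "gm \<in> glide_set G j m Z1" using gl by auto
    then show ?thesis by (auto simp: \<phi>_def inner_diff_right glide_set_eq intro: antisym)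
  qed
  have nz: "\<phi>'' () Z1 \<noteq> (\<lambda>v. 0)"
  proof
    assume "\<phi>'' () Z1 = (\<lambda>v. 0)"
    then have "(\<phi> has_derivative (\<lambda>v. 0)) (at Z1)" using C11_data_singleD(2)[OF D, of Z1] \<rho>(1) by simp
    then have "GDERIV \<phi> Z1 :> 0" by (simp add: gderiv_def)
    then show False using sing amb gl gpm z unfolding singular_set_def \<phi>_def by blast
  qed
  have A: "x \<in> ambiguity_set \<Omega> G j m" if "x \<in> ball Z1 \<rho>" "\<phi> x = 0" for x
  proof -
    have "glide_set G j m x = {gp, gm}"
      using glide_set_two_directions(3)[OF G sub[OF that(1)] gG] that(2) by (simp add: \<phi>_def)
    then show ?thesis using that(1) \<rho>(2) r(2) gpm by (auto simp: ambiguity_set_def)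
  qed
  obtain h where h: "h > 0" "\<And>s. s\<in>{0<..<h} \<Longrightarrow> Z1 + s *\<^sub>R \<nu> \<in> side_region G j m Z1 h gp"
    and \<nu>1: "norm \<nu> = 1" "\<forall>v \<in> tangent_vectors (ambiguity_set \<Omega> G j m) Z1. v \<bullet> \<nu> = 0"
    using \<nu> unfolding ambiguity_normal_def by blast
  have pos: "\<phi> (Z1 + s *\<^sub>R \<nu>) > 0" if "0 < s" "s < h" for s
  proof -
    have "glide_set G j m (Z1 + s *\<^sub>R \<nu>) = {gp}" using h(2)[of s] that by (simp add: side_region_def)
    then have "gp \<in> glide_set G j m (Z1 + s *\<^sub>R \<nu>)" "gm \<notin> glide_set G j m (Z1 + s *\<^sub>R \<nu>)" using gpm by auto
    then show ?thesis using gG by (force simp: \<phi>_def inner_diff_right glide_set_eq)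
  qed
  obtain c where c: "c > 0" "\<And>v. \<phi>'' () Z1 v = c * (v \<bullet> \<nu>)"
    using normal_of_C11_hypersurface[OF \<rho>(1) D z nz A \<nu>1 h(1) pos] by blast
  have "strictly_differentiable \<phi> (\<phi>'' () Z1) Z1" by (rule C11_data_strictly_differentiable[OF \<rho>(1) D])
  moreover have "\<phi>'' () Z1 = (\<lambda>v. c * (v \<bullet> \<nu>))" using c(2) by blast
  ultimately show ?thesis using c(1) unfolding \<phi>_def[abs_def] by auto
qed

text \<open>A list lets finitely many unrelated strict inequalities be treated at once.\<close>

lemma eventually_uniformly_negative:
  fixes Fs :: "('a::t2_space \<Rightarrow> real) list"
  assumes "\<And>F. F \<in> set Fs \<Longrightarrow> isCont F x \<and> F x < 0"
  shows "\<exists>\<eta>>0. eventually (\<lambda>y. \<forall>F\<in>set Fs. F y \<le> - \<eta>) (nhds x)"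
  using assms
proof (induction Fs)
  case Nil
  then show ?case by (auto intro: exI[of _ 1])
next
  case (Cons F Fs)
  then obtain \<eta> where \<eta>: "\<eta> > 0" "eventually (\<lambda>y. \<forall>F\<in>set Fs. F y \<le> - \<eta>) (nhds x)" by auto
  have F: "isCont F x" "F x < 0" using Cons.prems[of F] by auto
  have "(F \<longlongrightarrow> F x) (nhds x)" using F(1) unfolding isCont_def tendsto_at_iff_tendsto_nhds .
  then have "eventually (\<lambda>y. F y < F x / 2) (nhds x)" using F(2) by (intro order_tendstoD(2)) auto
  with \<eta>(2) have "eventually (\<lambda>y. \<forall>F'\<in>set (F # Fs). F' y \<le> - min \<eta> (- F x / 2)) (nhds x)"
    by eventually_elim (auto simp: min_def intro: order_trans)
  then show ?case using \<eta>(1) F(2) by (intro exI[of _ "min \<eta> (- F x / 2)"]) auto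
qed

text \<open>The numbers \<open>p0 + s * a + t * b\<close> and \<open>q0 + s * c + t * d\<close>, for \<open>s\<close> and \<open>t\<close> in \<open>{0, 1}\<close>, are the normal
components of the four local fields. Their signs imply \<open>\<bar>b\<bar> < - a\<close> and \<open>\<bar>c\<bar> < - d\<close>, so the matrix is
diagonally dominant.\<close>

lemma sliding_determinant:
  fixes a b c d p0 q0 :: real
  assumes "p0 + a + b < 0" "q0 + c + d < 0" "p0 + a < 0" "q0 + c > 0" "p0 + b > 0" "q0 + d < 0" "p0 > 0" "q0 > 0"
  shows "a * d - b * c \<noteq> 0"
proof -
  have "\<bar>b\<bar> < - a" "\<bar>c\<bar> < - d" using assms by linarith+
  then have "\<bar>b\<bar> * \<bar>c\<bar> < (- a) * (- d)" by (intro mult_strict_mono') auto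
  then have "\<bar>b * c\<bar> < a * d" by (simp add: abs_mult)
  then show ?thesis by linarith
qed

lemma local_field_nth:
  "local_field G j k l Z1 gk gl Z $ i =
    (j i Z \<bullet> (if i = k then gk else if i = l then gl else the_elem (glide_set G j i Z1))) *\<^sub>R
     (if i = k then gk else if i = l then gl else the_elem (glide_set G j i Z1))"
  by (simp add: local_field_def Let_def)

lemma isCont_local_field:
  assumes "\<And>i. isCont (j i) Z1"
  shows "isCont (local_field G j k l Z1 gk gl) Z1"
  unfolding isCont_def
proof (rule vec_tendstoI)
  fix i
  show "((\<lambda>Z. local_field G j k l Z1 gk gl Z $ i) \<longlongrightarrow> local_field G j k l Z1 gk gl Z1 $ i) (at Z1)"
    unfolding local_field_nth using assms[unfolded isCont_def] by (intro tendsto_intros)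
qed

lemma local_field_Lipschitz:
  fixes j :: "'n::finite \<Rightarrow> plane^'n \<Rightarrow> plane"
  assumes "\<And>i x y. x \<in> U \<Longrightarrow> y \<in> U \<Longrightarrow> norm (j i x - j i y) \<le> B i * norm (x - y)" "\<And>i. B i > 0"
  shows "\<exists>L\<ge>0. \<forall>x\<in>U. \<forall>y\<in>U. norm (local_field G j k l Z1 gk gl x - local_field G j k l Z1 gk gl y) \<le> L * norm (x - y)"
proof -
  define g where "g i = (if i = k then gk else if i = l then gl else the_elem (glide_set G j i Z1))" for i
  have nth: "local_field G j k l Z1 gk gl x $ i = (j i x \<bullet> g i) *\<^sub>R g i" for x i
    by (simp add: local_field_nth g_def)
  define L where "L = (\<Sum>i\<in>UNIV. B i * (norm (g i) * norm (g i)))"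
  have "norm (local_field G j k l Z1 gk gl x - local_field G j k l Z1 gk gl y) \<le> L * norm (x - y)" if xy: "x \<in> U" "y \<in> U" for x y
  proof -
    have "norm (local_field G j k l Z1 gk gl x - local_field G j k l Z1 gk gl y)
       \<le> (\<Sum>i\<in>UNIV. norm ((local_field G j k l Z1 gk gl x - local_field G j k l Z1 gk gl y) $ i))"
      unfolding norm_vec_def by (rule L2_set_le_sum) simp
    also have "\<dots> \<le> (\<Sum>i\<in>UNIV. B i * (norm (g i) * norm (g i)) * norm (x - y))"
    proof (rule sum_mono)
      fix i
      have "(local_field G j k l Z1 gk gl x - local_field G j k l Z1 gk gl y) $ i = ((j i x - j i y) \<bullet> g i) *\<^sub>R g i"
        by (simp add: nth inner_diff_left scaleR_diff_left)
      then have "norm ((local_field G j k l Z1 gk gl x - local_field G j k l Z1 gk gl y) $ i) = \<bar>(j i x - j i y) \<bullet> g i\<bar> * norm (g i)" by simp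
      also have "\<dots> \<le> (norm (j i x - j i y) * norm (g i)) * norm (g i)"
        by (intro mult_right_mono Cauchy_Schwarz_ineq2) auto
      also have "\<dots> \<le> ((B i * norm (x - y)) * norm (g i)) * norm (g i)"
        using assms(1)[OF xy] by (intro mult_right_mono) auto
      finally show "norm ((local_field G j k l Z1 gk gl x - local_field G j k l Z1 gk gl y) $ i) \<le> B i * (norm (g i) * norm (g i)) * norm (x - y)"
        by (simp add: mult_ac)
    qed
    also have "\<dots> = L * norm (x - y)" by (simp add: L_def sum_distrib_right)
    finally show ?thesis .
  qed
  moreover have "L \<ge> 0" unfolding L_def using assms(2) by (intro sum_nonneg mult_nonneg_nonneg) (auto intro: less_imp_le)
  ultimately show ?thesis by blast
qed

text \<open>On an ambiguity surface the fields on its two sides have the same speed, so their difference has a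
direction that does not depend on the configuration.\<close>

lemma local_field_switch_first:
  assumes "j k Z \<bullet> (gp - gm) = 0"
  shows "local_field G j k l Z1 gp gl Z = local_field G j k l Z1 gm gl Z + (j k Z \<bullet> gp) *\<^sub>R axis k (gp - gm)"
proof -
  have "j k Z \<bullet> gm = j k Z \<bullet> gp" using assms by (simp add: inner_diff_right)
  then show ?thesis by (simp add: vec_eq_iff local_field_nth axis_def right_diff_distrib)
qed

lemma local_field_switch_second:
  assumes "j l Z \<bullet> (gp - gm) = 0" "k \<noteq> l"
  shows "local_field G j k l Z1 gk gp Z = local_field G j k l Z1 gk gm Z + (j l Z \<bullet> gp) *\<^sub>R axis l (gp - gm)"
proof -
  have "j l Z \<bullet> gm = j l Z \<bullet> gp" using assms by (simp add: inner_diff_right)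
  then show ?thesis using assms(2) by (auto simp: vec_eq_iff local_field_nth axis_def right_diff_distrib)
qed

lemma velocity_set_local_field:
  assumes V: "V \<in> velocity_set G j Z" and sub: "\<And>i. glide_set G j i Z \<subseteq> glide_set G j i Z1"
    and single: "\<And>i. i \<noteq> k \<Longrightarrow> i \<noteq> l \<Longrightarrow> \<exists>g. glide_set G j i Z1 = {g}"
  shows "\<exists>gk\<in>glide_set G j k Z. \<exists>gl\<in>glide_set G j l Z. V = local_field G j k l Z1 gk gl Z"
proof -
  have "\<exists>g. g \<in> glide_set G j i Z \<and> V $ i = (j i Z \<bullet> g) *\<^sub>R g" for i using V unfolding velocity_set_def by blast
  then obtain g where g: "\<And>i. g i \<in> glide_set G j i Z" "\<And>i. V $ i = (j i Z \<bullet> g i) *\<^sub>R g i" by metis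
  have "V = local_field G j k l Z1 (g k) (g l) Z"
  proof (rule iffD2[OF vec_eq_iff], rule allI)
    fix i
    have "i \<noteq> k \<Longrightarrow> i \<noteq> l \<Longrightarrow> g i = the_elem (glide_set G j i Z1)"
      using single[of i] sub[of i] g(1)[of i] by auto
    then show "V $ i = local_field G j k l Z1 (g k) (g l) Z $ i" unfolding local_field_nth g(2) by auto
  qed
  then show ?thesis using g(1) by blast
qed

lemma inclusion_solution_restrict:
  assumes W: "inclusion_solution \<Omega> G j I W" and sub: "{a..b} \<subseteq> I"
  shows "trajectory_on (\<lambda>Z. convex hull velocity_set G j Z) a b W"
  unfolding trajectory_on_def
proof
  show "absolutely_continuous_fun_on {a..b} W"
    using W sub absolutely_continuous_fun_on_subset unfolding inclusion_solution_def by blast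
  have "AE t in lebesgue. t \<in> I \<longrightarrow> (\<exists>v\<in>convex hull velocity_set G j (W t). (W has_vector_derivative v) (at t within I))"
    using W unfolding inclusion_solution_def by blast
  then show "AE t in lebesgue. t \<in> {a<..<b} \<longrightarrow> (\<exists>v\<in>convex hull velocity_set G j (W t). (W has_vector_derivative v) (at t within {a..b}))"
  proof (rule AE_mp, intro AE_I2 impI)
    fix t assume 1: "t \<in> I \<longrightarrow> (\<exists>v\<in>convex hull velocity_set G j (W t). (W has_vector_derivative v) (at t within I))" "t \<in> {a<..<b}"
    then have "t \<in> I" using sub by auto
    with 1 obtain v where "v \<in> convex hull velocity_set G j (W t)" "(W has_vector_derivative v) (at t within I)" by blast
    then show "\<exists>v\<in>convex hull velocity_set G j (W t). (W has_vector_derivative v) (at t within {a..b})"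
      using has_vector_derivative_within_subset[OF _ sub] by blast
  qed
qed

theorem theorem3p1:
  fixes \<Omega> :: "plane set" and nrm :: "plane \<Rightarrow> plane" and \<gamma> \<mu> lam :: real
    and b :: "'n::finite \<Rightarrow> real"
    and u0 :: "plane^'n \<Rightarrow> plane \<Rightarrow> real"
    and j :: "'n \<Rightarrow> plane^'n \<Rightarrow> plane"
    and G :: "plane set"
    and Z :: "real \<Rightarrow> plane^'n" and Z0 Z1 :: "plane^'n"
    and T t1 :: real
    and k l :: 'n
    and gkp gkm glp glm :: plane
    and nk nl :: "plane^'n"
  assumes "bounded \<Omega>" and "open \<Omega>" and "simply_connected \<Omega>"
    and "0 < \<gamma>" and "\<gamma> < 1" and "C2_holder_boundary \<gamma> \<Omega>"
    and "\<forall>x\<in>frontier \<Omega>. outer_unit_normal \<gamma> \<Omega> x (nrm x)"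
    and "\<mu> > 0" and "lam \<noteq> 0"
    and "\<forall>Y\<in>configurations \<Omega>. neumann_solution \<Omega> nrm \<mu> lam b Y (u0 Y)"
    and "j = peach_koehler \<mu> lam b u0"
    and "glide_directions G"
    and "T > 0"
    and "inclusion_solution \<Omega> G j {-T..T} Z" and "Z 0 = Z0" and "Z0 \<in> configurations \<Omega>"
    and "k \<noteq> l"
    and "Z1 \<in> ambiguity_set \<Omega> G j l \<inter> ambiguity_set \<Omega> G j k"
    and "\<forall>i. i \<noteq> k \<and> i \<noteq> l \<longrightarrow> Z1 \<notin> ambiguity_set \<Omega> G j i"
    and "Z1 \<notin> zero_force_set \<Omega> j \<union> singular_set \<Omega> G j l \<union> singular_set \<Omega> G j k"
    and "glide_set G j k Z1 = {gkp, gkm}" and "glide_set G j l Z1 = {glp, glm}"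
    and "ambiguity_normal \<Omega> G j k Z1 gkp gkm nk"
    and "ambiguity_normal \<Omega> G j l Z1 glp glm nl"
    and "local_field G j k l Z1 gkp glp Z1 \<bullet> nk < 0" and "local_field G j k l Z1 gkp glp Z1 \<bullet> nl < 0"
    and "local_field G j k l Z1 gkp glm Z1 \<bullet> nk < 0" and "local_field G j k l Z1 gkp glm Z1 \<bullet> nl > 0"
    and "local_field G j k l Z1 gkm glp Z1 \<bullet> nk > 0" and "local_field G j k l Z1 gkm glp Z1 \<bullet> nl < 0"
    and "local_field G j k l Z1 gkm glm Z1 \<bullet> nk > 0" and "local_field G j k l Z1 gkm glm Z1 \<bullet> nl > 0"
    and "t1 \<in> {-T..<T}" and "Z t1 = Z1"
  shows "\<exists>\<delta>>0. t1 + \<delta> \<le> T \<and>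
           (\<forall>I I' W W'. is_interval I \<and> is_interval I' \<and> t1 \<in> I \<and> t1 \<in> I' \<and>
              inclusion_solution \<Omega> G j I W \<and> inclusion_solution \<Omega> G j I' W' \<and>
              W t1 = Z1 \<and> W' t1 = Z1 \<longrightarrow>
              (\<forall>t \<in> I \<inter> I' \<inter> {t1..t1 + \<delta>}. W t = W' t)) \<and>
           (\<forall>t\<in>{t1..t1 + \<delta>}. Z t \<in> ambiguity_set \<Omega> G j k \<inter> ambiguity_set \<Omega> G j l)"
proof -
  have Z1c: "Z1 \<in> configurations \<Omega>" using assms(18) by (simp add: ambiguity_set_def)
  have ambk: "Z1 \<in> ambiguity_set \<Omega> G j k" and ambl: "Z1 \<in> ambiguity_set \<Omega> G j l" using assms(18) by auto
  have G: "finite G" "G \<noteq> {}" "\<And>g. g \<in> G \<Longrightarrow> norm g = 1"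
  proof -
    show "finite G" "\<And>g. g \<in> G \<Longrightarrow> norm g = 1" using assms(12) by (auto simp: glide_directions_def)
    show "G \<noteq> {}" using assms(21) by (auto simp: glide_set_eq)
  qed
  have j0: "j i Z1 \<noteq> 0" for i using assms(20) Z1c by (auto simp: zero_force_set_def)
  have "\<exists>\<delta>>0. ball Z1 \<delta> \<subseteq> configurations \<Omega> \<and> uniformly_C11 {()} (ball Z1 \<delta>) (\<lambda>_. j i)" for i
    unfolding assms(11)
    by (rule peach_koehler_locally_C11[OF assms(2,1,3,7,9,8,10) Z1c])
  then obtain dl where dl: "\<And>i. dl i > 0" "\<And>i. ball Z1 (dl i) \<subseteq> configurations \<Omega>"
    "\<And>i. uniformly_C11 {()} (ball Z1 (dl i)) (\<lambda>_. j i)" by metis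
  define r0 where "r0 = Min (range dl)"
  have r0: "r0 > 0" using dl(1) by (simp add: r0_def)
  have r0dl: "r0 \<le> dl i" for i by (simp add: r0_def)
  have r0c: "ball Z1 r0 \<subseteq> configurations \<Omega>" using dl(2)[of k] subset_ball[OF r0dl[of k], of Z1] by blast
  have C11: "uniformly_C11 {()} (ball Z1 r0) (\<lambda>_. j i)" for i
    by (rule uniformly_C11_subset[OF dl(3) subset_ball[OF r0dl]])
  have "\<exists>j' B. C11_data {()} (ball Z1 r0) (\<lambda>_. j i) j' B" for i
    by (rule uniformly_C11E[OF C11 convex_ball])
  then obtain j' Bj where jd: "\<And>i. C11_data {()} (ball Z1 r0) (\<lambda>_. j i) (j' i) (Bj i)" by metis
  have jLip: "norm (j i x - j i y) \<le> Bj i * norm (x - y)" if "x \<in> ball Z1 r0" "y \<in> ball Z1 r0" for i x y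
    using C11_dataD(6)[OF jd, of "()" x y i] that by simp
  have Bj: "Bj i > 0" for i by (rule C11_dataD(1)[OF jd])
  have jcont: "isCont (j i) Z1" for i
    using C11_dataD(2)[OF jd, of "()" Z1 i] r0 by (auto intro: has_derivative_continuous)
  define \<phi> where "\<phi> Z = j k Z \<bullet> (gkp - gkm)" for Z
  define \<psi> where "\<psi> Z = j l Z \<bullet> (glp - glm)" for Z
  obtain ck where ck: "ck > 0" "strictly_differentiable \<phi> (\<lambda>v. ck * (v \<bullet> nk)) Z1"
    using ambiguity_surface_normal[OF G(1,2) ambk _ assms(21,23) r0 r0c C11] assms(20) unfolding \<phi>_def[abs_def] by blast
  obtain cl where cl: "cl > 0" "strictly_differentiable \<psi> (\<lambda>v. cl * (v \<bullet> nl)) Z1"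
    using ambiguity_surface_normal[OF G(1,2) ambl _ assms(22,24) r0 r0c C11] assms(20) unfolding \<psi>_def[abs_def] by blast
  define p where "p v = ck * (v \<bullet> nk)" for v
  define q where "q v = cl * (v \<bullet> nl)" for v
  have plin: "linear p" and qlin: "linear q"
    unfolding p_def[abs_def] q_def[abs_def] by (auto intro!: linearI simp: inner_add_left algebra_simps)
  have gG: "gkp \<in> G" "gkm \<in> G" "glp \<in> G" "glm \<in> G"
    using assms(21,22) by (auto simp: glide_set_eq)
  have gne: "gkp \<noteq> gkm" "glp \<noteq> glm" using ambk ambl assms(21,22) by (auto simp: ambiguity_set_def)
  have \<phi>0: "\<phi> Z1 = 0"
  proof -
    have "gkp \<in> glide_set G j k Z1" "gkm \<in> glide_set G j k Z1" using assms(21) by auto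
    then show ?thesis by (auto simp: \<phi>_def inner_diff_right glide_set_eq intro: antisym)
  qed
  have \<psi>0: "\<psi> Z1 = 0"
  proof -
    have "glp \<in> glide_set G j l Z1" "glm \<in> glide_set G j l Z1" using assms(22) by auto
    then show ?thesis by (auto simp: \<psi>_def inner_diff_right glide_set_eq intro: antisym)
  qed
  have single: "\<exists>g. glide_set G j i Z1 = {g}" if "i \<noteq> k" "i \<noteq> l" for i
  proof (rule glide_set_singleton[where j = j and l = i and Z = Z1, OF G j0])
    show "card (glide_set G j i Z1) \<noteq> 2" using assms(19) that Z1c by (auto simp: ambiguity_set_def)
  qed
  define F where "F gk gl = local_field G j k l Z1 gk gl" for gk gl
  have Fcont: "isCont (F gk gl) Z1" for gk gl unfolding F_def by (rule isCont_local_field[OF jcont])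
  have pos: "0 < c \<Longrightarrow> 0 < x \<Longrightarrow> 0 < c * x" "0 < c \<Longrightarrow> x < 0 \<Longrightarrow> c * x < 0" for c x :: real
    by (simp_all add: mult_pos_neg)
  note signs = assms(25-32)[folded F_def]
  define B where "B = (norm (F gkp glp Z1) + norm (F gkp glm Z1) + norm (F gkm glp Z1) + norm (F gkm glm Z1)) + 1"
  have nB: "norm (F gkp glp Z1) < B" "norm (F gkp glm Z1) < B" "norm (F gkm glp Z1) < B" "norm (F gkm glm Z1) < B"
    unfolding B_def
    using norm_ge_zero[of "F gkp glp Z1"] norm_ge_zero[of "F gkp glm Z1"]
      norm_ge_zero[of "F gkm glp Z1"] norm_ge_zero[of "F gkm glm Z1"] by linarith+
  \<comment> \<open>The eight sign conditions, and bounds for the four fields, as functions that are negative at \<open>Z1\<close>.\<close>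
  define Fs where "Fs = [\<lambda>Z. p (F gkp glp Z), \<lambda>Z. p (F gkp glm Z), \<lambda>Z. - p (F gkm glp Z), \<lambda>Z. - p (F gkm glm Z),
      \<lambda>Z. q (F gkp glp Z), \<lambda>Z. - q (F gkp glm Z), \<lambda>Z. q (F gkm glp Z), \<lambda>Z. - q (F gkm glm Z),
      \<lambda>Z. norm (F gkp glp Z) - B, \<lambda>Z. norm (F gkp glm Z) - B, \<lambda>Z. norm (F gkm glp Z) - B, \<lambda>Z. norm (F gkm glm Z) - B]"
  have "\<exists>\<eta>>0. eventually (\<lambda>y. \<forall>F\<in>set Fs. F y \<le> - \<eta>) (nhds Z1)"
  proof (rule eventually_uniformly_negative)
    fix f assume f: "f \<in> set Fs"
    have "isCont f Z1"
      using f unfolding Fs_def p_def q_def by (auto intro!: continuous_intros Fcont)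
    moreover have "f Z1 < 0"
      using f signs ck(1) cl(1) pos nB unfolding Fs_def p_def q_def by auto
    ultimately show "isCont f Z1 \<and> f Z1 < 0" by simp
  qed
  then obtain \<eta> where \<eta>: "\<eta> > 0" "eventually (\<lambda>y. \<forall>F\<in>set Fs. F y \<le> - \<eta>) (nhds Z1)" by blast
  have "eventually (\<lambda>Z. \<forall>i. glide_set G j i Z \<subseteq> glide_set G j i Z1) (nhds Z1)"
    by (intro eventually_all_finite glide_set_upper_semicontinuous[where j = j and ?Z1.0 = Z1, OF G(1,2)] jcont)
  from eventually_conj[OF \<eta>(2) this] obtain r1 where r1: "r1 > 0"
    "\<And>Z. dist Z Z1 < r1 \<Longrightarrow> (\<forall>F\<in>set Fs. F Z \<le> - \<eta>) \<and> (\<forall>i. glide_set G j i Z \<subseteq> glide_set G j i Z1)"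
    unfolding eventually_nhds_metric by blast
  define r where "r = min r0 r1"
  have r: "r > 0" "ball Z1 r \<subseteq> ball Z1 r0" using r0 r1 by (auto simp: r_def)
  have near: "\<forall>F\<in>set Fs. F Z \<le> - \<eta>" "\<And>i. glide_set G j i Z \<subseteq> glide_set G j i Z1" if "Z \<in> ball Z1 r" for Z
    using r1(2)[of Z] that by (auto simp: r_def dist_commute)
  have subk: "glide_set G j k Z \<subseteq> {gkp, gkm}" and subl: "glide_set G j l Z \<subseteq> {glp, glm}" if "Z \<in> ball Z1 r" for Z
    using near(2)[OF that] assms(21,22) by auto
  note gk = glide_set_two_directions[OF G(1,2) subk gG(1,2), folded \<phi>_def]
  note gl = glide_set_two_directions[OF G(1,2) subl gG(3,4), folded \<psi>_def]
  define H where "H Z = convex hull velocity_set G j Z" for Z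
  have vel: "\<exists>a\<in>glide_set G j k Z. \<exists>b\<in>glide_set G j l Z. V = F a b Z" if "Z \<in> ball Z1 r" "V \<in> velocity_set G j Z" for Z V
    unfolding F_def by (rule velocity_set_local_field[OF that(2) near(2)[OF that(1)] single])
  \<comment> \<open>Every property needed of velocities is membership in a convex set, so it suffices to check it for
the at most four local fields.\<close>
  have hull: "v \<in> C"
    if "v \<in> H Z" "Z \<in> ball Z1 r" "convex C" "\<And>a b. a \<in> glide_set G j k Z \<Longrightarrow> b \<in> glide_set G j l Z \<Longrightarrow> F a b Z \<in> C" for v Z C
  proof -
    have "velocity_set G j Z \<subseteq> C" using vel[OF that(2)] that(4) by blast
    then have "H Z \<subseteq> C" unfolding H_def by (rule hull_minimal) (rule that(3))
    then show ?thesis using that(1) by blast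
  qed
  have cvx: "convex {v. f v \<le> a}" if "linear f" for f :: "plane^'n \<Rightarrow> real" and a
  proof -
    have "{v. f v \<le> a} = f -` {..a}" by auto
    then show ?thesis using convex_linear_vimage[OF that] by simp
  qed
  have bnd: "norm (F a b Z) \<le> B" "a = gkp \<Longrightarrow> p (F a b Z) \<le> - \<eta>" "a = gkm \<Longrightarrow> - p (F a b Z) \<le> - \<eta>"
      "b = glp \<Longrightarrow> q (F a b Z) \<le> - \<eta>" "b = glm \<Longrightarrow> - q (F a b Z) \<le> - \<eta>"
    if "Z \<in> ball Z1 r" "a = gkp \<or> a = gkm" "b = glp \<or> b = glm" for a b Z
    using near(1)[OF that(1)] that(2,3) \<eta>(1) gne by (auto simp: Fs_def)
  define E where "E = (axis k (gkp - gkm) :: plane^'n)"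
  define E' where "E' = (axis l (glp - glm) :: plane^'n)"
  have swk: "F gkp b Z = F gkm b Z + (j k Z \<bullet> gkp) *\<^sub>R E" if "\<phi> Z = 0" for b Z
    using local_field_switch_first[where j = j and k = k and Z = Z and gp = gkp and gm = gkm] that
    by (simp add: F_def E_def \<phi>_def)
  have swl: "F a glp Z = F a glm Z + (j l Z \<bullet> glp) *\<^sub>R E'" if "\<psi> Z = 0" for a Z
    using local_field_switch_second[where j = j and l = l and k = k and Z = Z and gp = glp and gm = glm] that assms(17)
    by (simp add: F_def E'_def \<psi>_def)
  have det: "p E * q E' - p E' * q E \<noteq> 0"
  proof -
    define s t where "s = j k Z1 \<bullet> gkp" and "t = j l Z1 \<bullet> glp"
    have e1: "F gkp glm Z1 = F gkm glm Z1 + s *\<^sub>R E" "F gkm glp Z1 = F gkm glm Z1 + t *\<^sub>R E'"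
      "F gkp glp Z1 = F gkm glm Z1 + t *\<^sub>R E' + s *\<^sub>R E"
      using swk[OF \<phi>0] swl[OF \<psi>0] by (simp_all add: s_def t_def)
    have P: "p (F gkp glm Z1) = p (F gkm glm Z1) + s * p E" "p (F gkm glp Z1) = p (F gkm glm Z1) + t * p E'"
      "p (F gkp glp Z1) = p (F gkm glm Z1) + s * p E + t * p E'"
      "q (F gkp glm Z1) = q (F gkm glm Z1) + s * q E" "q (F gkm glp Z1) = q (F gkm glm Z1) + t * q E'"
      "q (F gkp glp Z1) = q (F gkm glm Z1) + s * q E + t * q E'"
      unfolding e1 by (simp_all add: linear_add[OF plin] linear_scale[OF plin] linear_add[OF qlin] linear_scale[OF qlin])
    have sg: "p (F gkp glp Z1) < 0" "q (F gkp glp Z1) < 0" "p (F gkp glm Z1) < 0" "q (F gkp glm Z1) > 0"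
      "p (F gkm glp Z1) > 0" "q (F gkm glp Z1) < 0" "p (F gkm glm Z1) > 0" "q (F gkm glm Z1) > 0"
      unfolding p_def q_def using signs ck(1) cl(1) pos by blast+
    have "(s * p E) * (t * q E') - (t * p E') * (s * q E) \<noteq> 0"
      by (rule sliding_determinant[OF sg[unfolded P]])
    moreover have "(s * p E) * (t * q E') - (t * p E') * (s * q E) = (s * t) * (p E * q E' - p E' * q E)"
      by (simp add: algebra_simps)
    ultimately show ?thesis by auto
  qed
  obtain L where L: "L \<ge> 0" "\<And>x y. x \<in> ball Z1 r \<Longrightarrow> y \<in> ball Z1 r \<Longrightarrow> norm (F gkm glm x - F gkm glm y) \<le> L * norm (x - y)"
    using local_field_Lipschitz[where j = j and U = "ball Z1 r0" and B = Bj and G = G and k = k and l = l and ?Z1.0 = Z1 and gk = gkm and gl = glm] jLip Bj r(2)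
    unfolding F_def by (meson subsetD)
  have sd: "strictly_differentiable \<phi> p Z1" "strictly_differentiable \<psi> q Z1"
    using ck(2) cl(2) by (simp_all add: p_def[abs_def] q_def[abs_def])
  have Bpos: "B > 0" by (simp add: B_def add_nonneg_pos)
  have H0: "\<exists>\<alpha> \<beta>. v = F gkm glm x + \<alpha> *\<^sub>R E + \<beta> *\<^sub>R E'"
    if x: "x \<in> ball Z1 r" and v: "v \<in> H x" and z: "\<phi> x = 0" "\<psi> x = 0" for x v
  proof -
    define C where "C = {F gkm glm x + \<alpha> *\<^sub>R E + \<beta> *\<^sub>R E' | \<alpha> \<beta>. True}"
    have "v \<in> C"
    proof (rule hull[OF v x])
      show "convex C"
      proof (rule convexI)
        fix y z and u w :: real assume "y \<in> C" "z \<in> C" and uw: "0 \<le> u" "0 \<le> w" "u + w = 1"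
        then obtain a1 b1 a2 b2 where "y = F gkm glm x + a1 *\<^sub>R E + b1 *\<^sub>R E'" "z = F gkm glm x + a2 *\<^sub>R E + b2 *\<^sub>R E'"
          by (auto simp: C_def)
        then have "u *\<^sub>R y + w *\<^sub>R z = (u + w) *\<^sub>R F gkm glm x + (u * a1 + w * a2) *\<^sub>R E + (u * b1 + w * b2) *\<^sub>R E'"
          by (simp add: algebra_simps)
        then show "u *\<^sub>R y + w *\<^sub>R z \<in> C" using uw by (auto simp: C_def)
      qed
      fix a b assume "a \<in> glide_set G j k x" "b \<in> glide_set G j l x"
      then have ab: "a = gkp \<or> a = gkm" "b = glp \<or> b = glm" using subk[OF x] subl[OF x] by auto
      have m: "F gkm glm x + \<alpha> *\<^sub>R E + \<beta> *\<^sub>R E' \<in> C" for \<alpha> \<beta> by (auto simp: C_def)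
      show "F a b x \<in> C"
        using ab m[of 0 0] m[of "j k x \<bullet> gkp" 0] m[of 0 "j l x \<bullet> glp"] m[of "j k x \<bullet> gkp" "j l x \<bullet> glp"]
        by (auto simp: swk[OF z(1)] swl[OF z(2)] add_ac)
    qed
    then show ?thesis by (auto simp: C_def)
  qed
  obtain \<delta> where \<delta>: "\<delta> > 0"
    and slide: "\<And>a b W t. b \<le> a + \<delta> \<Longrightarrow> trajectory_on H a b W \<Longrightarrow> W a = Z1 \<Longrightarrow> t \<in> {a..b} \<Longrightarrow>
       W t \<in> ball Z1 r \<and> \<phi> (W t) = 0 \<and> \<psi> (W t) = 0"
    and unique: "\<And>a b W W' t. b \<le> a + \<delta> \<Longrightarrow> trajectory_on H a b W \<Longrightarrow> W a = Z1 \<Longrightarrow>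
       trajectory_on H a b W' \<Longrightarrow> W' a = Z1 \<Longrightarrow> t \<in> {a..b} \<Longrightarrow> W t = W' t"
  proof (rule codimension_two_sliding[OF sd(1) \<phi>0 sd(2) \<psi>0 det r(1) \<eta>(1) Bpos _ _ _ _ _ H0 L(2) L(1)])
    fix x v assume x: "x \<in> ball Z1 r" and v: "v \<in> H x"
    have ab: "a = gkp \<or> a = gkm" "b = glp \<or> b = glm" if "a \<in> glide_set G j k x" "b \<in> glide_set G j l x" for a b
      using subk[OF x] subl[OF x] that by auto
    have "v \<in> cball 0 B"
      by (rule hull[OF v x convex_cball]) (use bnd(1)[OF x ab] in simp)
    then show "norm v \<le> B" by simp
    show "p v \<le> - \<eta>" if "\<phi> x > 0"
    proof -
      have "v \<in> {v. p v \<le> - \<eta>}"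
        by (rule hull[OF v x cvx[OF plin]]) (use bnd(2)[OF x ab] gk(1)[OF x that] in auto)
      then show ?thesis by simp
    qed
    show "p v \<ge> \<eta>" if "\<phi> x < 0"
    proof -
      have "v \<in> {v. - p v \<le> - \<eta>}"
        by (rule hull[OF v x cvx[OF linear_compose_neg[OF plin]]]) (use bnd(3)[OF x ab] gk(2)[OF x that] in auto)
      then show ?thesis by simp
    qed
    show "q v \<le> - \<eta>" if "\<psi> x > 0"
    proof -
      have "v \<in> {v. q v \<le> - \<eta>}"
        by (rule hull[OF v x cvx[OF qlin]]) (use bnd(4)[OF x ab] gl(1)[OF x that] in auto)
      then show ?thesis by simp
    qed
    show "q v \<ge> \<eta>" if "\<psi> x < 0"
    proof -
      have "v \<in> {v. - q v \<le> - \<eta>}"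
        by (rule hull[OF v x cvx[OF linear_compose_neg[OF qlin]]]) (use bnd(5)[OF x ab] gl(2)[OF x that] in auto)
      then show ?thesis by simp
    qed
  next
    fix \<delta> :: real
    assume "\<delta> > 0"
      and "\<And>a b W t. b \<le> a + \<delta> \<Longrightarrow> trajectory_on H a b W \<Longrightarrow> W a = Z1 \<Longrightarrow> t \<in> {a..b} \<Longrightarrow>
         W t \<in> ball Z1 r \<and> \<phi> (W t) = 0 \<and> \<psi> (W t) = 0"
      and "\<And>a b W W' t. b \<le> a + \<delta> \<Longrightarrow> trajectory_on H a b W \<Longrightarrow> W a = Z1 \<Longrightarrow>
         trajectory_on H a b W' \<Longrightarrow> W' a = Z1 \<Longrightarrow> t \<in> {a..b} \<Longrightarrow> W t = W' t"
    then show thesis by (rule that)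
  qed
  have restr: "trajectory_on H a b W" if "inclusion_solution \<Omega> G j I W" "{a..b} \<subseteq> I" for I W a b
    using inclusion_solution_restrict[OF that] by (simp add: H_def[abs_def])
  show ?thesis
  proof (intro exI[of _ "min \<delta> (T - t1)"] conjI allI impI ballI)
    show "0 < min \<delta> (T - t1)" "t1 + min \<delta> (T - t1) \<le> T" using \<delta> assms(33) by auto
  next
    fix I I' W W' t
    assume A: "is_interval I \<and> is_interval I' \<and> t1 \<in> I \<and> t1 \<in> I' \<and>
              inclusion_solution \<Omega> G j I W \<and> inclusion_solution \<Omega> G j I' W' \<and> W t1 = Z1 \<and> W' t1 = Z1"
      and t: "t \<in> I \<inter> I' \<inter> {t1..t1 + min \<delta> (T - t1)}"
    have sub: "{t1..t} \<subseteq> I" "{t1..t} \<subseteq> I'"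

    proof -
      have seg: "{t1..t} \<subseteq> J" if "is_interval J" "t1 \<in> J" "t \<in> J" for J
      proof
        fix s assume "s \<in> {t1..t}"
        then show "s \<in> J" using mem_is_interval_1_I[OF that, of s] by simp
      qed
      show "{t1..t} \<subseteq> I" by (rule seg) (use A t in blast)+
      show "{t1..t} \<subseteq> I'" by (rule seg) (use A t in blast)+
    qed
    show "W t = W' t"
    proof (rule unique[where a = t1 and b = t])
      show "trajectory_on H t1 t W" "trajectory_on H t1 t W'" using A sub restr by blast+
    qed (use A t in auto)
  next
    fix t assume t: "t \<in> {t1..t1 + min \<delta> (T - t1)}"
    have sub: "{t1..t} \<subseteq> {-T..T}" using t assms(33) by auto
    have "Z t \<in> ball Z1 r \<and> \<phi> (Z t) = 0 \<and> \<psi> (Z t) = 0"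
      by (rule slide[where a = t1 and b = t, OF _ restr[OF assms(14) sub] assms(34)]) (use t in auto)
    then have "glide_set G j k (Z t) = {gkp, gkm}" "glide_set G j l (Z t) = {glp, glm}" "Z t \<in> configurations \<Omega>"
      using gk(3) gl(3) r(2) r0c by auto
    then show "Z t \<in> ambiguity_set \<Omega> G j k \<inter> ambiguity_set \<Omega> G j l"
      using gne by (simp add: ambiguity_set_def)
  qed
qed

end
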